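(* Let $p,q$ be distinct primes (possibly even) and let $m,n$ be positive integers. Then $K_1(G)=K_1^*(G)$ for each of the following groups $G$: (1) $C_{p^m}\oplus C_p$; (2) $C_{p^m}\oplus C_q$; (3) $C_{p^m}\oplus C_q^2$; (4) $C_{p^m}\oplus C_2^n$; (5) $C_{p^m}\oplus C_3^n$.
   Context: Groups are finite abelian, written additively; $C_n$ is the cyclic group of order $n$. An indexed multiset $S=\{g_1,\ldots,g_\ell\}$ over a set $X\subseteq G$ is a finite (possibly empty) indexed family of elements of $X$; for $I\subseteq[\ell]$ put $S(I)=\{g_i : i\in I\}$, and submultisets of $S$ are the $S(I)$. Put $\sigma(S)=\sum_{g\in S}g$ (with multiplicity), $\sigma(\emptyset)=0$. $S$ is zero-sum if $\sigma(S)=0$; minimal zero-sum if $\sigma(S)=0$ and $\sigma(S')\ne0$ for every $\emptyset\subsetneq S'\subsetneq S$. An irreducible factorization of $S$ over $G\setminus\{0\}$ is a partition $[\ell]=\bigsqcup_{i=1}^m I_i$ into nonempty sets with each $S(I_i)$ minimal zero-sum; two factorizations are equivalent iff they are the same set of blocks $\{I_1,\ldots,I_m\}$. A unique factorization indexed multiset (UFIM) over $G\setminus\{0\}$ is a zero-sum indexed multiset over $G\setminus\{0\}$ with exactly one irreducible factorization up to equivalence. The cross number of $S$ is $k(S)=\sum_{g\in S}\frac1{\mathrm{ord}(g)}$ (with multiplicity; $k(\emptyset)=0$), and $K_1(G)=\max\{k(S): S\text{ is a UFIM over }G\setminus\{0\}\}$. For $G=\bigoplus_{i=1}^n\bigoplus_{j=1}^{n_i}C_{p_i^{e_{ij}}}$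 written as a direct sum of prime-power cyclic groups with distinct primes $p_i$, $K_1^*(G)=\sum_{i=1}^n\sum_{j=1}^{n_i}\frac{p_i^{e_{ij}}-1}{p_i^{e_{ij}}-p_i^{e_{ij}-1}}=\sum_{i}\sum_{j}\sum_{k=1}^{e_{ij}}\frac1{p_i^{k-1}}$. *)

theory Defs
  imports Complex_Main "HOL-Library.Disjoint_Sets" "HOL-Library.Multiset" "HOL-Algebra.FiniteProduct"
    "HOL-Algebra.Multiplicative_Group" "HOL-Algebra.Product_Groups"
    "HOL-Computational_Algebra.Primes"
begin

text \<open>
  Groups are those of HOL-Algebra and hence written multiplicatively: \<open>\<one>\<close> plays the role of the zero
  element and \<open>finprod\<close> that of the sum. An indexed multiset with index set \<open>[\<ell>]\<close> is a list
  \<open>S\<close> of length \<open>\<ell>\<close>, indexed from \<open>0\<close>; the submultiset \<open>S(I)\<close> is represented by the index set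
  \<open>I \<subseteq> {..<length S}\<close>, so that equal elements at different indices stay distinguishable.
\<close>

definition sigma :: "('a, 'b) monoid_scheme \<Rightarrow> 'a list \<Rightarrow> nat set \<Rightarrow> 'a" where
  "sigma G S I = finprod G (\<lambda>i. S ! i) I"

definition zero_sum :: "('a, 'b) monoid_scheme \<Rightarrow> 'a list \<Rightarrow> nat set \<Rightarrow> bool" where
  "zero_sum G S I \<longleftrightarrow> sigma G S I = \<one>\<^bsub>G\<^esub>"

definition minimal_zero_sum :: "('a, 'b) monoid_scheme \<Rightarrow> 'a list \<Rightarrow> nat set \<Rightarrow> bool" where
  "minimal_zero_sum G S I \<longleftrightarrow>
     zero_sum G S I \<and> (\<forall>J. J \<noteq> {} \<and> J \<subset> I \<longrightarrow> \<not> zero_sum G S J)"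

text \<open>A factorization is its set of blocks, so equivalent factorizations are equal.\<close>

definition irreducible_factorization ::
    "('a, 'b) monoid_scheme \<Rightarrow> 'a list \<Rightarrow> nat set set \<Rightarrow> bool" where
  "irreducible_factorization G S P \<longleftrightarrow>
     partition_on {..<length S} P \<and> (\<forall>I\<in>P. minimal_zero_sum G S I)"

definition ufim :: "('a, 'b) monoid_scheme \<Rightarrow> 'a list \<Rightarrow> bool" where
  "ufim G S \<longleftrightarrow>
     set S \<subseteq> carrier G - {\<one>\<^bsub>G\<^esub>} \<and>
     zero_sum G S {..<length S} \<and>
     (\<exists>!P. irreducible_factorization G S P)"

definition cross_number :: "('a, 'b) monoid_scheme \<Rightarrow> 'a list \<Rightarrow> real" where
  "cross_number G S = (\<Sum>g\<leftarrow>S. 1 / real (group.ord G g))"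

definition K1 :: "('a, 'b) monoid_scheme \<Rightarrow> real" where
  "K1 G = Max {cross_number G S |S. ufim G S}"

text \<open>
  A list of pairs \<open>(p, e)\<close> stands for the direct sum of the cyclic groups of order \<open>p ^ e\<close>.
  Repeated primes are allowed, so the double index \<open>(i, j)\<close> is flattened into one.
\<close>

definition cyclic_sum :: "(nat \<times> nat) list \<Rightarrow> (nat \<Rightarrow> int) monoid" where
  "cyclic_sum ds =
     product_group {..<length ds} (\<lambda>i. integer_mod_group (fst (ds ! i) ^ snd (ds ! i)))"

definition prime_power_decomposition ::
    "('a, 'b) monoid_scheme \<Rightarrow> (nat \<times> nat) list \<Rightarrow> bool" where
  "prime_power_decomposition G ds \<longleftrightarrow>
     (\<forall>(p, e)\<in>set ds. prime p \<and> 0 < e) \<and> G \<cong> cyclic_sum ds"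

definition K1_star_of :: "(nat \<times> nat) list \<Rightarrow> real" where
  "K1_star_of ds =
     (\<Sum>(p, e)\<leftarrow>ds. (real p ^ e - 1) / (real p ^ e - real p ^ (e - 1)))"

text \<open>The value does not depend on the decomposition, see \<open>K1_star_eq\<close> below.\<close>

definition K1_star :: "('a, 'b) monoid_scheme \<Rightarrow> real" where
  "K1_star G = (THE x. \<exists>ds. prime_power_decomposition G ds \<and> x = K1_star_of ds)"

lemma group_cyclic_sum: "group (cyclic_sum ds)"
  by (simp add: cyclic_sum_def)

lemma card_torsion_cyclic:
  fixes n m :: nat
  assumes "n > 0"
  shows "card {x \<in> {0..<int n}. (int m * x) mod int n = 0} = gcd m n"
proof -
  define g where "g = gcd m n"
  define d where "d = n div g"
  have g: "g > 0" "n = g * d" using assms by (auto simp: g_def d_def)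
  have d: "d > 0" using g assms by (cases d) auto
  have "int n dvd int m * x \<longleftrightarrow> int d dvd x" for x
  proof -
    obtain m' where m': "m = g * m'" unfolding g_def by (metis gcd_dvd1 dvd_def)
    have "g * gcd m' d = g" using g m' g_def by (metis gcd_mult_distrib_nat)
    then have cop: "coprime m' d" using g by (simp add: coprime_iff_gcd_eq_1)
    have "int n dvd int m * x \<longleftrightarrow> int g * int d dvd int g * (int m' * x)"
      by (simp add: g m' mult.assoc)
    also have "\<dots> \<longleftrightarrow> int d dvd int m' * x" using g by simp
    also have "\<dots> \<longleftrightarrow> int d dvd x"
      using cop by (simp add: coprime_dvd_mult_right_iff coprime_commute)
    finally show ?thesis .
  qed
  then have "{x \<in> {0..<int n}. (int m * x) mod int n = 0} = {x \<in> {0..<int n}. int d dvd x}"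
    by (auto simp: mod_eq_0_iff_dvd)
  also have "\<dots> = (\<lambda>k. int d * int k) ` {..<g}"
  proof (intro equalityI subsetI)
    fix x assume x: "x \<in> {x \<in> {0..<int n}. int d dvd x}"
    then obtain k where k: "x = int d * k" by (auto elim: dvdE)
    have "0 \<le> k" using x k d by (simp add: zero_le_mult_iff)
    moreover have "int d * k < int d * int g" using x k g by (simp add: mult.commute)
    then have "k < int g" using d by simp
    ultimately show "x \<in> (\<lambda>k. int d * int k) ` {..<g}"
      by (intro image_eqI[of _ _ "nat k"]) (auto simp: k)
  next
    fix x assume "x \<in> (\<lambda>k. int d * int k) ` {..<g}"
    then obtain k where k: "x = int d * int k" "k < g" by auto
    then have "d * k < n" using g d by simp
    then have "int d * int k < int n" by (metis of_nat_less_iff of_nat_mult)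
    then show "x \<in> {x \<in> {0..<int n}. int d dvd x}" using k by auto
  qed
  also have "card \<dots> = g" using d by (subst card_image) (auto simp: inj_on_def)
  finally show ?thesis by (simp add: g_def)
qed

lemma pow_cyclic_sum:
  assumes "x \<in> carrier (cyclic_sum ds)"
  shows "x [^]\<^bsub>cyclic_sum ds\<^esub> (m::nat) =
    (\<lambda>i\<in>{..<length ds}. (int m * x i) mod int (fst (ds ! i) ^ snd (ds ! i)))"
proof (induction m)
  case (Suc m)
  then show ?case
    by (auto simp: cyclic_sum_def nat_pow_Suc fun_eq_iff mod_simps algebra_simps)
qed (auto simp: cyclic_sum_def)

lemma card_torsion_cyclic_sum:
  assumes ds: "\<forall>(p, e)\<in>set ds. prime p \<and> 0 < e" and r: "prime r"
  shows "card {x \<in> carrier (cyclic_sum ds). x [^]\<^bsub>cyclic_sum ds\<^esub> (r ^ k) = \<one>\<^bsub>cyclic_sum ds\<^esub>}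
    = r ^ (\<Sum>(p, e)\<leftarrow>ds. if p = r then min k e else 0)"
proof -
  let ?n = "\<lambda>i. fst (ds ! i) ^ snd (ds ! i)"
  let ?T = "\<lambda>i. {x \<in> {0..<int (?n i)}. (int (r ^ k) * x) mod int (?n i) = 0}"
  have pr: "prime (fst (ds ! i))" if "i < length ds" for i
    using ds that by (metis case_prod_beta nth_mem)
  then have pos: "?n i > 0" if "i < length ds" for i
    using that prime_gt_0_nat by fastforce
  have car: "carrier (cyclic_sum ds) = (\<Pi>\<^sub>E i\<in>{..<length ds}. {0..<int (?n i)})"
    unfolding cyclic_sum_def carrier_product_group
    by (rule PiE_cong) (use pos in \<open>simp add: carrier_integer_mod_group, fastforce\<close>)
  have one: "\<one>\<^bsub>cyclic_sum ds\<^esub> = (\<lambda>i\<in>{..<length ds}. 0)"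
    by (simp add: cyclic_sum_def)
  have "{x \<in> carrier (cyclic_sum ds). x [^]\<^bsub>cyclic_sum ds\<^esub> (r ^ k) = \<one>\<^bsub>cyclic_sum ds\<^esub>}
      = {x \<in> carrier (cyclic_sum ds).
          (\<lambda>i\<in>{..<length ds}. (int (r ^ k) * x i) mod int (?n i)) = (\<lambda>i\<in>{..<length ds}. 0)}"
    using pow_cyclic_sum one by auto
  also have "\<dots> = (\<Pi>\<^sub>E i\<in>{..<length ds}. ?T i)"
  proof -
    have "(\<lambda>i\<in>{..<length ds}. (int (r ^ k) * x i) mod int (?n i)) = (\<lambda>i\<in>{..<length ds}. 0)
        \<longleftrightarrow> (\<forall>i<length ds. (int (r ^ k) * x i) mod int (?n i) = 0)" for x
      unfolding restrict_def fun_eq_iff by (metis lessThan_iff)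
    then show ?thesis
      unfolding car by (simp only: PiE_iff set_eq_iff mem_Collect_eq lessThan_iff Ball_def) blast
  qed
  also have "card \<dots> = (\<Prod>i<length ds. card (?T i))"
    by (simp add: card_PiE)
  also have "\<dots> = (\<Prod>i<length ds. r ^ (if fst (ds ! i) = r then min k (snd (ds ! i)) else 0))"
  proof (rule prod.cong[OF refl])
    fix i assume "i \<in> {..<length ds}"
    then have i: "i < length ds" by simp
    have gcd: "gcd (r ^ k) (?n i) = r ^ (if fst (ds ! i) = r then min k (snd (ds ! i)) else 0)"
    proof (cases "fst (ds ! i) = r")
      case True
      show ?thesis
      proof (cases "k \<le> snd (ds ! i)")
        case le: True
        then have "r ^ k dvd r ^ snd (ds ! i)" by (rule le_imp_power_dvd)
        then show ?thesis using True le by (simp add: gcd_proj1_if_dvd_nat)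
      next
        case nle: False
        then have "r ^ snd (ds ! i) dvd r ^ k" by (intro le_imp_power_dvd) simp
        then show ?thesis using True nle by (simp add: gcd_proj2_if_dvd_nat)
      qed
    next
      case False
      then have "coprime r (fst (ds ! i))" using pr[OF i] r primes_coprime by metis
      then have "coprime (r ^ k) (?n i)" by simp
      then show ?thesis using False by simp
    qed
    then show "card (?T i) = r ^ (if fst (ds ! i) = r then min k (snd (ds ! i)) else 0)"
      using card_torsion_cyclic[OF pos[OF i], of "r ^ k"] by simp
  qed
  also have "\<dots> = r ^ (\<Sum>i<length ds. if fst (ds ! i) = r then min k (snd (ds ! i)) else 0)"
    by (rule power_sum [symmetric])
  also have "(\<Sum>i<length ds. if fst (ds ! i) = r then min k (snd (ds ! i)) else 0)
      = (\<Sum>(p, e)\<leftarrow>ds. if p = r then min k e else 0)"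
    by (subst sum_list_sum_nth) (auto simp: atLeast0LessThan case_prod_beta)
  finally show ?thesis .
qed

lemma count_eq_torsion:
  "int (count (mset ds) (r, Suc k)) =
     2 * int (\<Sum>(p, e)\<leftarrow>ds. if p = r then min (Suc k) e else 0)
     - int (\<Sum>(p, e)\<leftarrow>ds. if p = r then min k e else 0)
     - int (\<Sum>(p, e)\<leftarrow>ds. if p = r then min (Suc (Suc k)) e else 0)"
proof (induction ds)
  case (Cons d ds)
  obtain a b where d: "d = (a, b)" by (cases d)
  show ?case
    using Cons by (cases "a = r"; cases "b = Suc k") (auto simp: d min_def)
qed simp

theorem prime_power_decomposition_unique:
  assumes ds: "prime_power_decomposition G ds" and ds': "prime_power_decomposition G ds'"
    and G: "group G"
  shows "mset ds = mset ds'"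
proof (rule multiset_eqI)
  let ?t = "\<lambda>ds r k. (\<Sum>(p, e)\<leftarrow>ds. if p = r then min k e else (0::nat))"
  have iso: "card {x \<in> carrier G. x [^]\<^bsub>G\<^esub> (r ^ k) = \<one>\<^bsub>G\<^esub>} = r ^ ?t ds r k"
    if d: "prime_power_decomposition G ds" and r: "prime r" for ds r k
  proof -
    obtain h where h: "h \<in> iso G (cyclic_sum ds)"
      using d by (auto simp: prime_power_decomposition_def is_iso_def)
    interpret group_hom G "cyclic_sum ds" h
      using G group_cyclic_sum h by (simp add: group_hom_def group_hom_axioms_def iso_def)
    have bij: "bij_betw h (carrier G) (carrier (cyclic_sum ds))"
      using h by (simp add: iso_def)
    have eq1: "h x = \<one>\<^bsub>cyclic_sum ds\<^esub> \<longleftrightarrow> x = \<one>\<^bsub>G\<^esub>" if "x \<in> carrier G" for x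
      using bij that by (metis bij_betw_def hom_one inj_onD G.one_closed)
    have eq2: "h x [^]\<^bsub>cyclic_sum ds\<^esub> (r ^ k) = \<one>\<^bsub>cyclic_sum ds\<^esub> \<longleftrightarrow> x [^]\<^bsub>G\<^esub> (r ^ k) = \<one>\<^bsub>G\<^esub>"
      if "x \<in> carrier G" for x
      using that eq1[of "x [^]\<^bsub>G\<^esub> (r ^ k)"] by (simp add: hom_nat_pow)
    have img: "h ` {x \<in> carrier G. x [^]\<^bsub>G\<^esub> (r ^ k) = \<one>\<^bsub>G\<^esub>}
       = {x \<in> carrier (cyclic_sum ds). x [^]\<^bsub>cyclic_sum ds\<^esub> (r ^ k) = \<one>\<^bsub>cyclic_sum ds\<^esub>}"
    proof (intro equalityI subsetI)
      fix y assume y: "y \<in> {x \<in> carrier (cyclic_sum ds). x [^]\<^bsub>cyclic_sum ds\<^esub> (r ^ k) = \<one>\<^bsub>cyclic_sum ds\<^esub>}"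
      then obtain x where "x \<in> carrier G" "y = h x"
        using bij_betw_imp_surj_on[OF bij] by (metis (lifting) imageE mem_Collect_eq)
      then show "y \<in> h ` {x \<in> carrier G. x [^]\<^bsub>G\<^esub> (r ^ k) = \<one>\<^bsub>G\<^esub>}"
        using y eq2 by simp
    qed (use eq2 hom_closed in force)
    have inj: "inj_on h {x \<in> carrier G. x [^]\<^bsub>G\<^esub> (r ^ k) = \<one>\<^bsub>G\<^esub>}"
      using bij by (auto simp: bij_betw_def intro: inj_on_subset)
    have "card {x \<in> carrier G. x [^]\<^bsub>G\<^esub> (r ^ k) = \<one>\<^bsub>G\<^esub>} =
       card {x \<in> carrier (cyclic_sum ds). x [^]\<^bsub>cyclic_sum ds\<^esub> (r ^ k) = \<one>\<^bsub>cyclic_sum ds\<^esub>}"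
      using card_image[OF inj] unfolding img by (rule sym)
    then show ?thesis
      using card_torsion_cyclic_sum[of ds r k] d r by (simp add: prime_power_decomposition_def)
  qed
  fix x :: "nat \<times> nat"
  obtain r e where x: "x = (r, e)" by (cases x)
  show "count (mset ds) x = count (mset ds') x"
  proof (cases "prime r \<and> 0 < e")
    case True
    then obtain k where k: "e = Suc k" by (cases e) auto
    have t: "?t ds r j = ?t ds' r j" for j
    proof -
      have "r ^ ?t ds r j = r ^ ?t ds' r j"
        using iso[OF ds, of r j] iso[OF ds', of r j] True by simp
      then show ?thesis
        using True prime_gt_1_nat power_inject_exp by blast
    qed
    have "int (count (mset ds) x) = int (count (mset ds') x)"
      unfolding x k count_eq_torsion t ..
    then show ?thesis by simp
  next
    case False
    then have "x \<notin> set ds" "x \<notin> set ds'"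
      using ds ds' x by (auto simp: prime_power_decomposition_def)
    then show ?thesis by (metis count_mset_0_iff)
  qed
qed

theorem K1_star_eq:
  assumes "group G" "prime_power_decomposition G ds"
  shows "K1_star G = K1_star_of ds"
  unfolding K1_star_def
proof (rule the_equality)
  show "\<exists>ds'. prime_power_decomposition G ds' \<and> K1_star_of ds = K1_star_of ds'"
    using assms by blast
  fix x assume "\<exists>ds'. prime_power_decomposition G ds' \<and> x = K1_star_of ds'"
  then obtain ds' where ds': "prime_power_decomposition G ds'" "x = K1_star_of ds'" by blast
  have "mset ds' = mset ds"
    using prime_power_decomposition_unique ds' assms by blast
  moreover have "K1_star_of es =
      (\<Sum>(p, e)\<in>#mset es. (real p ^ e - 1) / (real p ^ e - real p ^ (e - 1)))" for es
    unfolding K1_star_of_def by (simp only: sum_mset_sum_list mset_map [symmetric])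
  ultimately show "x = K1_star_of ds"
    using ds' by simp
qed

end

theory Submission
  imports Defs "HOL-Number_Theory.Residues" "HOL-Library.Function_Algebras"
begin

text \<open>
  The upper bound is proved by induction on the exponent of the cyclic component. The elements of
  maximal order in this component are amalgamated into minimal zero-sum blocks modulo the subgroup of
  index \<open>p\<close>; if the blocks are chosen well, the cross number drops by at most \<open>1 / p^(k-1)\<close>. This leaves
  the elementary groups \<open>C_q^N\<close>, where the claim says that a family with unique factorization has at most
  \<open>N * q\<close> members. There the indicator of zero is modulo \<open>q\<close> a polynomial of degree \<open>N * (q - 1)\<close>. Taking
  differences along all members of a family except one from each block gives a function that does not
  vanish at \<open>0\<close>, so the length is at most \<open>N * (q - 1)\<close> plus the number of blocks. For \<open>q = 2\<close> and
  \<open>q = 3\<close> there are at most \<open>N\<close> blocks. In rank two, one can save all but two of the blocks: an even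
  block can be used completely, as can two odd blocks containing parallel elements, and three or more
  odd blocks without parallel elements force a constant function with two different values.
\<close>

subsection \<open>Families with unique factorization\<close>

text \<open>The target \<open>N * q\<close> for \<open>C_q^N\<close> exceeds the degree
  \<open>N * (q - 1)\<close> by exactly \<open>N\<close>, so the counting argument succeeds as soon
  as there are at most \<open>N\<close> blocks. The obstacle is that nothing controls this number in
  general: for \<open>q = 2\<close> it is at most half the length, for \<open>q = 3\<close> each
  block can be traded for \<open>q - 1\<close> differences, but for larger \<open>q\<close> neither
  count suffices. In rank two any two elements outside the lattice are parallel or generate, and
  this replaces a bound on the number of blocks. Hence the shape of the hypothesis
  \<open>rank\<close>. For \<open>r = p\<close> the order does not separate the innermost layer of
  the cyclic component from the components of order \<open>r\<close>. The induction then ends at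
  exponent 1 with an elementary group of rank \<open>Suc n\<close>, so that \<open>C_(p^m)\<close>
  plus \<open>C_p\<close> is governed by rank two. The target value is \<open>n\<close> plus one
  term \<open>1 / p^j\<close> for each layer. A layer may therefore cost no more than one such term,
  although amalgamating elements with and without a component of order \<open>r\<close> can lower
  the weight.\<close>

text \<open>Groups are presented additively as quotients \<open>V / K\<close>, and a family \<open>v\<close> over an index set takes
  its values in \<open>V\<close>. Unique factorization means that the zero-sum index sets are the unions of the
  blocks; this is equivalent to their being closed under intersection, the form used below. It is
  stable under amalgamating elements.\<close>

definition subgrp :: "'v::ab_group_add set \<Rightarrow> bool" where
  "subgrp K \<longleftrightarrow> 0 \<in> K \<and> (\<forall>x\<in>K. \<forall>y\<in>K. x + y \<in> K \<and> x - y \<in> K)"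

definition minzs :: "'v::ab_group_add set \<Rightarrow> ('i \<Rightarrow> 'v) \<Rightarrow> 'i set \<Rightarrow> bool" where
  "minzs K v B \<longleftrightarrow> sum v B \<in> K \<and> (\<forall>J. J \<noteq> {} \<and> J \<subset> B \<longrightarrow> sum v J \<notin> K)"

definition uf :: "'v::ab_group_add set \<Rightarrow> ('i \<Rightarrow> 'v) \<Rightarrow> 'i set \<Rightarrow> bool" where
  "uf K v X \<longleftrightarrow> finite X \<and> sum v X \<in> K \<and>
     (\<forall>I J. I \<subseteq> X \<longrightarrow> J \<subseteq> X \<longrightarrow> sum v I \<in> K \<longrightarrow> sum v J \<in> K \<longrightarrow> sum v (I \<inter> J) \<in> K)"

lemma subgrpD:
  assumes "subgrp K"
  shows "0 \<in> K" "x \<in> K \<Longrightarrow> y \<in> K \<Longrightarrow> x + y \<in> K" "x \<in> K \<Longrightarrow> y \<in> K \<Longrightarrow> x - y \<in> K"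
    "x \<in> K \<Longrightarrow> - x \<in> K"
  using assms unfolding subgrp_def by (blast, blast, blast, metis diff_0)

lemma subgrp_sum: "subgrp K \<Longrightarrow> (\<And>i. i \<in> I \<Longrightarrow> f i \<in> K) \<Longrightarrow> sum f I \<in> K"
  by (induction I rule: infinite_finite_induct) (auto simp: subgrpD)

lemma subgrp_add_cancel:
  assumes "subgrp K"
  shows "y \<in> K \<Longrightarrow> x + y \<in> K \<longleftrightarrow> x \<in> K" "y \<in> K \<Longrightarrow> y + x \<in> K \<longleftrightarrow> x \<in> K"
    "y \<in> K \<Longrightarrow> x - y \<in> K \<longleftrightarrow> x \<in> K"
proof -
  show 1: "y \<in> K \<Longrightarrow> x + y \<in> K \<longleftrightarrow> x \<in> K" for x y
    using subgrpD(3)[OF assms, of "x + y" y] subgrpD(2)[OF assms, of x y] by auto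
  show "y \<in> K \<Longrightarrow> y + x \<in> K \<longleftrightarrow> x \<in> K" using 1[of y x] by (simp add: add.commute)
  show "y \<in> K \<Longrightarrow> x - y \<in> K \<longleftrightarrow> x \<in> K"
    using 1[of y "x - y"] by simp
qed

lemma sum_Diff_mem:
  assumes "subgrp K" "finite X" "I \<subseteq> X" "sum v I \<in> K"
  shows "sum v (X - I) \<in> K \<longleftrightarrow> sum v X \<in> K"
  using assms by (simp add: sum_diff subgrp_add_cancel)

lemma sum_Un_mem:
  assumes "subgrp K" "finite I" "finite J" "I \<inter> J = {}" "sum v I \<in> K"
  shows "sum v (I \<union> J) \<in> K \<longleftrightarrow> sum v J \<in> K"
  using assms by (simp add: sum.union_disjoint subgrp_add_cancel)

lemma ex_minzs:
  assumes "finite X" "X \<noteq> {}" "sum v X \<in> K"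
  obtains B where "B \<subseteq> X" "B \<noteq> {}" "minzs K v B"
  using assms
proof (induction "card X" arbitrary: X thesis rule: less_induct)
  case less
  show ?case
  proof (cases "minzs K v X")
    case False
    then obtain J where "J \<noteq> {}" "J \<subset> X" "sum v J \<in> K"
      using less.prems by (auto simp: minzs_def)
    then show thesis
      using less.hyps[of J] less.prems
      by (metis finite_subset psubset_card_mono psubset_imp_subset subset_trans)
  qed (use less.prems in blast)
qed

lemma minzs_partition:
  assumes "subgrp K" "finite X" "sum v X \<in> K"
  shows "\<exists>P. partition_on X P \<and> (\<forall>B\<in>P. minzs K v B)"
  using assms(2,3)
proof (induction "card X" arbitrary: X rule: less_induct)
  case less
  show ?case
  proof (cases "X = {}")
    case True
    then show ?thesis by (intro exI[of _ "{}"]) (simp add: partition_on_empty)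
  next
    case False
    then obtain B where B: "B \<subseteq> X" "B \<noteq> {}" "minzs K v B"
      using ex_minzs less.prems by blast
    have "sum v (X - B) \<in> K"
      using sum_Diff_mem[OF assms(1) less.prems(1) B(1)] B(3) less.prems(2) by (simp add: minzs_def)
    moreover have "card (X - B) < card X"
      using B less.prems(1) by (intro psubset_card_mono) auto
    ultimately obtain P where P: "partition_on (X - B) P" "\<forall>B\<in>P. minzs K v B"
      using less.hyps[of "X - B"] less.prems(1) by auto
    have "partition_on X (insert B P)"
      using P(1) B by (subst partition_on_insert) (auto simp: disjnt_def dest: partition_onD1)
    then show ?thesis using P B by blast
  qed
qed

lemma uf_subset:
  assumes K: "subgrp K" and X: "uf K v X" and Y: "Y \<subseteq> X" "sum v Y \<in> K"
  shows "uf K v Y"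
  unfolding uf_def
proof (intro conjI allI impI)
  show "finite Y" using X Y(1) finite_subset unfolding uf_def by metis
  fix I J assume "I \<subseteq> Y" "J \<subseteq> Y" "sum v I \<in> K" "sum v J \<in> K"
  then show "sum v (I \<inter> J) \<in> K" using X Y(1) unfolding uf_def by (meson order_trans)
qed (rule Y(2))

lemma uf_Diff:
  assumes K: "subgrp K" and X: "uf K v X" and Y: "Y \<subseteq> X" "sum v Y \<in> K"
  shows "uf K v (X - Y)"
proof (rule uf_subset[OF K X])
  have "finite X" "sum v X \<in> K" using X by (simp_all add: uf_def)
  then show "sum v (X - Y) \<in> K" using sum_Diff_mem[OF K _ Y] by simp
qed blast

text \<open>Closure under intersection makes \<open>J \<inter> B\<close> a zero-sum part of
  \<open>B\<close>, and minimality leaves only the two extremes. Uniqueness of the factorization is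
  mostly used in this form.\<close>

lemma uf_block:
  assumes "uf K v X" "B \<subseteq> X" "minzs K v B" "J \<subseteq> X" "sum v J \<in> K"
  shows "J \<inter> B = {} \<or> B \<subseteq> J"
proof -
  have "sum v B \<in> K" using assms(3) by (simp add: minzs_def)
  then have "sum v (J \<inter> B) \<in> K" using assms(1,2,4,5) unfolding uf_def by simp
  then have "J \<inter> B = {} \<or> \<not> J \<inter> B \<subset> B" using assms(3) unfolding minzs_def by metis
  then show ?thesis by blast
qed

lemma minzs_uf:
  assumes "subgrp K" "finite B" "minzs K v B"
  shows "uf K v B"
  unfolding uf_def
proof (intro conjI allI impI)
  fix I J assume "I \<subseteq> B" "J \<subseteq> B" "sum v I \<in> K" "sum v J \<in> K"
  then have "I = {} \<or> I = B" "J = {} \<or> J = B"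
    using assms(3) unfolding minzs_def psubset_eq by metis+
  then show "sum v (I \<inter> J) \<in> K" using \<open>sum v I \<in> K\<close> \<open>sum v J \<in> K\<close> subgrpD(1)[OF assms(1)] by auto
qed (use assms in \<open>simp_all add: minzs_def\<close>)

text \<open>Partial sums along an ordering of a block: the difference of two of them is the sum of a
  segment, or minus it, which is the sum of the complementary segment.\<close>

lemma block_chain:
  assumes K: "subgrp K" and B: "finite B" "minzs K v B"
  shows "\<exists>p :: nat \<Rightarrow> 'v::ab_group_add. \<forall>j<card B. \<forall>j'<card B.
    \<exists>W\<subseteq>B. p j - p j' - sum v W \<in> K \<and> (sum v W \<in> K \<longrightarrow> j = j')"
proof -
  obtain b where b: "bij_betw b {..<card B} B"
    using ex_bij_betw_nat_finite[OF B(1)] unfolding atLeast0LessThan by blast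
  define p where "p j = (\<Sum>i<j. v (b i))" for j
  have seg: "p j' - p j = sum v (b ` {j..<j'}) \<and> b ` {j..<j'} \<subseteq> B \<and> sum v (b ` {j..<j'}) \<notin> K"
    if "j < j'" "j' < card B" for j j'
  proof -
    have "j' \<in> {..<card B} - {j..<j'}" "{j..<j'} \<subseteq> {..<card B}"
      using that by (simp, force)
    then have sub: "{j..<j'} \<subset> {..<card B}" by blast
    have inj: "inj_on b {..<card B}" using b by (simp add: bij_betw_def)
    have "b ` {j..<j'} \<subset> b ` {..<card B}" using inj sub by (rule image_strict_mono)
    then have s: "b ` {j..<j'} \<subset> B" using b by (simp add: bij_betw_def)
    have "sum v (b ` {j..<j'}) = (\<Sum>i\<in>{j..<j'}. v (b i))"
      using inj_on_subset[OF inj psubset_imp_subset[OF sub]] by (simp add: sum.reindex)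
    also have "\<dots> = p j' - p j"
    proof -
      have e: "{..<j'} = {..<j} \<union> {j..<j'}" using that by auto
      show ?thesis unfolding p_def by (subst e, subst sum.union_disjoint) auto
    qed
    finally have e: "p j' - p j = sum v (b ` {j..<j'})" by simp
    have "b ` {j..<j'} \<noteq> {}" using that by auto
    then have "sum v (b ` {j..<j'}) \<notin> K" using s B(2) unfolding minzs_def by metis
    then show ?thesis using e s by blast
  qed
  show ?thesis
  proof (intro exI[of _ p] allI impI)
    fix j j' assume j: "j < card B" "j' < card B"
    consider "j = j'" | "j' < j" | "j < j'" by linarith
    then show "\<exists>W\<subseteq>B. p j - p j' - sum v W \<in> K \<and> (sum v W \<in> K \<longrightarrow> j = j')"
    proof cases
      case 1 then show ?thesis by (intro exI[of _ "{}"]) (simp add: subgrpD[OF K])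
    next
      case 2 then show ?thesis using seg[OF 2 j(1)] subgrpD(1)[OF K]
        by (intro exI[of _ "b ` {j'..<j}"]) auto
    next
      case 3
      let ?S = "b ` {j..<j'}"
      have s: "p j' - p j = sum v ?S" "?S \<subseteq> B" "sum v ?S \<notin> K" using seg[OF 3 j(2)] by auto
      have d: "sum v (B - ?S) = sum v B - sum v ?S" using B(1) s(2) by (rule sum_diff)
      have zB: "sum v B \<in> K" using B(2) by (simp add: minzs_def)
      have "p j - p j' - sum v (B - ?S) = - sum v B" using d s(1) by (simp add: algebra_simps)
      then have "p j - p j' - sum v (B - ?S) \<in> K" using subgrpD(4)[OF K zB] by simp
      moreover have "sum v (B - ?S) \<notin> K"
        unfolding d using s(3) zB subgrpD(3)[OF K, of "sum v B" "sum v B - sum v ?S"] by auto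
      ultimately show ?thesis by blast
    qed
  qed
qed

text \<open>Adding one partial sum from each block gives as many pairwise incongruent elements as
  the product of the block sizes, which is at least their sum \<open>card X\<close>. Expressing
  differences by subset sums \<open>W\<close> makes the invariant additive over blocks. The clause
  with \<open>2 \<le> card Q\<close> is there because a product dominates a sum only if both factors
  are at least two.\<close>

lemma uf_incongruent_sums:
  assumes K: "subgrp K" and X: "uf K v X" and nz: "\<And>i. i \<in> X \<Longrightarrow> v i \<notin> K"
  shows "\<exists>Q. finite Q \<and> 1 \<le> card Q \<and> card X \<le> card Q \<and> (X \<noteq> {} \<longrightarrow> 2 \<le> card Q) \<and>
    (\<forall>a\<in>Q. \<forall>b\<in>Q. \<exists>W\<subseteq>X. a - b - sum v W \<in> K \<and> (sum v W \<in> K \<longrightarrow> a = b))"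
  using X nz
proof (induction "card X" arbitrary: X rule: less_induct)
  case less
  have fX: "finite X" using less.prems(1) by (simp add: uf_def)
  show ?case
  proof (cases "X = {}")
    case True
    then show ?thesis by (intro exI[of _ "{0}"]) (simp add: subgrpD[OF K])
  next
    case False
    then obtain B where B: "B \<subseteq> X" "B \<noteq> {}" "minzs K v B"
      using ex_minzs fX less.prems(1) unfolding uf_def by metis
    have fB: "finite B" using B fX finite_subset by blast
    have zB: "sum v B \<in> K" using B(3) by (simp add: minzs_def)
    have uX': "uf K v (X - B)" by (rule uf_Diff[OF K less.prems(1) B(1) zB])
    have cX: "card X = card (X - B) + card B"
      using B(1) fX by (metis card_Diff_subset card_mono fB le_add_diff_inverse2)
    have "card B \<noteq> 1"
      using zB less.prems(2) B(1) by (auto simp: card_1_singleton_iff)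
    moreover have "card B \<noteq> 0" using B(2) fB by auto
    ultimately have cB: "2 \<le> card B" by linarith
    have "card (X - B) < card X" using cX cB by linarith
    then obtain Q where Q: "finite Q" "1 \<le> card Q" "card (X - B) \<le> card Q"
        and Q2: "X - B \<noteq> {} \<longrightarrow> 2 \<le> card Q"
        and Q4: "\<forall>a\<in>Q. \<forall>b\<in>Q. \<exists>W\<subseteq>X - B. a - b - sum v W \<in> K \<and> (sum v W \<in> K \<longrightarrow> a = b)"
      using less.hyps[OF _ uX'] less.prems(2) by (metis (no_types, lifting) DiffD1)
    obtain p :: "nat \<Rightarrow> _" where p: "\<And>j j'. j < card B \<Longrightarrow> j' < card B \<Longrightarrow>
        \<exists>W\<subseteq>B. p j - p j' - sum v W \<in> K \<and> (sum v W \<in> K \<longrightarrow> j = j')"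
      using block_chain[OF K fB B(3)] by blast
    define f where "f = (\<lambda>(a, j). a + p j)"
    have key: "\<exists>W\<subseteq>X. f x - f y - sum v W \<in> K \<and> (sum v W \<in> K \<longrightarrow> x = y)"
      if xy: "x \<in> Q \<times> {..<card B}" "y \<in> Q \<times> {..<card B}" for x y
    proof -
      obtain a j a' j' where e: "x = (a, j)" "y = (a', j')" by (cases x, cases y)
      obtain W1 where W1: "W1 \<subseteq> X - B" "a - a' - sum v W1 \<in> K" "sum v W1 \<in> K \<longrightarrow> a = a'"
        using bspec[OF bspec[OF Q4, of a], of a'] xy e by auto
      obtain W2 where W2: "W2 \<subseteq> B" "p j - p j' - sum v W2 \<in> K" "sum v W2 \<in> K \<longrightarrow> j = j'"
        using p[of j j'] xy e by auto
      have fin: "finite W1" "finite W2" using W1 W2 fX fB by (meson finite_Diff finite_subset)+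
      have s: "sum v (W1 \<union> W2) = sum v W1 + sum v W2"
        using W1(1) W2(1) fin by (intro sum.union_disjoint) auto
      have "f x - f y - sum v (W1 \<union> W2) = (a - a' - sum v W1) + (p j - p j' - sum v W2)"
        by (simp add: s e f_def algebra_simps)
      then have 1: "f x - f y - sum v (W1 \<union> W2) \<in> K" using W1(2) W2(2) subgrpD(2)[OF K] by simp
      \<comment> \<open>Intersecting with \<open>B\<close> splits a zero-sum
        \<open>W1 \<union> W2\<close> into its two parts, so that both invariants apply.\<close>
      have 2: "x = y" if z: "sum v (W1 \<union> W2) \<in> K"
      proof -
        have "W1 \<union> W2 \<subseteq> X" using W1(1) W2(1) B(1) by blast
        then have "sum v ((W1 \<union> W2) \<inter> B) \<in> K"
          using less.prems(1) z zB B(1) unfolding uf_def by simp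
        moreover have "(W1 \<union> W2) \<inter> B = W2" using W1(1) W2(1) by blast
        ultimately have z2: "sum v W2 \<in> K" by simp
        then have "sum v W1 \<in> K" using z s subgrp_add_cancel(1)[OF K] by metis
        then show ?thesis using z2 W1(3) W2(3) e by simp
      qed
      show ?thesis using 1 2 W1(1) W2(1) B(1) by (intro exI[of _ "W1 \<union> W2"]) auto
    qed
    have inj: "inj_on f (Q \<times> {..<card B})"
    proof (rule inj_onI)
      fix x y assume xy: "x \<in> Q \<times> {..<card B}" "y \<in> Q \<times> {..<card B}" and e: "f x = f y"
      obtain W where "f x - f y - sum v W \<in> K" "sum v W \<in> K \<longrightarrow> x = y" using key[OF xy] by blast
      moreover from this(1) e have "sum v W \<in> K" using subgrpD(4)[OF K, of "- sum v W"] by simp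
      ultimately show "x = y" by simp
    qed
    have cQ: "card (f ` (Q \<times> {..<card B})) = card Q * card B"
      using inj by (simp add: card_image card_cartesian_product)
    have "card X \<le> card Q * card B"
    proof (cases "X - B = {}")
      case True
      then have "card X = 1 * card B" using cX by (simp only: card.empty)
      then show ?thesis using Q(2) by (simp only: mult_le_mono1)
    next
      case False
      then have q2: "2 \<le> card Q" using Q2 by simp
      \<comment> \<open>Expanded, this says that the sum of the two cardinalities is at most their
        product.\<close>
      have "(card Q - 1) * (card B - 1) \<ge> 1 * 1" using q2 cB by (intro mult_mono) auto
      then have "card Q + card B \<le> card Q * card B"
        using q2 cB by (cases "card Q"; cases "card B") auto
      then show ?thesis using cX Q(3) by linarith
    qed
    moreover have "2 \<le> card Q * card B" using Q(2) cB mult_le_mono[of 1 "card Q" 2 "card B"] by simp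
    ultimately have c: "card X \<le> card (f ` (Q \<times> {..<card B}))" "2 \<le> card (f ` (Q \<times> {..<card B}))"
      using cQ by simp_all
    have "\<forall>a\<in>f ` (Q \<times> {..<card B}). \<forall>b\<in>f ` (Q \<times> {..<card B}).
        \<exists>W\<subseteq>X. a - b - sum v W \<in> K \<and> (sum v W \<in> K \<longrightarrow> a = b)"
    proof (intro ballI)
      fix a b assume "a \<in> f ` (Q \<times> {..<card B})" "b \<in> f ` (Q \<times> {..<card B})"
      then obtain x y where xy: "x \<in> Q \<times> {..<card B}" "y \<in> Q \<times> {..<card B}" "a = f x" "b = f y"
        by (auto elim!: imageE)
      then show "\<exists>W\<subseteq>X. a - b - sum v W \<in> K \<and> (sum v W \<in> K \<longrightarrow> a = b)"
        using key[OF xy(1,2)] by metis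
    qed
    then show ?thesis
      using c Q(1) by (intro exI[of _ "f ` (Q \<times> {..<card B})"]) simp
  qed
qed

subsection \<open>Iterated differences modulo a prime\<close>

text \<open>\<open>ann q k f\<close> says that modulo \<open>q\<close> all \<open>k\<close>-fold differences of \<open>f\<close> vanish, so that \<open>f\<close> behaves
  like a polynomial of degree less than \<open>k\<close>.\<close>

primrec ann :: "int \<Rightarrow> nat \<Rightarrow> ('v::ab_group_add \<Rightarrow> int) \<Rightarrow> bool" where
  "ann q 0 f \<longleftrightarrow> (\<forall>z. q dvd f z)"
| "ann q (Suc k) f \<longleftrightarrow> (\<forall>g. ann q k (\<lambda>z. f z - f (z + g)))"

lemma ann_add: "ann q k f \<Longrightarrow> ann q k g \<Longrightarrow> ann q k (\<lambda>z. f z + g z)"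
proof (induction k arbitrary: f g)
  case (Suc k)
  have "(\<lambda>z. f z + g z - (f (z + a) + g (z + a))) = (\<lambda>z. (f z - f (z + a)) + (g z - g (z + a)))" for a
    by (simp add: algebra_simps)
  then show ?case using Suc by simp
qed simp

lemma ann_cmult: "ann q k f \<Longrightarrow> ann q k (\<lambda>z. c * f z)"
proof (induction k arbitrary: f)
  case (Suc k)
  have "(\<lambda>z. c * f z - c * f (z + a)) = (\<lambda>z. c * (f z - f (z + a)))" for a
    by (simp add: algebra_simps)
  then show ?case using Suc by simp
qed simp

lemma ann_diff: "ann q k f \<Longrightarrow> ann q k g \<Longrightarrow> ann q k (\<lambda>z. f z - g z)"
  using ann_add[of q k f "\<lambda>z. - 1 * g z"] ann_cmult[of q k g "-1"] by simp

lemma ann_shift: "ann q k f \<Longrightarrow> ann q k (\<lambda>z. f (z + a))"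
proof (induction k arbitrary: f)
  case (Suc k)
  have "ann q k (\<lambda>z. f (z + a) - f (z + g + a))" for g
  proof -
    have "ann q k (\<lambda>z. f z - f (z + g))" using Suc.prems by simp
    from Suc.IH[OF this] show ?thesis by (simp add: add.assoc add.commute[of a g])
  qed
  then show ?case by simp
qed simp

lemma ann_Suc: "ann q k f \<Longrightarrow> ann q (Suc k) f"
  by (simp add: ann_diff ann_shift)

lemma ann_mono: "ann q k f \<Longrightarrow> k \<le> l \<Longrightarrow> ann q l f"
  by (induction l) (auto simp: le_Suc_eq simp del: ann.simps intro: ann_Suc)

lemma ann_0_mono: "(\<And>z. q dvd f z) \<Longrightarrow> ann q k f"
  by (rule ann_mono[of q 0]) auto

lemma ann_cong: "ann q k f \<Longrightarrow> (\<And>z. q dvd g z - f z) \<Longrightarrow> ann q k g"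
  using ann_add[of q k f "\<lambda>z. g z - f z"] ann_0_mono[of q "\<lambda>z. g z - f z" k] by simp

text \<open>The truncated \<open>k - 1\<close> is harmless: differences of a function that vanishes
  modulo \<open>q\<close> vanish as well.\<close>

lemma ann_difference: "ann q k f \<Longrightarrow> ann q (k - 1) (\<lambda>z. f z - f (z + a))"
  by (cases k) (auto simp: dvd_diff)

lemma ann_sum: "(\<And>i. i \<in> A \<Longrightarrow> ann q k (f i)) \<Longrightarrow> ann q k (\<lambda>z. \<Sum>i\<in>A. f i z)"
  by (induction A rule: infinite_finite_induct) (auto intro: ann_0_mono ann_add)

text \<open>The index \<open>Suc a\<close> stands for degree at most \<open>a\<close>, and degrees
  add by the product rule for differences. Degree 0 is split off because the difference of that
  factor already vanishes modulo \<open>q\<close>.\<close>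

lemma ann_mult: "ann q (Suc a) f \<Longrightarrow> ann q (Suc b) g \<Longrightarrow> ann q (Suc (a + b)) (\<lambda>z. f z * g z)"
proof (induction "a + b" arbitrary: a b f g rule: less_induct)
  case less
  have "ann q (a + b) (\<lambda>z. f z * g z - f (z + h) * g (z + h))" for h
  proof -
    have "ann q (a + b) (\<lambda>z. (f z - f (z + h)) * g z)"
    proof (cases a)
      case 0
      then have "q dvd f z - f (z + h)" for z using less.prems(1) by auto
      then show ?thesis by (intro ann_0_mono) auto
    next
      case (Suc a')
      have "ann q (Suc a') (\<lambda>z. f z - f (z + h))" using less.prems(1) Suc by simp
      then show ?thesis
        using less.hyps[of a' b "\<lambda>z. f z - f (z + h)"] less.prems(2) Suc by (simp del: ann.simps)
    qed
    moreover have "ann q (a + b) (\<lambda>z. f (z + h) * (g z - g (z + h)))"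
    proof (cases b)
      case 0
      then have "q dvd g z - g (z + h)" for z using less.prems(2) by auto
      then show ?thesis by (intro ann_0_mono) auto
    next
      case (Suc b')
      have "ann q (Suc b') (\<lambda>z. g z - g (z + h))" using less.prems(2) Suc by simp
      then show ?thesis
        using less.hyps[of a b' "\<lambda>z. f (z + h)"] ann_shift[OF less.prems(1)] Suc by (simp del: ann.simps)
    qed
    ultimately have "ann q (a + b) (\<lambda>z. (f z - f (z + h)) * g z + f (z + h) * (g z - g (z + h)))"
      by (rule ann_add)
    then show ?thesis by (simp add: algebra_simps)
  qed
  then show ?case by simp
qed

lemma ann_const: "ann q (Suc 0) (\<lambda>z. c)"
  by simp

lemma ann_power: "ann q (Suc a) f \<Longrightarrow> ann q (Suc (n * a)) (\<lambda>z. f z ^ n)"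
proof (induction n)
  case (Suc n)
  then show ?case using ann_mult[of q a f "n * a" "\<lambda>z. f z ^ n"] by simp
qed simp

lemma ann_prod:
  "finite A \<Longrightarrow> (\<And>i. i \<in> A \<Longrightarrow> ann q (Suc a) (f i)) \<Longrightarrow> ann q (Suc (card A * a)) (\<lambda>z. \<Prod>i\<in>A. f i z)"
proof (induction A rule: finite_induct)
  case (insert x A)
  then show ?case using ann_mult[of q a "f x" "card A * a" "\<lambda>z. \<Prod>i\<in>A. f i z"] by simp
qed simp

section \<open>Differences along a family and their values at subset sums\<close>

text \<open>This is the product of the operators \<open>1 - T_i\<close> over
  \<open>i \<in> R\<close>, where \<open>T_i\<close> is translation by \<open>v i\<close>. In
  expanded form its value at a subset sum becomes a signed count of zero-sum sets.\<close>

definition iter_diff :: "('i \<Rightarrow> 'v::ab_group_add) \<Rightarrow> 'i set \<Rightarrow> ('v \<Rightarrow> int) \<Rightarrow> 'v \<Rightarrow> int" where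
  "iter_diff v R f z = (\<Sum>I\<in>Pow R. (- 1) ^ card I * f (z + sum v I))"

lemma iter_diff_insert:
  assumes "finite R" "i \<notin> R"
  shows "iter_diff v (insert i R) f z = iter_diff v R f z - iter_diff v R f (z + v i)"
proof -
  have inj: "inj_on (insert i) (Pow R)" using assms by (auto simp: inj_on_def)
  have "iter_diff v (insert i R) f z = (\<Sum>I\<in>Pow R. (- 1) ^ card I * f (z + sum v I)) +
      (\<Sum>I\<in>insert i ` Pow R. (- 1) ^ card I * f (z + sum v I))"
    unfolding iter_diff_def Pow_insert using assms by (intro sum.union_disjoint) auto
  also have "(\<Sum>I\<in>insert i ` Pow R. (- 1) ^ card I * f (z + sum v I)) =
      (\<Sum>I\<in>Pow R. (- 1) ^ card (insert i I) * f (z + sum v (insert i I)))"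
    using inj by (simp add: sum.reindex)
  also have "\<dots> = (\<Sum>I\<in>Pow R. - ((- 1) ^ card I * f (z + v i + sum v I)))"
  proof (rule sum.cong[OF refl])
    fix I assume "I \<in> Pow R"
    then have "finite I" "i \<notin> I" using assms finite_subset by auto
    then show "(- 1) ^ card (insert i I) * f (z + sum v (insert i I)) =
        - ((- 1) ^ card I * f (z + v i + sum v I))"
      by (simp add: algebra_simps)
  qed
  finally show ?thesis by (simp add: iter_diff_def sum_negf)
qed

lemma ann_iter_diff: "finite R \<Longrightarrow> ann q k f \<Longrightarrow> ann q (k - card R) (iter_diff v R f)"
proof (induction R rule: finite_induct)
  case empty
  have "iter_diff v {} f = f" by (rule ext) (simp add: iter_diff_def)
  then show ?case using empty by simp
next
  case (insert x R)
  have "ann q (k - card R - 1) (\<lambda>z. iter_diff v R f z - iter_diff v R f (z + v x))"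
    using insert by (intro ann_difference) simp
  moreover have "iter_diff v (insert x R) f = (\<lambda>z. iter_diff v R f z - iter_diff v R f (z + v x))"
    using insert by (simp add: iter_diff_insert fun_eq_iff)
  ultimately show ?case using insert by simp
qed

text \<open>Modulo \<open>q\<close> such an \<open>f\<close> is a function on the quotient by
  \<open>K\<close>.\<close>

definition periodic :: "int \<Rightarrow> 'v::ab_group_add set \<Rightarrow> ('v \<Rightarrow> int) \<Rightarrow> bool" where
  "periodic q K f \<longleftrightarrow> (\<forall>z. \<forall>x\<in>K. q dvd f (z + x) - f z)"

text \<open>On the subset sums of \<open>Y\<close>, a good function is a multiple of the indicator of zero.\<close>

definition good :: "int \<Rightarrow> 'v::ab_group_add set \<Rightarrow> ('i \<Rightarrow> 'v) \<Rightarrow> 'i set \<Rightarrow> ('v \<Rightarrow> int) \<Rightarrow> bool" where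
  "good q K v Y h \<longleftrightarrow> periodic q K h \<and> (\<forall>J. J \<subseteq> Y \<longrightarrow> sum v J \<notin> K \<longrightarrow> q dvd h (sum v J)) \<and> \<not> q dvd h 0"

text \<open>The value at \<open>sum v J\<close>, divided by \<open>h 0\<close>, of \<open>iter_diff v R h\<close> for good \<open>h\<close>.\<close>

definition signed_count :: "'v::ab_group_add set \<Rightarrow> ('i \<Rightarrow> 'v) \<Rightarrow> 'i set \<Rightarrow> 'i set \<Rightarrow> int" where
  "signed_count K v R J = (\<Sum>I | I \<subseteq> R \<and> sum v (J \<union> I) \<in> K. (- 1) ^ card I)"

lemma periodic_iter_diff: "periodic q K f \<Longrightarrow> periodic q K (iter_diff v R f)"
  unfolding periodic_def
proof (intro allI ballI)
  fix z x assume f: "\<forall>z. \<forall>x\<in>K. q dvd f (z + x) - f z" and x: "x \<in> K"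
  have "iter_diff v R f (z + x) - iter_diff v R f z =
      (\<Sum>I\<in>Pow R. (- 1) ^ card I * (f (z + sum v I + x) - f (z + sum v I)))"
    by (simp add: iter_diff_def sum_subtractf right_diff_distrib add.assoc add.commute[of x])
  also have "q dvd \<dots>" using f x by (intro dvd_sum dvd_mult) blast
  finally show "q dvd iter_diff v R f (z + x) - iter_diff v R f z" .
qed

text \<open>Modulo \<open>q\<close> only the terms with \<open>J \<union> I\<close> zero-sum
  survive, each with the value \<open>h 0\<close> up to sign. Disjointness of \<open>J\<close> and
  \<open>R\<close> ensures that no index is counted twice in
  \<open>sum v J + sum v I\<close>.\<close>

lemma iter_diff_val:
  assumes h: "good q K v Y h" and Y: "finite Y" "J \<subseteq> Y" "R \<subseteq> Y" "J \<inter> R = {}"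
  shows "q dvd iter_diff v R h (sum v J) - signed_count K v R J * h 0"
proof -
  have fin: "finite J" "finite R" using Y finite_subset by blast+
  have "signed_count K v R J * h 0 = (\<Sum>I\<in>Pow R. if sum v (J \<union> I) \<in> K then (- 1) ^ card I * h 0 else 0)"
  proof -
    have "{I. I \<subseteq> R \<and> sum v (J \<union> I) \<in> K} = Pow R \<inter> {I. sum v (J \<union> I) \<in> K}" by auto
    then show ?thesis unfolding signed_count_def sum_distrib_right using fin by (simp add: sum.inter_restrict)
  qed
  then have "iter_diff v R h (sum v J) - signed_count K v R J * h 0 =
      (\<Sum>I\<in>Pow R. (- 1) ^ card I * h (sum v J + sum v I) -
        (if sum v (J \<union> I) \<in> K then (- 1) ^ card I * h 0 else 0))"
    by (simp add: iter_diff_def sum_subtractf)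
  also have "q dvd \<dots>"
  proof (rule dvd_sum)
    fix I assume "I \<in> Pow R"
    then have I: "I \<subseteq> R" "finite I" "J \<inter> I = {}" "J \<union> I \<subseteq> Y" using Y fin finite_subset by auto
    have s: "sum v J + sum v I = sum v (J \<union> I)" using I fin by (simp add: sum.union_disjoint)
    show "q dvd (- 1) ^ card I * h (sum v J + sum v I) -
        (if sum v (J \<union> I) \<in> K then (- 1) ^ card I * h 0 else 0)"
    proof (cases "sum v (J \<union> I) \<in> K")
      case True
      then have "q dvd h (0 + sum v (J \<union> I)) - h 0" using h unfolding good_def periodic_def by blast
      then have "q dvd (- 1) ^ card I * (h (sum v (J \<union> I)) - h 0)" by simp
      then show ?thesis using True s by (simp add: right_diff_distrib)
    next
      case False
      then have "q dvd h (sum v (J \<union> I))" using h I(4) unfolding good_def by blast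
      then show ?thesis using False s by simp
    qed
  qed
  finally show ?thesis .
qed

lemma good_ann_pos: "good q K v Y h \<Longrightarrow> ann q k h \<Longrightarrow> 0 < k"
  by (cases k) (auto simp: good_def)

lemma signed_count_unique:
  assumes "I0 \<subseteq> R" "sum v (J \<union> I0) \<in> K" "\<And>I. I \<subseteq> R \<Longrightarrow> sum v (J \<union> I) \<in> K \<Longrightarrow> I = I0"
  shows "signed_count K v R J = (- 1) ^ card I0"
proof -
  have "{I. I \<subseteq> R \<and> sum v (J \<union> I) \<in> K} = {I0}" using assms by blast
  then show ?thesis by (simp add: signed_count_def)
qed

lemma signed_count_none:
  assumes "\<And>I. I \<subseteq> R \<Longrightarrow> sum v (J \<union> I) \<in> K \<Longrightarrow> False"
  shows "signed_count K v R J = 0"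
proof -
  have "{I. I \<subseteq> R \<and> sum v (J \<union> I) \<in> K} = {}" using assms by blast
  then show ?thesis unfolding signed_count_def by (simp only: sum.empty)
qed

section \<open>Length bounds from the degree\<close>

text \<open>With \<open>k\<close> or more differences \<open>h\<close> would be annihilated, but at
  0 only \<open>I = {}\<close> contributes and leaves \<open>h 0\<close>. For the indicator of zero
  this is the bound \<open>N * (q - 1)\<close> on zero-sum free families over
  \<open>C_q^N\<close>.\<close>

lemma zero_sum_free_card_less:
  assumes K: "subgrp K" and h: "good q K v Y h" "ann q k h" and Y: "finite Y" "R \<subseteq> Y"
    and R: "\<And>I. I \<subseteq> R \<Longrightarrow> sum v I \<in> K \<Longrightarrow> I = {}"
  shows "card R < k"
proof (rule ccontr)
  assume "\<not> card R < k"
  then have "ann q 0 (iter_diff v R h)" using ann_iter_diff[OF finite_subset[OF Y(2,1)] h(2), of v] by simp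
  then have "q dvd iter_diff v R h (sum v {})" by simp
  moreover have "q dvd iter_diff v R h (sum v {}) - signed_count K v R {} * h 0"
    using iter_diff_val[OF h(1) Y(1) _ Y(2), of "{}"] by simp
  moreover have "signed_count K v R {} = (- 1) ^ card ({} :: 'b set)"
    using R subgrpD(1)[OF K] by (intro signed_count_unique) auto
  ultimately have "q dvd h 0" using dvd_diff_right_iff[of q "iter_diff v R h (sum v {})" "h 0"] by simp
  then show False using h(1) by (simp add: good_def)
qed

text \<open>Intersecting \<open>J \<union> I\<close> with \<open>C\<close> recovers
  \<open>I\<close>. So parts of a zero-sum \<open>C\<close> cannot interact with indices outside of
  it.\<close>

lemma uf_split:
  assumes K: "subgrp K" and X: "uf K v X" and C: "C \<subseteq> X" "sum v C \<in> K"
    and J: "J \<subseteq> X" "J \<inter> C = {}" and I: "I \<subseteq> C" and z: "sum v (J \<union> I) \<in> K"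
  shows "sum v I \<in> K" "sum v J \<in> K"
proof -
  have fX: "finite X" using X by (simp add: uf_def)
  have "sum v ((J \<union> I) \<inter> C) \<in> K" using X C J I z unfolding uf_def by (meson Un_least order_trans)
  moreover have "(J \<union> I) \<inter> C = I" using J I by blast
  ultimately show zI: "sum v I \<in> K" by simp
  have "finite J" "finite I" "J \<inter> I = {}"
    using finite_subset[OF J(1) fX] finite_subset[OF order_trans[OF I C(1)] fX] J I by blast+
  then show "sum v J \<in> K" using z zI K by (simp add: sum.union_disjoint subgrp_add_cancel)
qed

lemma signed_count_split:
  assumes K: "subgrp K" and X: "uf K v X" and C: "C \<subseteq> X" "sum v C \<in> K"
    and J: "J \<subseteq> X" "J \<inter> C = {}" "sum v J \<notin> K" and R: "R \<subseteq> C" "S \<subseteq> C"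
  shows "signed_count K v R (J \<union> S) = 0"
proof (rule signed_count_none)
  fix I assume "I \<subseteq> R" "sum v (J \<union> S \<union> I) \<in> K"
  then have "sum v J \<in> K" using uf_split(2)[OF K X C J(1,2), of "S \<union> I"] R by (auto simp: Un_assoc)
  then show False using J(3) by simp
qed

lemma block_inter:
  assumes "subgrp K" "uf K v X" "partition_on X P" "\<And>B. B \<in> P \<Longrightarrow> minzs K v B"
    and "B \<in> P" "I \<subseteq> X" "sum v I \<in> K"
  shows "I \<inter> B = {} \<or> B \<subseteq> I"
  using uf_block[OF assms(2) _ assms(4)[OF assms(5)] assms(6,7)] partition_onD1[OF assms(3)] assms(5) by blast

text \<open>A zero-sum set that meets a block contains all of it, in particular the chosen
  representative.\<close>

lemma transversal_zero_sum_free: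
  assumes K: "subgrp K" and X: "uf K v X" and P: "partition_on X P" "\<And>B. B \<in> P \<Longrightarrow> minzs K v B"
    and I: "I \<subseteq> X" "sum v I \<in> K" and r: "\<And>B. B \<in> P \<Longrightarrow> r B \<in> B \<and> r B \<notin> I"
  shows "I = {}"
proof -
  have "I \<inter> B = {}" if "B \<in> P" for B using block_inter[OF K X P that I] r[OF that] by blast
  then show ?thesis using I(1) partition_onD1[OF P(1)] by blast
qed

lemma card_reps:
  assumes "partition_on X P" "\<And>B. B \<in> P \<Longrightarrow> r B \<in> B"
  shows "inj_on r P" "r ` P \<subseteq> X"
proof -
  show "inj_on r P"
  proof (rule inj_onI)
    fix B C assume "B \<in> P" "C \<in> P" "r B = r C"
    then have "r B \<in> B" "r B \<in> C" using assms(2) by metis+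
    then show "B = C"
      using partition_onD2[OF assms(1)] \<open>B \<in> P\<close> \<open>C \<in> P\<close> unfolding disjoint_def by blast
  qed
  show "r ` P \<subseteq> X" using assms(2) partition_onD1[OF assms(1)] by blast
qed

lemma card_minus_blocks_less:
  fixes v :: "'i \<Rightarrow> 'v::ab_group_add"
  assumes K: "subgrp K" and X: "uf K v X" and P: "partition_on X P" "\<And>B. B \<in> P \<Longrightarrow> minzs K v B"
    and h: "good q K v X h" "ann q k h"
  shows "card X < k + card P"
proof -
  have fX: "finite X" using X by (simp add: uf_def)
  define r where "r = (\<lambda>B. SOME i. i \<in> (B :: 'i set))"
  have r: "r B \<in> B" if "B \<in> P" for B
    unfolding r_def using partition_onD3[OF P(1)] that by (metis ex_in_conv someI_ex)
  note cr = card_reps[OF P(1) r]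
  have "card (X - r ` P) < k"
  proof (rule zero_sum_free_card_less[OF K h fX])
    fix I assume I: "I \<subseteq> X - r ` P" "sum v I \<in> K"
    then show "I = {}" using r by (intro transversal_zero_sum_free[OF K X P, of I r]) auto
  qed blast
  moreover have "card (X - r ` P) = card X - card P"
    using cr fX by (simp add: card_Diff_subset finite_subset card_image)
  ultimately show ?thesis by linarith
qed

text \<open>For an element \<open>c\<close> of a block, \<open>- c\<close> is again a subset sum of this block. Hence the second
  difference at \<open>z - c\<close>, \<open>z\<close>, \<open>z + c\<close> eliminates the block while lowering the degree by two.\<close>

lemma twice_card_blocks_less:
  assumes q: "prime q" "q \<noteq> (2::int)"
    and K: "subgrp K" and X: "uf K v X" "\<And>i. i \<in> X \<Longrightarrow> v i \<notin> K"
    and P: "partition_on X P" "\<And>B. B \<in> P \<Longrightarrow> minzs K v B"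
    and h: "good q K v (\<Union>P') h" "ann q k h" and P': "P' \<subseteq> P"
  shows "2 * card P' < k"
proof -
  have fX: "finite X" using X by (simp add: uf_def)
  have XP: "X = \<Union>P" using partition_onD1[OF P(1)] .
  have "finite P" using fX unfolding XP by (rule finite_UnionD)
  then have "finite P'" using P' finite_subset by blast
  then show ?thesis using h P'
  proof (induction P' arbitrary: h k rule: finite_induct)
    case empty
    then show ?case using good_ann_pos by fastforce
  next
    case (insert B P')
    have BP: "B \<in> P" and P'P: "P' \<subseteq> P" using insert.prems by auto
    have BX: "B \<subseteq> X" using BP XP by blast
    have fB: "finite B" using BX fX finite_subset by blast
    have zB: "sum v B \<in> K" and minB: "\<And>J. J \<noteq> {} \<Longrightarrow> J \<subset> B \<Longrightarrow> sum v J \<notin> K"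
      using P(2)[OF BP] by (auto simp: minzs_def)
    obtain c where c: "c \<in> B" using partition_onD3[OF P(1)] BP by (metis ex_in_conv)
    have cK: "v c \<notin> K" using X(2) c BX by blast
    have sc: "sum v (B - {c}) = sum v B - v c" using fB c by (simp add: sum_diff1)
    define h' where "h' z = h (z - v c) - h z - (h z - h (z + v c))" for z
    have "ann q (k - 1 - 1) h'"
    proof -
      have "ann q (k - 1 - 1) (\<lambda>z. (h (z + - v c) - h (z + v c + - v c)) -
          (h (z + v c + - v c) - h (z + v c + v c + - v c)))"
        by (rule ann_difference[OF ann_difference[OF ann_shift[OF insert.prems(2)]]])
      then show ?thesis by (simp add: h'_def[abs_def])
    qed
    moreover have good': "good q K v (\<Union>P') h'"
      unfolding good_def
    proof (intro conjI allI impI)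
      have per: "q dvd h (z + x) - h z" if "x \<in> K" for z x
        using insert.prems(1) that by (simp add: good_def periodic_def)
      show "periodic q K h'"
        unfolding periodic_def
      proof (intro allI ballI)
        fix z x assume x: "x \<in> K"
        have "h' (z + x) - h' z = (h (z - v c + x) - h (z - v c)) - (h (z + x) - h z)
            - ((h (z + x) - h z) - (h (z + v c + x) - h (z + v c)))"
          by (simp add: h'_def algebra_simps)
        also have "q dvd \<dots>" by (intro dvd_diff per x)
        finally show "q dvd h' (z + x) - h' z" .
      qed
      have minus: "q dvd h (z - v c)" if "q dvd h (z + sum v (B - {c}))" for z
      proof -
        have "h (z + sum v (B - {c})) = h (z - v c + sum v B)" by (simp add: sc algebra_simps)
        then have "q dvd h (z + sum v (B - {c})) - h (z - v c)" using per[OF zB, of "z - v c"] by simp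
        then show ?thesis using dvd_diff_right_iff[OF that] by blast
      qed
      have val: "q dvd h (sum v J + sum v I)"
        if J: "J \<subseteq> \<Union>P'" and I: "I \<subseteq> B" and nz: "sum v J \<notin> K \<or> sum v I \<notin> K" for J I
      proof -
        have "J \<inter> B = {}"
        proof -
          have "C \<inter> B = {}" if "C \<in> P'" for C
            using disjointD[OF partition_onD2[OF P(1)], of C B] that P'P BP insert.hyps(2) by auto
          then show ?thesis using J by blast
        qed
        moreover have JX: "J \<subseteq> X" using J P'P XP by blast
        ultimately have "sum v (J \<union> I) \<notin> K" using uf_split[OF K X(1) BX zB JX _ I] nz by blast
        moreover have "J \<union> I \<subseteq> \<Union>(insert B P')" using J I by blast
        ultimately have "q dvd h (sum v (J \<union> I))" using insert.prems(1) unfolding good_def by blast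
        moreover have "finite J" "finite I" "J \<inter> I = {}"
          using finite_subset[OF JX fX] finite_subset[OF I fB] I \<open>J \<inter> B = {}\<close> by blast+
        ultimately show ?thesis by (simp add: sum.union_disjoint)
      qed
      show "q dvd h' (sum v J)" if J: "J \<subseteq> \<Union>P'" "sum v J \<notin> K" for J
      proof -
        have 1: "q dvd h (sum v J + sum v {c})" "q dvd h (sum v J + sum v {})"
            "q dvd h (sum v J + sum v (B - {c}))"
          by (rule val[OF J(1)]; use J(2) c in simp)+
        have 2: "q dvd h (sum v J + v c)" "q dvd h (sum v J)" using 1(1,2) by simp_all
        show ?thesis unfolding h'_def by (intro dvd_diff 2 minus 1(3))
      qed
      show "\<not> q dvd h' 0"
      proof
        assume a: "q dvd h' 0"
        have sB: "sum v (B - {c}) \<notin> K"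
          using sc zB cK subgrpD(3)[OF K zB, of "sum v B - v c"] by auto
        have 1: "q dvd h (sum v {} + sum v {c})" "q dvd h (sum v {} + sum v (B - {c}))"
          by (rule val; use cK sB c in simp)+
        have 2: "q dvd h (0 + v c)" "q dvd h (0 - v c)" using 1(1) minus[of 0] 1(2) by simp_all
        have "q dvd h' 0 - h (0 - v c) - h (0 + v c)" by (intro dvd_diff a 2)
        \<comment> \<open>The two outer values of the second difference vanish modulo
          \<open>q\<close>, since \<open>v c\<close> and \<open>- v c\<close> are congruent to
          subset sums of \<open>B\<close> outside \<open>K\<close>. The middle value has the
          coefficient \<open>-2\<close>, which is invertible for odd \<open>q\<close>.\<close>
        then have "q dvd (-2) * h 0" by (simp add: h'_def)
        then have "q dvd 2 \<or> q dvd h 0" using q(1) by (simp add: prime_dvd_mult_iff)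
        moreover have "\<not> q dvd 2" using q by (metis primes_dvd_imp_eq two_is_prime_nat prime_int_numeral_eq)
        ultimately show False using insert.prems(1) by (simp add: good_def)
      qed
    qed
    ultimately have "2 * card P' < k - 1 - 1" using insert.IH P'P by blast
    then show ?case using insert.hyps by simp
  qed
qed

subsection \<open>Elementary groups of rank two\<close>

primrec nmul :: "nat \<Rightarrow> 'v::ab_group_add \<Rightarrow> 'v" where
  "nmul 0 x = 0"
| "nmul (Suc n) x = nmul n x + x"

lemma nmul_add: "nmul (i + j) x = nmul i x + nmul j x"
  by (induction j) (simp_all add: algebra_simps)

text \<open>Generation modulo \<open>K\<close> is phrased through subgroups so that it applies
  directly to the group of periods of a function modulo \<open>q\<close>.\<close>

definition generates :: "'v::ab_group_add set \<Rightarrow> 'v \<Rightarrow> 'v \<Rightarrow> bool" where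
  "generates K a b \<longleftrightarrow> (\<forall>H. subgrp H \<longrightarrow> K \<subseteq> H \<longrightarrow> a \<in> H \<longrightarrow> b \<in> H \<longrightarrow> H = UNIV)"

lemma periods_subgrp: "subgrp {g. \<forall>z. q dvd f (z + g) - (f z :: int)}"
  unfolding subgrp_def
proof (intro conjI ballI)
  fix x y assume "x \<in> {g. \<forall>z. q dvd f (z + g) - f z}" "y \<in> {g. \<forall>z. q dvd f (z + g) - f z}"
  then have x: "q dvd f (z + x) - f z" and y: "q dvd f (z + y) - f z" for z by blast+
  have "q dvd (f (z + x + y) - f (z + x)) + (f (z + x) - f z)" for z by (intro dvd_add x y)
  then show "x + y \<in> {g. \<forall>z. q dvd f (z + g) - f z}" by (simp add: add.assoc)
  have "q dvd (f (z - y + x) - f (z - y)) - (f (z - y + y) - f (z - y))" for z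
    by (intro dvd_diff x y)
  then show "x - y \<in> {g. \<forall>z. q dvd f (z + g) - f z}" by (simp add: algebra_simps)
qed simp

lemma generates_constant:
  assumes "generates K a b" "periodic q K f"
    and "\<And>z. q dvd f z - f (z + a)" "\<And>z. q dvd f z - f (z + b)"
  shows "q dvd f x - f 0"
proof -
  have "{g. \<forall>z. q dvd f (z + g) - f z} = UNIV"
  proof (rule assms(1)[unfolded generates_def, rule_format, OF periods_subgrp])
    show "K \<subseteq> {g. \<forall>z. q dvd f (z + g) - f z}" using assms(2) by (auto simp: periodic_def)
    show "a \<in> {g. \<forall>z. q dvd f (z + g) - f z}" using assms(3) by (simp add: dvd_diff_commute)
    show "b \<in> {g. \<forall>z. q dvd f (z + g) - f z}" using assms(4) by (simp add: dvd_diff_commute)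
  qed
  then have "q dvd f (0 + x) - f 0" by blast
  then show ?thesis by simp
qed

text \<open>The difference in any direction \<open>v i\<close> has smaller degree and vanishes on
  the cube over \<open>E - {i}\<close>, hence everywhere by induction. Then two generating
  directions are periods, so \<open>f\<close> is constant, and its value at the vertex 0 vanishes.
  Having one direction more than \<open>m\<close> guarantees that two are available in every
  step.\<close>

lemma vanishes_on_cube:
  assumes E: "finite E" "card E = Suc m" and g: "\<And>i j. i \<in> E \<Longrightarrow> j \<in> E \<Longrightarrow> i \<noteq> j \<Longrightarrow> generates K (v i) (v j)"
    and f: "periodic q K f" "ann q m f" and J: "\<And>J. J \<subseteq> E \<Longrightarrow> q dvd f (sum v J)"
  shows "q dvd f z"
  using E g f J
proof (induction m arbitrary: E f z)
  case 0
  then show ?case by simp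
next
  case (Suc m)
  have diff: "q dvd f x - f (x + v i)" if i: "i \<in> E" for i x
  proof (rule Suc.IH[of "E - {i}" "\<lambda>x. f x - f (x + v i)"])
    show "finite (E - {i})" "card (E - {i}) = Suc m" using Suc.prems(1,2) i by simp_all
    show "generates K (v j) (v k)" if "j \<in> E - {i}" "k \<in> E - {i}" "j \<noteq> k" for j k using Suc.prems(3) that by blast
    show "periodic q K (\<lambda>x. f x - f (x + v i))"
      unfolding periodic_def
    proof (intro allI ballI)
      fix z x assume "x \<in> K"
      then have "q dvd (f (z + x) - f z) - (f (z + v i + x) - f (z + v i))"
        using Suc.prems(4) dvd_diff[of q "f (z + x) - f z" "f (z + v i + x) - f (z + v i)"]
        unfolding periodic_def by blast
      then show "q dvd f (z + x) - f (z + x + v i) - (f z - f (z + v i))" by (simp add: algebra_simps)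
    qed
    show "ann q m (\<lambda>x. f x - f (x + v i))" using Suc.prems(5) by simp
    show "q dvd f (sum v J) - f (sum v J + v i)" if J: "J \<subseteq> E - {i}" for J
    proof -
      have "finite J" "i \<notin> J" using J Suc.prems(1) finite_subset by auto
      then have "sum v J + v i = sum v (insert i J)" by (simp add: add.commute)
      moreover have "J \<subseteq> E" "insert i J \<subseteq> E" using J i by auto
      ultimately show ?thesis using Suc.prems(6)[of J] Suc.prems(6)[of "insert i J"] by simp
    qed
  qed
  have "\<not> is_singleton E" "E \<noteq> {}" using Suc.prems(2) by (auto simp: is_singleton_altdef)
  then obtain i j where ij: "i \<in> E" "j \<in> E" "i \<noteq> j"
    by (metis is_singletonI' )
  have "q dvd f z - f 0"
    by (rule generates_constant[OF Suc.prems(3)[OF ij] Suc.prems(4) diff[OF ij(1)] diff[OF ij(2)]])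
  moreover have "q dvd f 0" using Suc.prems(6)[of "{}"] by simp
  ultimately show ?case using dvd_diff_left_iff by blast
qed

text \<open>With the translation \<open>T\<close> by \<open>x\<close>, the operator is the combination of \<open>1, T, T^l, T^(l+1)\<close> that is
  divisible by \<open>(1 - T)^3\<close>. The weights of \<open>1\<close> and \<open>T^l\<close> do not cancel, which is what eliminates two
  blocks containing parallel elements in \<open>good_remove_parallel_blocks\<close>.\<close>

lemma third_difference:
  fixes f :: "'v::ab_group_add \<Rightarrow> int"
  assumes "ann q k f" and l: "1 \<le> l"
  shows "ann q (k - 3) (\<lambda>z. (int l - 1) * f z - (int l + 1) * f (z + x) +
    (int l + 1) * f (z + nmul l x) - (int l - 1) * f (z + nmul (l + 1) x))"
proof -
  define g where "g z = f z - f (z + x)" for z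
  \<comment> \<open>With translation \<open>T\<close> by \<open>x\<close>, the summand is
    \<open>(1 - T) (1 - T^i) (1 - T^(l - i))\<close> applied to \<open>f\<close>. Summing over
    \<open>i\<close> lets the inner terms telescope, and only the exponents 0, 1, \<open>l\<close>
    and \<open>l + 1\<close> remain.\<close>
  define W where "W z = (\<Sum>i\<in>{1..<l}. (g z - g (z + nmul i x)) -
    (g (z + nmul (l - i) x) - g (z + nmul (l - i) x + nmul i x)))" for z
  have "ann q (k - 1) g" unfolding g_def[abs_def] by (rule ann_difference[OF assms(1)])
  then have "ann q (k - 1 - 1 - 1) W"
    unfolding W_def[abs_def] by (intro ann_sum ann_difference)
  moreover have "W z = (int l - 1) * f z - (int l + 1) * f (z + x) +
    (int l + 1) * f (z + nmul l x) - (int l - 1) * f (z + nmul (l + 1) x)" for z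
  proof -
    define G where "G i = g (z + nmul i x)" for i
    define F where "F i = f (z + nmul i x)" for i
    have GF: "G i = F i - F (Suc i)" for i by (simp add: G_def F_def g_def add.assoc)
    have "W z = (\<Sum>i\<in>{1..<l}. (G 0 + G l) - G i - G (l - i))"
      unfolding W_def
    proof (rule sum.cong[OF refl])
      fix i assume "i \<in> {1..<l}"
      then have "nmul (l - i) x + nmul i x = nmul l x" by (simp add: nmul_add[symmetric])
      then have "g (z + nmul (l - i) x + nmul i x) = G l" by (simp add: G_def add.assoc)
      then show "g z - g (z + nmul i x) - (g (z + nmul (l - i) x) - g (z + nmul (l - i) x + nmul i x))
          = (G 0 + G l) - G i - G (l - i)"
        by (simp add: G_def)
    qed
    also have "\<dots> = (int l - 1) * (G 0 + G l) - (\<Sum>i\<in>{1..<l}. G i) - (\<Sum>i\<in>{1..<l}. G (l - i))"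
      using l by (simp add: sum_subtractf of_nat_diff)
    also have "(\<Sum>i\<in>{1..<l}. G (l - i)) = (\<Sum>i\<in>{1..<l}. G i)"
      by (rule sum.reindex_bij_witness[of _ "\<lambda>i. l - i" "\<lambda>i. l - i"]) auto
    also have "(\<Sum>i\<in>{1..<l}. G i) = F 1 - F l"
      unfolding GF using sum_Suc_diff'[OF l, of "\<lambda>i. - F i"] by simp
    finally show ?thesis by (simp add: GF) (simp add: F_def algebra_simps)
  qed
  then have "W = (\<lambda>z. (int l - 1) * f z - (int l + 1) * f (z + x) +
    (int l + 1) * f (z + nmul l x) - (int l - 1) * f (z + nmul (l + 1) x))" by (rule ext)
  ultimately show ?thesis by (simp add: numeral_3_eq_3)
qed

text \<open>Every zero-sum set contains \<open>B\<close> or avoids it, so inserting and deleting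
  \<open>B\<close> pairs off the sets that are counted. The pairing reverses signs because
  \<open>B\<close> is odd.\<close>

lemma signed_count_odd_block:
  assumes K: "subgrp K" and Y: "uf K v Y" and B: "B \<subseteq> R" "minzs K v B" "odd (card B)"
    and R: "R \<subseteq> Y" and J: "J \<subseteq> Y" "J \<inter> R = {}"
  shows "signed_count K v R J = 0"
proof -
  have fY: "finite Y" using Y by (simp add: uf_def)
  have fB: "finite B" using B(3) by (metis card.infinite even_zero)
  have neB: "B \<noteq> {}" using B(3) by auto
  have zB: "sum v B \<in> K" using B(2) by (simp add: minzs_def)
  define S where "S = {I. I \<subseteq> R \<and> sum v (J \<union> I) \<in> K}"
  define S0 where "S0 = {I \<in> S. I \<inter> B = {}}"
  have fin: "finite I" if "I \<in> S" for I
    using that R fY by (auto simp: S_def intro: finite_subset)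
  have "S \<subseteq> Pow Y" using R by (auto simp: S_def)
  then have fS: "finite S" using fY by (meson finite_Pow_iff finite_subset)
  have zU: "sum v (J \<union> (I \<union> B)) \<in> K \<longleftrightarrow> sum v (J \<union> I) \<in> K" if I: "I \<subseteq> R" "I \<inter> B = {}" for I
  proof -
    have "finite (J \<union> I)" using I J R fY by (meson Un_least finite_subset order_trans)
    moreover have "B \<inter> (J \<union> I) = {}" using I(2) J(2) B(1) by blast
    moreover have "J \<union> (I \<union> B) = B \<union> (J \<union> I)" by blast
    ultimately show ?thesis using sum_Un_mem[OF K fB _ _ zB] by simp
  qed
  have eq: "S = S0 \<union> (\<lambda>I. I \<union> B) ` S0"
  proof (intro equalityI subsetI)
    fix I assume I: "I \<in> S"
    then have IR: "I \<subseteq> R" "sum v (J \<union> I) \<in> K" by (simp_all add: S_def)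
    have "(J \<union> I) \<inter> B = {} \<or> B \<subseteq> J \<union> I"
      using IR J(1) R B(1) by (intro uf_block[OF Y _ B(2)]) auto
    then consider "I \<inter> B = {}" | "B \<subseteq> I" using J(2) B(1) by blast
    then show "I \<in> S0 \<union> (\<lambda>I. I \<union> B) ` S0"
    proof cases
      case 1
      then show ?thesis using I by (simp add: S0_def)
    next
      case 2
      then have e: "(I - B) \<union> B = I" by blast
      then have "sum v (J \<union> (I - B)) \<in> K" using zU[of "I - B"] IR by auto
      then have "I - B \<in> S0" using IR(1) by (auto simp: S0_def S_def)
      then show ?thesis using e by (metis UnI2 image_eqI)
    qed
  next
    fix I assume "I \<in> S0 \<union> (\<lambda>I. I \<union> B) ` S0"
    then show "I \<in> S" using zU B(1) by (auto simp: S0_def S_def)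
  qed
  have "S0 \<inter> (\<lambda>I. I \<union> B) ` S0 = {}" using neB by (auto simp: S0_def)
  then have "signed_count K v R J = (\<Sum>I\<in>S0. (- 1) ^ card I) + (\<Sum>I\<in>(\<lambda>I. I \<union> B) ` S0. (- 1) ^ card I)"
    unfolding signed_count_def S_def[symmetric] using fS by (subst eq, subst sum.union_disjoint) (auto simp: S0_def)
  also have "(\<Sum>I\<in>(\<lambda>I. I \<union> B) ` S0. (- 1) ^ card I) = (\<Sum>I\<in>S0. (- 1) ^ card (I \<union> B) :: int)"
    by (subst sum.reindex) (auto simp: inj_on_def S0_def)
  also have "\<dots> = (\<Sum>I\<in>S0. - ((- 1) ^ card I))"
  proof (rule sum.cong[OF refl])
    fix I assume "I \<in> S0"
    then have "card (I \<union> B) = card I + card B"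
      using fin fB by (intro card_Un_disjoint) (auto simp: S0_def)
    then show "(- 1) ^ card (I \<union> B) = - ((- 1) ^ card I :: int)" using B(3) by (simp add: power_add)
  qed
  finally show ?thesis by (simp add: sum_negf)
qed

text \<open>Take \<open>R\<close> to omit one element of every block and a second one, \<open>c'\<close>, of \<open>B1\<close>. Putting back the
  omitted element of another block makes this odd block cancel, so the difference of \<open>f\<close> in that
  direction vanishes. Two such directions generate the group and \<open>f\<close> is constant. But \<open>f\<close> agrees with
  \<open>h\<close> at \<open>0\<close> and vanishes at the omitted element of \<open>B1\<close>, because \<open>c'\<close> is missing.\<close>

lemma good_odd_blocks:
  fixes v :: "'i \<Rightarrow> 'v::ab_group_add"
  assumes q: "prime q" and K: "subgrp K" and Y: "uf K v Y" "\<And>i. i \<in> Y \<Longrightarrow> v i \<notin> K"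
    and P: "partition_on Y P" "\<And>B. B \<in> P \<Longrightarrow> minzs K v B"
    and odd: "\<And>B. B \<in> P \<Longrightarrow> odd (card B)"
    and g: "\<And>B C b c. B \<in> P \<Longrightarrow> C \<in> P \<Longrightarrow> B \<noteq> C \<Longrightarrow> b \<in> B \<Longrightarrow> c \<in> C \<Longrightarrow> generates K (v b) (v c)"
    and h: "good q K v Y h" "ann q k h" and P3: "3 \<le> card P"
  shows "card Y \<le> k + 1"
proof (rule ccontr)
  assume big: "\<not> card Y \<le> k + 1"
  have fY: "finite Y" using Y(1) by (simp add: uf_def)
  have YP: "Y = \<Union>P" using partition_onD1[OF P(1)] .
  define r where "r = (\<lambda>B. SOME i. i \<in> (B :: 'i set))"
  have r: "r B \<in> B" if "B \<in> P" for B
    unfolding r_def using partition_onD3[OF P(1)] that by (metis ex_in_conv someI_ex)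
  note cr = card_reps[OF P(1) r]
  have fP: "finite P" using P3 by (intro card_ge_0_finite) simp
  \<comment> \<open>\<open>B1\<close> gives up two members, while \<open>B2\<close> and
    \<open>B3\<close> provide the two directions that generate. This is why three blocks are
    required.\<close>
  obtain S where S: "S \<subseteq> P" "card S = 3" using obtain_subset_with_card_n[OF P3] by metis
  obtain B1 B2 B3 where BS: "S = {B1, B2, B3}" and Bne: "B1 \<noteq> B2" "B2 \<noteq> B3" "B1 \<noteq> B3"
    using card_3_iff[THEN iffD1, OF S(2)] by (elim exE conjE)
  have B: "B1 \<in> P" "B2 \<in> P" "B3 \<in> P" "B1 \<noteq> B2" "B1 \<noteq> B3" "B2 \<noteq> B3"
    using S(1) BS Bne by simp_all
  have BY: "B \<subseteq> Y" if "B \<in> P" for B using that YP by blast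
  have fB: "finite B" if "B \<in> P" for B using BY[OF that] fY finite_subset by blast
  have zB: "sum v B \<in> K" if "B \<in> P" for B using P(2)[OF that] by (simp add: minzs_def)
  have "B1 \<noteq> {r B1}"
  proof
    assume "B1 = {r B1}"
    then have "sum v B1 = v (r B1)" by (metis sum.insert sum.empty add_0_right finite.emptyI empty_iff)
    then have "v (r B1) \<in> K" using zB[OF B(1)] by simp
    then show False using Y(2) r[OF B(1)] BY[OF B(1)] by blast
  qed
  then obtain c' where c': "c' \<in> B1" "c' \<noteq> r B1" using r[OF B(1)] by blast
  have c'r: "c' \<notin> r ` P"
  proof
    assume "c' \<in> r ` P"
    then obtain B where "B \<in> P" "c' = r B" by blast
    then have "c' \<in> B" "B \<noteq> B1" using r c' by auto
    then show False using disjointD[OF partition_onD2[OF P(1)] \<open>B \<in> P\<close> B(1)] c'(1) by blast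
  qed
  define R where "R = Y - insert c' (r ` P)"
  have RY: "R \<subseteq> Y" "finite R" using fY by (auto simp: R_def)
  have "card R = card Y - (card P + 1)"
    unfolding R_def using cr c'r c'(1) BY[OF B(1)] fP
    by (subst card_Diff_subset) (auto simp: card_image)
  \<comment> \<open>If the bound fails, then \<open>card R \<ge> k + 1 - card P\<close>. One further
    difference below leaves the index \<open>card P - 2\<close>, which is one less than the number
    of representatives of the other blocks, as \<open>vanishes_on_cube\<close> demands.\<close>
  then have kR: "k - card R \<le> card P - 1" using big P3 by linarith
  define f where "f = iter_diff v R h"
  have annf: "ann q (card P - 1) f"
    unfolding f_def by (rule ann_mono[OF ann_iter_diff[OF RY(2) h(2)] kR])
  have perf: "periodic q K f" unfolding f_def using h(1) periodic_iter_diff by (auto simp: good_def)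
  have diff0: "q dvd f z - f (z + v (r B))" if BP: "B \<in> P" "B \<noteq> B1" for B z
  proof -
    have rR: "r B \<notin> R" using BP by (simp add: R_def)
    define E where "E = r ` (P - {B})"
    define f' where "f' = iter_diff v (insert (r B) R) h"
    have f': "f' z = f z - f (z + v (r B))" for z
      unfolding f'_def f_def using RY(2) rR by (rule iter_diff_insert)
    have "card E = card P - 1"
      unfolding E_def using inj_on_subset[OF cr(1)] BP fP by (subst card_image) auto
    then have cE: "card E = Suc (card P - 2)" using P3 by simp
    have "q dvd f' z"
    proof (rule vanishes_on_cube[where K = K and v = v and f = f', OF _ cE])
      show "finite E" using fP by (simp add: E_def)
      show "generates K (v i) (v j)" if ij: "i \<in> E" "j \<in> E" "i \<noteq> j" for i j
      proof -
        obtain C D where CD: "C \<in> P" "D \<in> P" "i = r C" "j = r D" using ij(1,2) by (auto simp: E_def)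
        then have "C \<noteq> D" using ij(3) by auto
        then show ?thesis using g[OF CD(1,2) _ r[OF CD(1)] r[OF CD(2)]] CD(3,4) by simp
      qed
      show "periodic q K f'" unfolding f'_def using h(1) periodic_iter_diff by (auto simp: good_def)
      have "f' = (\<lambda>z. f z - f (z + v (r B)))" using f' by (rule ext)
      then have "ann q (card P - 1 - 1) f'" using ann_difference[OF annf] by simp
      then show "ann q (card P - 2) f'" by (simp add: numeral_2_eq_2)
      fix J assume J: "J \<subseteq> E"
      have EY: "E \<subseteq> Y" using cr(2) by (auto simp: E_def)
      have JR: "J \<inter> insert (r B) R = {}"
        using J cr(1) BP by (auto simp: E_def R_def dest: inj_onD)
      have JB: "J \<inter> B = {}"
      proof -
        have "r C \<notin> B" if "C \<in> P" "C \<noteq> B" for C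
          using disjointD[OF partition_onD2[OF P(1)] that(1) BP(1) that(2)] r[OF that(1)] by blast
        then show ?thesis using J by (auto simp: E_def)
      qed
      have BR: "B \<subseteq> insert (r B) R"
      proof
        fix x assume x: "x \<in> B"
        have "x \<noteq> c'" using disjointD[OF partition_onD2[OF P(1)] BP(1) B(1) BP(2)] x c'(1) by blast
        moreover have "x \<noteq> r C" if "C \<in> P" "C \<noteq> B" for C
          using disjointD[OF partition_onD2[OF P(1)] that(1) BP(1) that(2)] r[OF that(1)] x by blast
        ultimately show "x \<in> insert (r B) R" using x BY[OF BP(1)] by (auto simp: R_def)
      qed
      have RY': "insert (r B) R \<subseteq> Y" using RY(1) r[OF BP(1)] BY[OF BP(1)] by blast
      have "signed_count K v (insert (r B) R) J = 0"
        using J EY by (intro signed_count_odd_block[OF K Y(1) BR P(2)[OF BP(1)] odd[OF BP(1)] RY' _ JR]) auto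
      then show "q dvd f' (sum v J)"
        unfolding f'_def using iter_diff_val[OF h(1) fY _ RY' JR] J EY by auto
    qed
    then show ?thesis by (simp add: f')
  qed
  have const: "q dvd f z - f 0" for z
  proof (rule generates_constant[OF _ perf])
    show "generates K (v (r B2)) (v (r B3))" using g[OF B(2,3,6) r[OF B(2)] r[OF B(3)]] .
    show "q dvd f z - f (z + v (r B2))" for z using diff0[OF B(2)] B(4) by auto
    show "q dvd f z - f (z + v (r B3))" for z using diff0[OF B(3)] B(5) by auto
  qed
  have nR: "r B \<notin> R" if "B \<in> P" for B using that by (simp add: R_def)
  have "signed_count K v R {} = (- 1) ^ card ({} :: 'i set)"
  proof (rule signed_count_unique)
    fix I assume I: "I \<subseteq> R" "sum v ({} \<union> I) \<in> K"
    then show "I = {}"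
      using r nR RY(1) by (intro transversal_zero_sum_free[OF K Y(1) P, of I r]) auto
  qed (auto simp: subgrpD[OF K])
  then have f0: "q dvd f 0 - h 0"
    unfolding f_def using iter_diff_val[OF h(1) fY _ RY(1), of "{}"] by simp
  have "signed_count K v R {r B1} = 0"
  proof (rule signed_count_none)
    fix I assume I: "I \<subseteq> R" "sum v ({r B1} \<union> I) \<in> K"
    have "({r B1} \<union> I) \<inter> B1 = {} \<or> B1 \<subseteq> {r B1} \<union> I"
      using I RY(1) BY[OF B(1)] r[OF B(1)] by (intro uf_block[OF Y(1) _ P(2)[OF B(1)]]) auto
    then have "c' \<in> {r B1} \<union> I" using r[OF B(1)] c'(1) by blast
    then show False using c'(2) I(1) by (auto simp: R_def)
  qed
  then have f1: "q dvd f (v (r B1))"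
    unfolding f_def using iter_diff_val[OF h(1) fY _ RY(1), of "{r B1}"] nR[OF B(1)] BY[OF B(1)] r[OF B(1)] by auto
  have "q dvd f (v (r B1)) - (f (v (r B1)) - f 0) - (f 0 - h 0)"
    by (intro dvd_diff f1 const f0)
  then have "q dvd h 0" by simp
  then show False using h(1) by (simp add: good_def)
qed

section \<open>Eliminating blocks at the full rate\<close>

lemma periodic_combination:
  assumes "periodic q K f"
  shows "periodic q K (\<lambda>z. a * f z - b * f (z + x) + b * f (z + y) - a * f (z + w))"
  unfolding periodic_def
proof (intro allI ballI)
  fix z u assume u: "u \<in> K"
  have p: "q dvd f (z + u) - f z" for z using assms u by (simp add: periodic_def)
  have "q dvd a * (f (z + u) - f z) - b * (f (z + x + u) - f (z + x)) +
      b * (f (z + y + u) - f (z + y)) - a * (f (z + w + u) - f (z + w))"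
    by (intro dvd_add dvd_diff dvd_mult p)
  then show "q dvd a * f (z + u) - b * f (z + u + x) + b * f (z + u + y) - a * f (z + u + w) -
      (a * f z - b * f (z + x) + b * f (z + y) - a * f (z + w))"
    by (simp add: algebra_simps)
qed

text \<open>Among the subsets of \<open>B\<close> only \<open>{}\<close> and \<open>B\<close> are
  zero-sum, and for even \<open>B\<close> they have the same sign, so the value at 0 is
  \<open>2 * h 0\<close>. All members of \<open>B\<close> are used for differences, hence nothing is
  lost in comparison with the degree.\<close>

lemma good_remove_even_block:
  assumes q: "prime q" "q \<noteq> 2" and K: "subgrp K" and Y: "uf K v Y"
    and B: "B \<subseteq> Y" "minzs K v B" "even (card B)" "B \<noteq> {}" and h: "good q K v Y h"
  shows "good q K v (Y - B) (iter_diff v B h)"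
  unfolding good_def
proof (intro conjI allI impI)
  have fY: "finite Y" using Y by (simp add: uf_def)
  have zB: "sum v B \<in> K" using B(2) by (simp add: minzs_def)
  show "periodic q K (iter_diff v B h)" using h periodic_iter_diff by (auto simp: good_def)
  fix J assume J: "J \<subseteq> Y - B" "sum v J \<notin> K"
  have "signed_count K v B (J \<union> {}) = 0"
    using J by (intro signed_count_split[OF K Y B(1) zB]) auto
  then show "q dvd iter_diff v B h (sum v J)"
    using iter_diff_val[OF h fY _ B(1), of J] J(1) by auto
next
  have fY: "finite Y" using Y by (simp add: uf_def)
  have zB: "sum v B \<in> K" using B(2) by (simp add: minzs_def)
  have "{I. I \<subseteq> B \<and> sum v ({} \<union> I) \<in> K} = {{}, B}"
    using B(2) subgrpD(1)[OF K] by (auto simp: minzs_def)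
  then have "signed_count K v B {} = (\<Sum>I\<in>{{}, B}. (- 1) ^ card I)" by (simp only: signed_count_def)
  moreover have "{} \<noteq> B" using B(4) by simp
  ultimately have "signed_count K v B {} = 2" using B(3) by simp
  then have d: "q dvd iter_diff v B h 0 - 2 * h 0" using iter_diff_val[OF h fY _ B(1), of "{}"] by simp
  show "\<not> q dvd iter_diff v B h 0"
  proof
    assume "q dvd iter_diff v B h 0"
    then have "q dvd 2 * h 0" using d dvd_diff_right_iff by blast
    then have "q dvd 2 \<or> q dvd h 0" using q(1) by (simp add: prime_dvd_mult_iff)
    moreover have "\<not> q dvd 2" using q by (metis primes_dvd_imp_eq two_is_prime_nat prime_int_numeral_eq)
    ultimately show False using h by (simp add: good_def)
  qed
qed

text \<open>Differences are taken along all members except \<open>c\<close>, \<open>c'\<close> and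
  \<open>d\<close>, and the third difference in direction \<open>v c\<close> makes up for these
  three. Of its four points 0, \<open>c\<close>, \<open>d\<close> and \<open>c + d\<close>, only 0
  and \<open>d\<close> can be completed to a zero-sum set, because the missing \<open>c'\<close>
  excludes every set that meets \<open>B\<close>. As \<open>C\<close> is odd, both completions have
  sign 1, and their weights \<open>l - 1\<close> and \<open>l + 1\<close> add up to
  \<open>2 * l\<close>, which is invertible modulo \<open>q\<close>.\<close>

lemma good_remove_parallel_blocks:
  assumes q: "prime q" "q \<noteq> 2" and K: "subgrp K" and Y: "uf K v Y"
    and B: "B \<subseteq> Y" "minzs K v B" "c \<in> B" "c' \<in> B" "c \<noteq> c'"
    and C: "C \<subseteq> Y" "minzs K v C" "d \<in> C" "odd (card C)" and BC: "B \<inter> C = {}"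
    and l: "\<not> q dvd int l" "v d - nmul l (v c) \<in> K"
    and h: "good q K v Y h" "ann q k h"
  obtains h' where "good q K v (Y - (B \<union> C)) h'" "ann q (k - card (B \<union> C)) h'"
proof
  have fY: "finite Y" using Y by (simp add: uf_def)
  have fBC: "finite B" "finite C" using B(1) C(1) fY finite_subset by blast+
  have zBC: "sum v (B \<union> C) \<in> K"
    using B(2) C(2) sum_Un_mem[OF K fBC BC] by (simp add: minzs_def)
  have BCY: "B \<union> C \<subseteq> Y" using B(1) C(1) by simp
  have dcc: "d \<noteq> c" "d \<noteq> c'" using B(3,4) C(3) BC by auto
  define R where "R = (B \<union> C) - {c, c', d}"
  have R: "R \<subseteq> B \<union> C" "R \<subseteq> Y" "finite R" "R \<inter> {c, c', d} = {}"
    using BCY fBC by (auto simp: R_def)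
  have "card {c, c', d} = 3" "{c, c', d} \<subseteq> B \<union> C" using dcc B C(3) by auto
  then have cR: "card (B \<union> C) = card R + 3"
    unfolding R_def using fBC by (metis card_Diff_subset card_mono finite.emptyI finite_UnI finite_insert le_add_diff_inverse2)
  define f where "f = iter_diff v R h"
  define h' where "h' z = (int l - 1) * f z - (int l + 1) * f (z + v c) +
    (int l + 1) * f (z + v d) - (int l - 1) * f (z + (v c + v d))" for z
  have perf: "periodic q K f" unfolding f_def using h(1) periodic_iter_diff by (auto simp: good_def)
  have "1 \<le> l" using l(1) by (cases l) auto
  then have "ann q (k - card R - 3) (\<lambda>z. (int l - 1) * f z - (int l + 1) * f (z + v c) +
    (int l + 1) * f (z + nmul l (v c)) - (int l - 1) * f (z + nmul (l + 1) (v c)))"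
    unfolding f_def by (intro third_difference ann_iter_diff R(3) h(2))
  \<comment> \<open>Since \<open>v d\<close> is congruent to \<open>nmul l (v c)\<close> modulo
    \<open>K\<close>, periodicity identifies \<open>h'\<close> with the third difference.\<close>
  moreover have "q dvd h' z - ((int l - 1) * f z - (int l + 1) * f (z + v c) +
    (int l + 1) * f (z + nmul l (v c)) - (int l - 1) * f (z + nmul (l + 1) (v c)))" for z
  proof -
    have p: "q dvd f (z + (v d - nmul l (v c))) - f z" for z
      using perf l(2) by (simp add: periodic_def)
    have "q dvd (int l + 1) * (f (z + nmul l (v c) + (v d - nmul l (v c))) - f (z + nmul l (v c))) -
      (int l - 1) * (f (z + nmul (l + 1) (v c) + (v d - nmul l (v c))) - f (z + nmul (l + 1) (v c)))"
      by (intro dvd_diff dvd_mult p)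
    then show ?thesis by (simp add: h'_def algebra_simps)
  qed
  ultimately have "ann q (k - card R - 3) h'" by (rule ann_cong)
  then show "ann q (k - card (B \<union> C)) h'" by (simp add: cR)
  show "good q K v (Y - (B \<union> C)) h'"
    unfolding good_def
  proof (intro conjI allI impI)
    show "periodic q K h'" unfolding h'_def[abs_def] by (rule periodic_combination[OF perf])
    have val: "q dvd f (sum v J + sum v S) - signed_count K v R (J \<union> S) * h 0"
      if "J \<subseteq> Y - (B \<union> C)" "S \<subseteq> {c, d}" for J S
    proof -
      have "finite J" "finite S" "J \<inter> S = {}" using that B(3) C(3) fY by (auto intro: finite_subset)
      then have s: "sum v J + sum v S = sum v (J \<union> S)" by (simp add: sum.union_disjoint)
      show ?thesis unfolding s f_def
        using that R BCY B(3) C(3) by (intro iter_diff_val[OF h(1) fY]) auto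
    qed
    have hs: "h' (sum v J) = (int l - 1) * f (sum v J + sum v {}) - (int l + 1) * f (sum v J + sum v {c}) +
      (int l + 1) * f (sum v J + sum v {d}) - (int l - 1) * f (sum v J + sum v {c, d})" for J
      using dcc by (simp add: h'_def)
    show "q dvd h' (sum v J)" if J: "J \<subseteq> Y - (B \<union> C)" "sum v J \<notin> K" for J
    proof -
      have 0: "q dvd f (sum v J + sum v S)" if S: "S \<subseteq> {c, d}" for S
      proof -
        have "signed_count K v R (J \<union> S) = 0"
          using J S R(1) B(3) C(3) by (intro signed_count_split[OF K Y BCY zBC]) auto
        then show ?thesis using val[OF J(1) S] by simp
      qed
      show ?thesis unfolding hs by (intro dvd_add dvd_diff dvd_mult 0) simp_all
    qed
    have noB: "I \<inter> B = {}" if I: "I \<subseteq> Y" "sum v I \<in> K" "c' \<notin> I" for I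
      using uf_block[OF Y B(1,2) I(1,2)] I(3) B(4) by blast
    have noC: "I \<inter> C = {} \<or> C \<subseteq> I" if I: "I \<subseteq> Y" "sum v I \<in> K" for I
      using uf_block[OF Y C(1,2) I] .
    have c'R: "c' \<notin> R" "d \<notin> R" by (simp_all add: R_def)
    have 1: "signed_count K v R ({} \<union> {}) = (- 1) ^ card ({} :: 'b set)"
    proof (rule signed_count_unique)
      fix I assume I: "I \<subseteq> R" "sum v ({} \<union> {} \<union> I) \<in> K"
      then have "I \<subseteq> Y" "sum v I \<in> K" "c' \<notin> I" "d \<notin> I" using R(2) c'R by auto
      then have "I \<inter> B = {}" "I \<inter> C = {}" using noB noC C(3) by blast+
      then show "I = {}" using I(1) R(1) by blast
    qed (auto simp: subgrpD[OF K])
    have 2: "signed_count K v R ({} \<union> S) = 0" if S: "c \<in> S" "S \<subseteq> {c, d}" for S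
    proof (rule signed_count_none)
      fix I assume I: "I \<subseteq> R" "sum v ({} \<union> S \<union> I) \<in> K"
      have "(S \<union> I) \<inter> B = {}"
        using I S R(2) c'R dcc B BCY C(3) by (intro noB) auto
      then show False using S(1) B(3) by blast
    qed
    have 3: "signed_count K v R ({} \<union> {d}) = (- 1) ^ card (C - {d})"
    proof (rule signed_count_unique)
      show "C - {d} \<subseteq> R" using B(3,4) BC by (auto simp: R_def)
      have "{} \<union> {d} \<union> (C - {d}) = C" using C(3) by blast
      then show "sum v ({} \<union> {d} \<union> (C - {d})) \<in> K" using C(2) by (simp add: minzs_def)
      fix I assume I: "I \<subseteq> R" "sum v ({} \<union> {d} \<union> I) \<in> K"
      have sub: "{d} \<union> I \<subseteq> Y" using I(1) R(2) C(1,3) by blast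
      have z: "sum v ({d} \<union> I) \<in> K" using I(2) by simp
      have "c' \<notin> {d} \<union> I" using I(1) c'R dcc by blast
      then have "({d} \<union> I) \<inter> B = {}" using noB[OF sub z] by blast
      moreover have "C \<subseteq> {d} \<union> I" using noC[OF sub z] C(3) by blast
      ultimately show "I = C - {d}" using I(1) R(1) c'R by blast
    qed
    have "even (card (C - {d}))" using C(3,4) fBC by simp
    then have 3: "signed_count K v R ({} \<union> {d}) = 1" unfolding 3 by simp
    show "\<not> q dvd h' 0"
    proof
      assume a: "q dvd h' 0"
      have v0: "q dvd f (sum v {} + sum v {}) - 1 * h 0"
        using val[of "{}" "{}"] 1 by simp
      have vd: "q dvd f (sum v {} + sum v {d}) - 1 * h 0"
        using val[of "{}" "{d}"] 3 by simp
      have vc: "q dvd f (sum v {} + sum v {c})" using val[of "{}" "{c}"] 2[of "{c}"] by simp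
      have vcd: "q dvd f (sum v {} + sum v {c, d})" using val[of "{}" "{c, d}"] 2[of "{c, d}"] by simp
      have "q dvd h' (sum v {}) - (int l - 1) * (f (sum v {} + sum v {}) - 1 * h 0)
        - (int l + 1) * (f (sum v {} + sum v {d}) - 1 * h 0)
        + (int l + 1) * f (sum v {} + sum v {c}) + (int l - 1) * f (sum v {} + sum v {c, d})"
        using a by (intro dvd_add dvd_diff dvd_mult v0 vd vc vcd) simp
      then have "q dvd 2 * int l * h 0" unfolding hs by (simp add: algebra_simps)
      then have "q dvd 2 \<or> q dvd int l \<or> q dvd h 0" using q(1) by (simp add: prime_dvd_mult_iff)
      moreover have "\<not> q dvd 2" using q by (metis primes_dvd_imp_eq two_is_prime_nat prime_int_numeral_eq)
      ultimately show False using h(1) l(1) by (simp add: good_def)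
    qed
  qed
qed

text \<open>Removing blocks by the preceding lemmas lowers the length and \<open>k\<close> by the
  same amount, so the claim passes to the remaining blocks. With at most two blocks left the plain
  count suffices, since \<open>k + 1\<close> allows for two of them. The assumption
  \<open>dich\<close> is what rank two provides.\<close>

lemma rank_two_bound:
  fixes v :: "'i \<Rightarrow> 'v::ab_group_add"
  assumes q: "prime q" "q \<noteq> 2" and K: "subgrp K"
    and dich: "\<And>a b. a \<notin> K \<Longrightarrow> b \<notin> K \<Longrightarrow> generates K a b \<or> (\<exists>l. \<not> q dvd int l \<and> b - nmul l a \<in> K)"
    and X: "uf K v X" "\<And>i. i \<in> X \<Longrightarrow> v i \<notin> K"
    and P: "partition_on X P" "\<And>B. B \<in> P \<Longrightarrow> minzs K v B"
    and P': "P' \<subseteq> P" and h: "good q K v (\<Union>P') h" "ann q k h"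
  shows "card (\<Union>P') \<le> k + 1"
  using P' h
proof (induction "card P'" arbitrary: P' h k rule: less_induct)
  case less
  have fX: "finite X" using X by (simp add: uf_def)
  have XP: "X = \<Union>P" using partition_onD1[OF P(1)] .
  have "finite P" using fX unfolding XP by (rule finite_UnionD)
  then have fP': "finite P'" using less.prems(1) finite_subset by blast
  define Y where "Y = \<Union>P'"
  have YX: "Y \<subseteq> X" using less.prems(1) XP by (auto simp: Y_def)
  have fY: "finite Y" using YX fX finite_subset by blast
  have dis: "disjoint P'" using partition_onD2[OF P(1)] less.prems(1) by (auto simp: disjoint_def)
  have P'X: "B \<subseteq> Y" "finite B" "minzs K v B" "B \<noteq> {}" if "B \<in> P'" for B
    using that P(2) less.prems(1) partition_onD3[OF P(1)] finite_subset[OF _ fY] by (auto simp: Y_def)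
  have part: "partition_on Y P'"
    using dis P'X(4) unfolding Y_def by (intro partition_onI) (auto simp: disjoint_def disjnt_def)
  have "sum v Y = (\<Sum>B\<in>P'. sum v B)"
    unfolding Y_def using dis P'X(2) by (subst sum.Union_disjoint) (auto simp: disjoint_def)
  also have "\<dots> \<in> K" by (rule subgrp_sum[OF K, of P' "sum v"]) (use P'X(3) in \<open>simp add: minzs_def\<close>)
  finally have zY: "sum v Y \<in> K" .
  have uY: "uf K v Y" by (rule uf_subset[OF K X(1) YX zY])
  have nY: "v i \<notin> K" if "i \<in> Y" for i using that X(2) YX by blast
  note h = less.prems(2,3)[folded Y_def]
  have removed: ?case if Q: "Q \<subseteq> P'" "Q \<noteq> {}" "good q K v (Y - \<Union>Q) h'" "ann q (k - card (\<Union>Q)) h'" for Q h'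
  proof -
    have e: "\<Union>(P' - Q) = Y - \<Union>Q"
    proof
      show "\<Union>(P' - Q) \<subseteq> Y - \<Union>Q"
      proof
        fix x assume "x \<in> \<Union>(P' - Q)"
        then obtain B where B: "x \<in> B" "B \<in> P'" "B \<notin> Q" by blast
        have "x \<notin> C" if "C \<in> Q" for C
          using disjointD[OF dis B(2), of C] that B Q(1) by blast
        then show "x \<in> Y - \<Union>Q" using B by (auto simp: Y_def)
      qed
    qed (auto simp: Y_def)
    have "card (P' - Q) < card P'" using Q(1,2) fP' by (intro psubset_card_mono) auto
    then have "card (\<Union>(P' - Q)) \<le> (k - card (\<Union>Q)) + 1"
      using less.hyps[of "P' - Q" h' "k - card (\<Union>Q)"] Q(3,4) less.prems(1) unfolding e by blast
    \<comment> \<open>A good function is not annihilated, so the subtraction is not truncated and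
      the two losses really agree.\<close>
    moreover have "0 < k - card (\<Union>Q)" using good_ann_pos[OF Q(3,4)] .
    moreover have "\<Union>Q \<subseteq> Y" using Q(1) by (auto simp: Y_def)
    then have "card (Y - \<Union>Q) = card Y - card (\<Union>Q)" "card (\<Union>Q) \<le> card Y"
      using fY by (simp_all add: card_Diff_subset finite_subset card_mono)
    ultimately show ?thesis unfolding e Y_def[symmetric] by linarith
  qed
  consider (even) B where "B \<in> P'" "even (card B)"
    | (par) B C b c where "\<And>B. B \<in> P' \<Longrightarrow> odd (card B)" "B \<in> P'" "C \<in> P'" "B \<noteq> C" "b \<in> B" "c \<in> C"
        "\<not> generates K (v b) (v c)"
    | (few) "card P' \<le> 2"
    | (many) "\<And>B. B \<in> P' \<Longrightarrow> odd (card B)" "3 \<le> card P'"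
        "\<And>B C b c. B \<in> P' \<Longrightarrow> C \<in> P' \<Longrightarrow> B \<noteq> C \<Longrightarrow> b \<in> B \<Longrightarrow> c \<in> C \<Longrightarrow> generates K (v b) (v c)"
    by (metis not_less_eq_eq numeral_2_eq_2 numeral_3_eq_3)
  then show ?case
  proof cases
    case even
    have "good q K v (Y - B) (iter_diff v B h)"
      using good_remove_even_block[OF q K uY P'X(1,3)[OF even(1)] even(2) P'X(4)[OF even(1)] h(1)] .
    moreover have "ann q (k - card B) (iter_diff v B h)" using ann_iter_diff[OF P'X(2)[OF even(1)] h(2)] .
    ultimately show ?thesis using removed[of "{B}" "iter_diff v B h"] even(1) by simp
  next
    case par
    have BC: "B \<inter> C = {}" using disjointD[OF dis par(2-4)] .
    have "v b \<notin> K" "v c \<notin> K" using nY P'X(1) par by blast+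
    then obtain l where l: "\<not> q dvd int l" "v c - nmul l (v b) \<in> K" using dich par(7) by blast
    have "B \<noteq> {b}"
    proof
      assume "B = {b}"
      then have "v b \<in> K" using P'X(3)[OF par(2)] by (simp add: minzs_def)
      then show False using \<open>v b \<notin> K\<close> by simp
    qed
    then obtain b' where b': "b' \<in> B" "b \<noteq> b'" using par(5) by blast
    obtain h' where h': "good q K v (Y - (B \<union> C)) h'" "ann q (k - card (B \<union> C)) h'"
      using good_remove_parallel_blocks[OF q K uY P'X(1,3)[OF par(2)] par(5) b' P'X(1,3)[OF par(3)]
        par(6) par(1)[OF par(3)] BC l h] .
    then show ?thesis using removed[of "{B, C}" h'] par(2,3) by simp
  next
    case few
    have "card Y < k + card P'"
      by (rule card_minus_blocks_less[OF K uY part P'X(3) h])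
    then show ?thesis using few by (simp add: Y_def)
  next
    case many
    show ?thesis
      using good_odd_blocks[OF q(1) K uY nY part P'X(3) many(1) many(3) h many(2)] by (simp add: Y_def)
  qed
qed

subsection \<open>Peeling off a layer of the cyclic component\<close>

text \<open>The pairwise incongruent sums of \<open>uf_incongruent_sums\<close> have distinct
  residues under \<open>\<phi>\<close> modulo \<open>p\<close>. If \<open>U\<close> itself is not
  zero-sum modulo \<open>L\<close>, the element \<open>- sum v U\<close> is appended under the index
  \<open>None\<close>. Closure under intersection persists, because zero-sum subsets of
  \<open>U\<close> are also closed under differences.\<close>

lemma sum_closed_card_le_index:
  fixes v :: "'i \<Rightarrow> 'v::ab_group_add" and \<phi> :: "'v \<Rightarrow> int"
  assumes p: "p > 0" and \<phi>: "\<And>x y. \<phi> (x + y) = \<phi> x + \<phi> y" and L: "L = {x. int p dvd \<phi> x}"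
    and fU: "finite U" and nz: "\<And>i. i \<in> U \<Longrightarrow> v i \<notin> L"
    and cl: "\<And>I J. I \<subseteq> U \<Longrightarrow> J \<subseteq> U \<Longrightarrow> sum v I \<in> L \<Longrightarrow> sum v J \<in> L \<Longrightarrow> sum v (I \<inter> J) \<in> L"
  shows "card U \<le> p"
proof -
  have phi0: "\<phi> 0 = 0" using \<phi>[of 0 0] by simp
  have phid: "\<phi> (x - y) = \<phi> x - \<phi> y" for x y using \<phi>[of "x - y" y] by simp
  have sL: "subgrp L" by (simp add: subgrp_def L phi0 \<phi> phid)
  have le: "card X \<le> p" if X: "uf L u X" "\<And>i. i \<in> X \<Longrightarrow> u i \<notin> L" for X :: "'i option set" and u
  proof -
    obtain Q where Q: "finite Q" "card X \<le> card Q"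
      "\<forall>a\<in>Q. \<forall>b\<in>Q. \<exists>W\<subseteq>X. a - b - sum u W \<in> L \<and> (sum u W \<in> L \<longrightarrow> a = b)"
      using uf_incongruent_sums[OF sL X] by metis
    have "inj_on (\<lambda>a. \<phi> a mod int p) Q"
    proof (rule inj_onI)
      fix a b assume ab: "a \<in> Q" "b \<in> Q" and e: "\<phi> a mod int p = \<phi> b mod int p"
      have d: "a - b \<in> L" using e by (simp add: L phid mod_eq_dvd_iff)
      obtain W where W: "a - b - sum u W \<in> L" "sum u W \<in> L \<longrightarrow> a = b"
        using bspec[OF bspec[OF Q(3) ab(1)] ab(2)] by metis
      have "sum u W \<in> L" using subgrpD(3)[OF sL d W(1)] by simp
      then show "a = b" using W(2) by simp
    qed
    moreover have "(\<lambda>a. \<phi> a mod int p) ` Q \<subseteq> {0..<int p}" using p by auto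
    ultimately have "card Q \<le> card {0..<int p}" by (intro card_inj_on_le) auto
    then show ?thesis using Q(2) by simp
  qed
  define u where "u = (\<lambda>j. case j of None \<Rightarrow> - sum v U | Some i \<Rightarrow> v i)"
  have sS: "sum u (Some ` I) = sum v I" for I
    by (subst sum.reindex) (simp_all add: u_def)
  have fS: "finite I" if "I \<subseteq> U" for I using that fU finite_subset by blast
  have inter: "Some ` I \<inter> Some ` J = Some ` (I \<inter> J)" for I J :: "'i set" by blast
  \<comment> \<open>A set containing the appended index is zero-sum exactly if the part of
    \<open>U\<close> that it omits is.\<close>
  have sN: "sum u (insert None (Some ` I)) \<in> L \<longleftrightarrow> sum v (U - I) \<in> L" if "I \<subseteq> U" for I
  proof -
    have "sum u (insert None (Some ` I)) = - sum v U + sum v I"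
      using fS[OF that] by (simp add: sS) (simp add: u_def)
    also have "\<dots> = - sum v (U - I)" using that fU by (simp add: sum_diff)
    finally show ?thesis using subgrpD(4)[OF sL, of "sum v (U - I)"] subgrpD(4)[OF sL, of "- sum v (U - I)"]
      by auto
  qed
  have dl: "sum v (J - I) \<in> L" if "I \<subseteq> U" "J \<subseteq> U" "sum v I \<in> L" "sum v J \<in> L" for I J
  proof -
    have "sum v (J - (I \<inter> J)) \<in> L \<longleftrightarrow> sum v J \<in> L"
      using sum_Diff_mem[OF sL fS[OF that(2)], of "I \<inter> J" v] cl[OF that] by simp
    then show ?thesis using that by (simp add: Diff_Int2 Diff_Int_distrib Int_commute Diff_Int)
  qed
  show ?thesis
  proof (cases "sum v U \<in> L")
    case True
    have "uf L u (Some ` U)"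
      unfolding uf_def
    proof (intro conjI allI impI)
      fix I J assume "I \<subseteq> Some ` U" "J \<subseteq> Some ` U" "sum u I \<in> L" "sum u J \<in> L"
      then show "sum u (I \<inter> J) \<in> L"
        unfolding subset_image_iff using cl by (auto simp: sS inter)
    qed (simp_all add: fU sS True)
    then have "card (Some ` U) \<le> p" using nz by (intro le) (auto simp: u_def)
    then show ?thesis by (simp add: card_image)
  next
    case False
    let ?X = "insert None (Some ` U)"
    have sub: "\<exists>I'\<subseteq>U. I = Some ` I' \<or> I = insert None (Some ` I')" if "I \<subseteq> ?X" for I
    proof -
      have "I - {None} \<subseteq> Some ` U" using that by blast
      then obtain I' where "I' \<subseteq> U" "I - {None} = Some ` I'" by (auto simp: subset_image_iff)
      then show ?thesis by (intro exI[of _ I']) auto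
    qed
    have "uf L u ?X"
      unfolding uf_def
    proof (intro conjI allI impI)
      show "sum u ?X \<in> L" using sN[of U] subgrpD(1)[OF sL] by simp
      fix I J assume IJ: "I \<subseteq> ?X" "J \<subseteq> ?X" "sum u I \<in> L" "sum u J \<in> L"
      obtain I' J' where I': "I' \<subseteq> U" "I = Some ` I' \<or> I = insert None (Some ` I')"
        and J': "J' \<subseteq> U" "J = Some ` J' \<or> J = insert None (Some ` J')"
        using sub[OF IJ(1)] sub[OF IJ(2)] by metis
      have mixed: "sum v (A \<inter> B) \<in> L" if "A \<subseteq> U" "B \<subseteq> U" "sum v A \<in> L" "sum v (U - B) \<in> L" for A B
      proof -
        have "A \<inter> B = A - (U - B)" using that(1,2) by blast
        then show ?thesis using dl[of "U - B" A] that by simp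
      qed
      show "sum u (I \<inter> J) \<in> L"
      proof (cases "None \<in> I"; cases "None \<in> J")
        assume N: "None \<in> I" "None \<in> J"
        then have e: "I = insert None (Some ` I')" "J = insert None (Some ` J')"
          using I'(2) J'(2) by auto
        have z: "sum v (U - I') \<in> L" "sum v (U - J') \<in> L"
          using IJ(3,4) sN[OF I'(1)] sN[OF J'(1)] e by simp_all
        have "sum v ((U - I') - (U - J')) \<in> L" using dl[OF _ _ z(2,1)] by blast
        then have "sum v (((U - I') - (U - J')) \<union> (U - J')) \<in> L"
          using z(2) fU by (subst sum.union_disjoint) (auto intro: subgrpD(2)[OF sL])
        moreover have "((U - I') - (U - J')) \<union> (U - J') = U - (I' \<inter> J')" by blast
        ultimately have "sum v (U - (I' \<inter> J')) \<in> L" by simp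
        moreover have "I \<inter> J = insert None (Some ` (I' \<inter> J'))" using e by auto
        ultimately show ?thesis using sN[of "I' \<inter> J'"] I'(1) by auto
      next
        assume N: "None \<in> I" "None \<notin> J"
        then have e: "I = insert None (Some ` I')" "J = Some ` J'"
          using I'(2) J'(2) by auto
        moreover have "I \<inter> J = Some ` (J' \<inter> I')" using e by auto
        ultimately show ?thesis using mixed[OF J'(1) I'(1)] sN[OF I'(1)] IJ(3,4) by (simp add: sS)
      next
        assume N: "None \<notin> I" "None \<in> J"
        then have e: "J = insert None (Some ` J')" "I = Some ` I'"
          using I'(2) J'(2) by auto
        moreover have "I \<inter> J = Some ` (I' \<inter> J')" using e by auto
        ultimately show ?thesis using mixed[OF I'(1) J'(1)] sN[OF J'(1)] IJ(3,4) by (simp add: sS)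
      next
        assume N: "None \<notin> I" "None \<notin> J"
        then have e: "I = Some ` I'" "J = Some ` J'"
          using I'(2) J'(2) by auto
        then show ?thesis using cl[OF I'(1) J'(1)] IJ(3,4) by (simp add: sS inter)
      qed
    qed (simp add: fU)
    moreover have "u i \<notin> L" if i: "i \<in> ?X" for i
    proof (cases i)
      case None
      then show ?thesis using False subgrpD(4)[OF sL, of "- sum v U"] by (auto simp: u_def)
    next
      case (Some j)
      then show ?thesis using i nz by (auto simp: u_def)
    qed
    ultimately have "card ?X \<le> p" by (rule le)
    moreover have "card (Some ` U) \<le> card ?X" using fU by (intro card_mono) auto
    ultimately show ?thesis by (simp add: card_image)
  qed
qed

text \<open>The blocks are chosen greedily, each with the least cardinality among the sets with sum
  in \<open>L\<close> but not in \<open>K\<close>. Such a set is minimal modulo \<open>L\<close>: if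
  it had a proper part with sum in \<open>L\<close>, this part or its complement would be a smaller
  candidate.\<close>

lemma max_family:
  fixes v :: "'i \<Rightarrow> 'v::ab_group_add"
  assumes K: "subgrp K" and L: "subgrp L" and fin: "finite Y"
  shows "\<exists>F. disjoint F \<and> \<Union>F \<subseteq> Y \<and> (\<forall>B\<in>F. B \<noteq> {} \<and> minzs L v B \<and> sum v B \<notin> K) \<and>
    (\<forall>I. I \<subseteq> Y - \<Union>F \<longrightarrow> sum v I \<in> L \<longrightarrow> sum v I \<in> K)"
  using fin
proof (induction "card Y" arbitrary: Y rule: less_induct)
  case less
  define bad where "bad I \<longleftrightarrow> I \<subseteq> Y \<and> sum v I \<in> L \<and> sum v I \<notin> K" for I
  show ?case
  proof (cases "\<exists>I. bad I")
    case False
    then show ?thesis by (intro exI[of _ "{}"]) (auto simp: bad_def)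
  next
    case True
    define B where "B = (ARG_MIN card I. bad I)"
    have B: "bad B" and Bmin: "bad I \<Longrightarrow> card B \<le> card I" for I
      unfolding B_def using arg_min_nat_lemma[of bad _ card] True by metis+
    have BY: "B \<subseteq> Y" "sum v B \<in> L" "sum v B \<notin> K" using B by (simp_all add: bad_def)
    have fB: "finite B" using BY(1) less.prems finite_subset by blast
    have ne: "B \<noteq> {}" using BY(3) subgrpD(1)[OF K] by auto
    have "sum v J \<notin> L" if J: "J \<noteq> {}" "J \<subset> B" for J
    proof
      assume z: "sum v J \<in> L"
      have JB: "J \<subseteq> B" "card J < card B" using J(2) psubset_card_mono[OF fB J(2)] by auto
      then have "\<not> bad J" using Bmin[of J] by linarith
      then have zJ: "sum v J \<in> K" using z JB(1) BY(1) by (auto simp: bad_def)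
      have "card (B - J) < card B" using J fB by (intro psubset_card_mono) auto
      then have "\<not> bad (B - J)" using Bmin[of "B - J"] by linarith
      moreover have "sum v (B - J) \<in> L" using sum_Diff_mem[OF L fB JB(1) z] BY(2) by simp
      moreover have "sum v (B - J) \<notin> K" using sum_Diff_mem[OF K fB JB(1) zJ] BY(3) by simp
      ultimately show False using BY(1) by (auto simp: bad_def)
    qed
    then have mB: "minzs L v B" using BY(2) by (simp add: minzs_def)
    have "card (Y - B) < card Y" using ne BY(1) less.prems by (intro psubset_card_mono) auto
    then obtain F where F: "disjoint F" "\<Union>F \<subseteq> Y - B" "\<forall>B\<in>F. B \<noteq> {} \<and> minzs L v B \<and> sum v B \<notin> K"
        "\<forall>I. I \<subseteq> (Y - B) - \<Union>F \<longrightarrow> sum v I \<in> L \<longrightarrow> sum v I \<in> K"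
      using less.hyps[of "Y - B"] less.prems by (metis finite_Diff)
    have "disjoint (insert B F)"
      using F(1,2) by (auto simp: disjoint_def)
    moreover have "(Y - B) - \<Union>F = Y - \<Union>(insert B F)" by blast
    then have "\<forall>I. I \<subseteq> Y - \<Union>(insert B F) \<longrightarrow> sum v I \<in> L \<longrightarrow> sum v I \<in> K" using F(4) by simp
    moreover have "\<Union>(insert B F) \<subseteq> Y" using BY(1) F(2) by blast
    moreover have "\<forall>B\<in>insert B F. B \<noteq> {} \<and> minzs L v B \<and> sum v B \<notin> K"
      using F(3) ne mB BY(3) by simp
    ultimately show ?thesis by blast
  qed
qed

text \<open>Naming each block by its least element keeps the new family indexed by natural numbers,
  so that the construction can be iterated. As \<open>F\<close> is disjoint, unions of blocks
  intersect in the union of the common blocks, which preserves unique factorization.\<close>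

lemma amalgamate:
  fixes v :: "nat \<Rightarrow> 'v::ab_group_add"
  assumes K: "subgrp K" and X: "uf K v X" and F: "disjoint F" "\<Union>F \<subseteq> X"
    and ne: "\<And>B. B \<in> F \<Longrightarrow> B \<noteq> {}" and z: "sum v (\<Union>F) \<in> K"
    and nz: "\<And>B. B \<in> F \<Longrightarrow> sum v B \<notin> K"
  obtains X' :: "nat set" and u where "uf K u X'" "\<And>i. i \<in> X' \<Longrightarrow> u i \<in> sum v ` F"
    "\<And>i. i \<in> X' \<Longrightarrow> u i \<notin> K"
    "\<And>w :: 'v \<Rightarrow> real. (\<Sum>i\<in>X'. w (u i)) = (\<Sum>B\<in>F. w (sum v B))"
proof -
  have fX: "finite X" using X by (simp add: uf_def)
  then have fUF: "finite (\<Union>F)" using F(2) finite_subset by blast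
  have fF: "finite F" using fUF by (rule finite_UnionD)
  have fB: "finite B" if "B \<in> F" for B using that fUF by (meson Union_upper finite_subset)
  have inj: "inj_on Min F"
  proof (rule inj_onI)
    fix B C assume BC: "B \<in> F" "C \<in> F" "Min B = Min C"
    then have "Min B \<in> B" "Min B \<in> C" using Min_in[OF fB ne] by metis+
    then show "B = C" using F(1) BC(1,2) unfolding disjoint_def by blast
  qed
  define g where "g = the_inv_into F Min"
  define u where "u = sum v \<circ> g"
  have g: "g (Min B) = B" if "B \<in> F" for B
    unfolding g_def using inj that by (rule the_inv_into_f_f)
  have gF: "g i \<in> F" if "i \<in> Min ` F" for i using that g by auto
  have sub: "\<exists>A\<subseteq>F. I = Min ` A" if "I \<subseteq> Min ` F" for I using that by (auto simp: subset_image_iff)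
  have su: "sum u (Min ` A) = sum v (\<Union>A)" if A: "A \<subseteq> F" for A
  proof -
    have "sum u (Min ` A) = (\<Sum>B\<in>A. sum v B)"
      using inj_on_subset[OF inj A] A g by (auto simp: sum.reindex u_def intro!: sum.cong)
    also have "\<dots> = sum v (\<Union>A)"
      using A F(1) fB by (subst sum.Union_disjoint) (auto simp: disjoint_def)
    finally show ?thesis .
  qed
  have "uf K u (Min ` F)"
    unfolding uf_def
  proof (intro conjI allI impI)
    show "finite (Min ` F)" using fF by simp
    show "sum u (Min ` F) \<in> K" using su[of F] z by simp
    fix I J assume IJ: "I \<subseteq> Min ` F" "J \<subseteq> Min ` F" "sum u I \<in> K" "sum u J \<in> K"
    obtain A where A: "A \<subseteq> F" "I = Min ` A" using sub[OF IJ(1)] by blast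
    obtain C where C: "C \<subseteq> F" "J = Min ` C" using sub[OF IJ(2)] by blast
    have e: "I \<inter> J = Min ` (A \<inter> C)"
      unfolding A(2) C(2) using inj_on_image_Int[OF inj A(1) C(1)] by simp
    have AX: "\<Union>A \<subseteq> X" "\<Union>C \<subseteq> X" using A(1) C(1) F(2) by blast+
    have zA: "sum v (\<Union>A) \<in> K" "sum v (\<Union>C) \<in> K" using IJ(3,4) A C su by simp_all
    have U: "\<Union>A \<inter> \<Union>C = \<Union>(A \<inter> C)"
    proof
      show "\<Union>A \<inter> \<Union>C \<subseteq> \<Union>(A \<inter> C)"
      proof
        fix x assume "x \<in> \<Union>A \<inter> \<Union>C"
        then obtain B D where "B \<in> A" "D \<in> C" "x \<in> B" "x \<in> D" by blast
        moreover from this have "B = D" using A(1) C(1) F(1) unfolding disjoint_def by blast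
        ultimately show "x \<in> \<Union>(A \<inter> C)" by blast
      qed
    qed blast
    have "sum v (\<Union>A \<inter> \<Union>C) \<in> K" using X AX zA unfolding uf_def by simp
    moreover have "A \<inter> C \<subseteq> F" using A(1) by blast
    ultimately show "sum u (I \<inter> J) \<in> K" unfolding e U by (simp only: su)
  qed
  moreover have "u i \<in> sum v ` F" if "i \<in> Min ` F" for i using gF[OF that] by (simp add: u_def)
  moreover have "u i \<notin> K" if "i \<in> Min ` F" for i using nz[OF gF[OF that]] by (simp add: u_def)
  moreover have "(\<Sum>i\<in>Min ` F. w (u i)) = (\<Sum>B\<in>F. w (sum v B))" for w :: "'v \<Rightarrow> real"
    using inj g by (auto simp: sum.reindex u_def intro!: sum.cong)
  ultimately show thesis by (rule that)
qed

text \<open>Amalgamate the elements outside \<open>L\<close> into blocks modulo \<open>L\<close>, first only elements of \<open>A\<close> as long as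
  their sum can be kept outside \<open>K\<close>, then arbitrary ones. At most \<open>p\<close> elements remain in the end, and at most
  \<open>p\<close> elements of \<open>A\<close> remain after the first stage. Blocks of the first stage lose no weight. In the
  second stage only the elements of \<open>A\<close> cause a loss, at most \<open>\<alpha> * (1 - \<rho>)\<close> each, and the remaining
  elements lose another \<open>p * \<alpha> * \<rho>\<close>.\<close>

lemma peel:
  fixes v :: "nat \<Rightarrow> 'v::ab_group_add" and \<chi> :: "'v \<Rightarrow> int" and w :: "'v \<Rightarrow> real"
  assumes p: "p > 0" and \<chi>: "\<And>x y. x \<in> M \<Longrightarrow> y \<in> M \<Longrightarrow> \<chi> (x + y) = \<chi> x + \<chi> y"
      "\<And>x. x \<in> M \<Longrightarrow> x \<in> L \<longleftrightarrow> int p dvd \<chi> x"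
    and K: "subgrp K" "K \<subseteq> L" and sL: "subgrp L" and A: "subgrp A" and M: "subgrp M"
    and X: "uf K v X" "\<And>i. i \<in> X \<Longrightarrow> v i \<notin> K" "\<And>i. i \<in> X \<Longrightarrow> v i \<in> M"
    and \<alpha>: "0 \<le> \<alpha>" "0 \<le> \<rho>" "\<rho> \<le> 1"
    and w1: "\<And>x. x \<in> M - L \<Longrightarrow> x \<in> A \<Longrightarrow> w x \<le> \<alpha>" "\<And>x. x \<in> M - L \<Longrightarrow> x \<notin> A \<Longrightarrow> w x \<le> \<alpha> * \<rho>"
    and w2: "\<And>x. x \<in> M \<inter> L - K \<Longrightarrow> p * (\<alpha> * \<rho>) \<le> w x"
      "\<And>x. x \<in> M \<inter> L - K \<Longrightarrow> x \<in> A \<Longrightarrow> p * \<alpha> \<le> w x"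
  obtains X' :: "nat set" and u where "uf K u X'" "\<And>i. i \<in> X' \<Longrightarrow> u i \<notin> K"
    "\<And>i. i \<in> X' \<Longrightarrow> u i \<in> M \<inter> L"
    "(\<Sum>i\<in>X. w (v i)) \<le> p * \<alpha> + (\<Sum>i\<in>X'. w (u i))"
proof -
  have fX: "finite X" and zX: "sum v X \<in> K" using X(1) by (simp_all add: uf_def)
  have \<chi>sum: "sum (\<chi> \<circ> v) I = \<chi> (sum v I)" if I: "I \<subseteq> X" for I
  proof -
    have "finite I" using I fX finite_subset by blast
    then show ?thesis using I
    proof (induction I rule: finite_induct)
      case empty
      show ?case using \<chi>(1)[of 0 0] subgrpD(1)[OF M] by simp
    next
      case (insert i I)
      have "sum v I \<in> M" using insert.prems X(3) by (intro subgrp_sum[OF M]) auto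
      then show ?case using insert X(3) \<chi>(1) by simp
    qed
  qed
  have sumL: "sum (\<chi> \<circ> v) I \<in> {x. int p dvd x} \<longleftrightarrow> sum v I \<in> L" if I: "I \<subseteq> X" for I
  proof -
    have "sum v I \<in> M" using I X(3) by (intro subgrp_sum[OF M]) auto
    then show ?thesis using \<chi>(2) \<chi>sum[OF I] by simp
  qed
  \<comment> \<open>\<open>\<chi>\<close> is additive on \<open>M\<close> only, so the index bound
    is applied to the integer family \<open>\<chi> \<circ> v\<close>.\<close>
  have index: "card V \<le> p" if V: "V \<subseteq> X" "\<And>i. i \<in> V \<Longrightarrow> v i \<notin> L"
    and cl: "\<And>I J. I \<subseteq> V \<Longrightarrow> J \<subseteq> V \<Longrightarrow> sum v I \<in> L \<Longrightarrow> sum v J \<in> L \<Longrightarrow> sum v (I \<inter> J) \<in> L" for V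
  proof (rule sum_closed_card_le_index[where \<phi> = "\<lambda>x. x" and L = "{x. int p dvd x}" and v = "\<chi> \<circ> v"])
    show "finite V" using V(1) fX finite_subset by blast
    show "(\<chi> \<circ> v) i \<notin> {x. int p dvd x}" if "i \<in> V" for i
      using that V X(3) \<chi>(2)[of "v i"] by auto
    fix I J assume IJ: "I \<subseteq> V" "J \<subseteq> V" and z: "sum (\<chi> \<circ> v) I \<in> {x. int p dvd x}"
      "sum (\<chi> \<circ> v) J \<in> {x. int p dvd x}"
    have s: "I \<subseteq> X" "J \<subseteq> X" "I \<inter> J \<subseteq> X" using IJ V(1) by auto
    have "sum v (I \<inter> J) \<in> L" using z IJ unfolding sumL[OF s(1)] sumL[OF s(2)] by (intro cl)
    then show "sum (\<chi> \<circ> v) (I \<inter> J) \<in> {x. int p dvd x}" unfolding sumL[OF s(3)] .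
  qed (use p in simp_all)
  define Xi where "Xi = {i \<in> X. v i \<in> L}"
  define Xo where "Xo = X - Xi"
  define U where "U = {i \<in> Xo. v i \<in> A}"
  have sub: "Xi \<subseteq> X" "Xo \<subseteq> X" "U \<subseteq> Xo" by (auto simp: Xi_def Xo_def U_def)
  have nL: "v i \<in> M - L" if "i \<in> Xo" for i using that X(3) by (auto simp: Xo_def Xi_def)
  have fin: "finite Xo" "finite U" "finite Xi" using sub fX by (meson finite_subset)+
  obtain F where F: "disjoint F" "\<Union>F \<subseteq> U" "\<And>B. B \<in> F \<Longrightarrow> B \<noteq> {} \<and> minzs L v B \<and> sum v B \<notin> K"
      "\<And>I. I \<subseteq> U - \<Union>F \<Longrightarrow> sum v I \<in> L \<Longrightarrow> sum v I \<in> K"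
    using max_family[OF K(1) sL fin(2), of v] by metis
  define Y where "Y = Xo - \<Union>F"
  have YX: "Y \<subseteq> Xo" "finite Y" using fin by (auto simp: Y_def)
  obtain G where G: "disjoint G" "\<Union>G \<subseteq> Y" "\<And>B. B \<in> G \<Longrightarrow> B \<noteq> {} \<and> minzs L v B \<and> sum v B \<notin> K"
      "\<And>I. I \<subseteq> Y - \<Union>G \<Longrightarrow> sum v I \<in> L \<Longrightarrow> sum v I \<in> K"
    using max_family[OF K(1) sL YX(2), of v] by metis
  define T where "T = Y - \<Union>G"
  have zU: "sum v (\<Union>H) \<in> L" if "disjoint H" "\<And>B. B \<in> H \<Longrightarrow> sum v B \<in> L" "finite (\<Union>H)" for H
  proof -
    have "sum v (\<Union>H) = (\<Sum>B\<in>H. sum v B)"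
      using that by (subst sum.Union_disjoint) (auto simp: disjoint_def intro: finite_subset)
    then show ?thesis using that(2) by (simp add: subgrp_sum[OF sL])
  qed
  have fFG: "finite (\<Union>F)" "finite (\<Union>G)" using F(2) G(2) fin(2) YX(2) finite_subset by blast+
  have "sum v Xi \<in> L" by (rule subgrp_sum[OF sL]) (simp add: Xi_def)
  then have "sum v Xo \<in> L" unfolding Xo_def using sum_Diff_mem[OF sL fX sub(1), of v] zX K(2) by auto
  moreover have "sum v (\<Union>F) \<in> L" using F(1,3) fFG(1) by (intro zU) (auto simp: minzs_def)
  ultimately have "sum v Y \<in> L"
    unfolding Y_def using sum_Diff_mem[OF sL fin(1), of "\<Union>F" v] F(2) sub(3) by auto
  moreover have "sum v (\<Union>G) \<in> L" using G(1,3) fFG(2) by (intro zU) (auto simp: minzs_def)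
  ultimately have "sum v T \<in> L"
    unfolding T_def using sum_Diff_mem[OF sL YX(2) G(2), of v] by auto
  \<comment> \<open>Maximality of \<open>G\<close> turns a sum in \<open>L\<close> into a sum in
    \<open>K\<close>, so \<open>T\<close> can be discarded while the rest stays zero-sum.\<close>
  then have zT: "sum v T \<in> K" using G(4)[of T] by (simp add: T_def)
  have TX: "T \<subseteq> X" using YX(1) sub by (auto simp: T_def)
  have small: "card V \<le> p" if V: "V \<subseteq> Xo" "\<And>I. I \<subseteq> V \<Longrightarrow> sum v I \<in> L \<Longrightarrow> sum v I \<in> K" for V
  proof (rule index)
    show "V \<subseteq> X" using V(1) sub(2) by blast
    show "v i \<notin> L" if "i \<in> V" for i using that V(1) nL by blast
    fix I J assume IJ: "I \<subseteq> V" "J \<subseteq> V" "sum v I \<in> L" "sum v J \<in> L"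
    then have "sum v I \<in> K" "sum v J \<in> K" using V(2) by auto
    moreover have "I \<subseteq> X" "J \<subseteq> X" using IJ(1,2) V(1) sub(2) by auto
    ultimately have "sum v (I \<inter> J) \<in> K" using X(1) unfolding uf_def by simp
    then show "sum v (I \<inter> J) \<in> L" using K(2) by blast
  qed
  have cU: "card (U - \<Union>F) \<le> p" using F(4) sub(3) by (intro small) auto
  have cT: "card T \<le> p" using G(4) YX(1) by (intro small) (auto simp: T_def)
  have cB: "card B \<le> p" if B: "B \<subseteq> Xo" "minzs L v B" for B
  proof (rule index)
    have fB: "finite B" using B(1) fin(1) finite_subset by blast
    show "B \<subseteq> X" using B(1) sub(2) by blast
    show "v i \<notin> L" if "i \<in> B" for i using that B(1) nL by blast
    show "sum v (I \<inter> J) \<in> L" if "I \<subseteq> B" "J \<subseteq> B" "sum v I \<in> L" "sum v J \<in> L" for I J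
      using minzs_uf[OF sL fB B(2)] that unfolding uf_def by simp
  qed
  \<comment> \<open>Members already in \<open>L\<close> are kept unchanged as singleton
    blocks.\<close>
  let ?S = "(\<lambda>i. {i}) ` Xi"
  define H where "H = ?S \<union> F \<union> G"
  have UF: "\<Union>?S = Xi" by blast
  have dj: "Xi \<inter> \<Union>F = {}" "Xi \<inter> \<Union>G = {}" "\<Union>F \<inter> \<Union>G = {}"
    using F(2) G(2) sub YX(1) by (auto simp: Xo_def Y_def U_def)
  have dH: "disjoint H"
  proof -
    have 1: "disjoint ?S" by (auto simp: disjoint_def)
    have 2: "disjoint (?S \<union> F)" using 1 F(1) dj(1) by (intro disjoint_union) (simp_all add: UF)
    have "\<Union>(?S \<union> F) \<inter> \<Union>G = {}" using dj(2,3) by blast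
    then show ?thesis unfolding H_def using 2 G(1) by (intro disjoint_union[of "?S \<union> F" G])
  qed
  have eH: "\<Union>H = X - T"
  proof -
    have "X = Xi \<union> \<Union>F \<union> \<Union>G \<union> T" "T \<inter> (Xi \<union> \<Union>F \<union> \<Union>G) = {}"
      using F(2) G(2) sub YX(1) by (auto simp: Xo_def Y_def T_def)
    then show ?thesis unfolding H_def by auto
  qed
  have Bsub: "B \<subseteq> X" if "B \<in> H" for B using that eH by blast
  have nzH: "sum v B \<notin> K" if "B \<in> H" for B
    using that F(3) G(3) X(2) sub(1) by (auto simp: H_def)
  have neH: "B \<noteq> {}" if "B \<in> H" for B
    using that F(3) G(3) by (auto simp: H_def)
  have zH: "sum v (\<Union>H) \<in> K" unfolding eH using sum_Diff_mem[OF K(1) fX TX zT] zX by simp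
  have HUX: "\<Union>H \<subseteq> X" unfolding eH by blast
  obtain X' :: "nat set" and u where u: "uf K u X'" "\<And>i. i \<in> X' \<Longrightarrow> u i \<in> sum v ` H"
    "\<And>i. i \<in> X' \<Longrightarrow> u i \<notin> K"
    and wu: "\<And>w :: 'v \<Rightarrow> real. (\<Sum>i\<in>X'. w (u i)) = (\<Sum>B\<in>H. w (sum v B))"
    using amalgamate[OF K(1) X(1) dH HUX neH zH nzH] by metis
  have HL: "sum v B \<in> M \<inter> L" if "B \<in> H" for B
  proof -
    have "sum v B \<in> M" using Bsub[OF that] X(3) by (intro subgrp_sum[OF M]) auto
    moreover have "sum v B \<in> L" using that F(3) G(3) by (auto simp: H_def minzs_def Xi_def)
    ultimately show ?thesis by simp
  qed
  have wF: "(\<Sum>i\<in>B. w (v i)) \<le> w (sum v B)" if B: "B \<in> F" for B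
  proof -
    have BU: "B \<subseteq> U" using B F(2) by blast
    then have "(\<Sum>i\<in>B. w (v i)) \<le> (\<Sum>i\<in>B. \<alpha>)"
      using nL sub(3) by (intro sum_mono w1(1)) (auto simp: U_def)
    also have "\<dots> \<le> p * \<alpha>"
      using cB[of B] BU sub(3) F(3)[OF B] \<alpha>(1) by (simp add: mult_right_mono)
    also have "\<dots> \<le> w (sum v B)"
    proof (rule w2(2))
      have "B \<in> H" using B by (simp add: H_def)
      then show "sum v B \<in> M \<inter> L - K" using HL nzH by blast
      show "sum v B \<in> A" using BU by (intro subgrp_sum[OF A]) (auto simp: U_def)
    qed
    finally show ?thesis .
  qed
  \<comment> \<open>\<open>c i\<close> covers the excess of a weight over
    \<open>\<alpha> * \<rho>\<close>. Once it is set aside, second-stage blocks can be treated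
    without regard to membership in \<open>A\<close>.\<close>
  define c where "c i = (if i \<in> U then \<alpha> * (1 - \<rho>) else 0)" for i
  have wc: "w (v i) - c i \<le> \<alpha> * \<rho>" if "i \<in> Xo" for i
    using nL[OF that] w1 that by (auto simp: c_def U_def algebra_simps)
  have wG: "(\<Sum>i\<in>B. w (v i) - c i) \<le> card B * (\<alpha> * \<rho>)" if B: "B \<subseteq> Xo" for B
    using sum_bounded_above[of B "\<lambda>i. w (v i) - c i" "\<alpha> * \<rho>"] wc B by auto
  have pr: "card B * (\<alpha> * \<rho>) \<le> p * (\<alpha> * \<rho>)" if "card B \<le> p" for B :: "nat set"
    using that \<alpha> by (intro mult_right_mono) auto
  have wG': "(\<Sum>i\<in>B. w (v i) - c i) \<le> w (sum v B)" if B: "B \<in> G" for B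
  proof -
    have BX: "B \<subseteq> Xo" using B G(2) YX(1) by blast
    have "B \<in> H" using B by (simp add: H_def)
    then have "p * (\<alpha> * \<rho>) \<le> w (sum v B)" using HL nzH by (intro w2(1)) blast
    then show ?thesis using wG[OF BX] pr[OF cB[OF BX]] G(3)[OF B] by linarith
  qed
  have wT: "(\<Sum>i\<in>T. w (v i) - c i) \<le> p * (\<alpha> * \<rho>)"
    using wG[of T] pr[OF cT] YX(1) by (force simp: T_def)
  have cY: "(\<Sum>i\<in>Y. c i) \<le> p * (\<alpha> * (1 - \<rho>))"
  proof -
    have "(\<Sum>i\<in>Y. c i) = (\<Sum>i\<in>Y \<inter> U. \<alpha> * (1 - \<rho>))"
      unfolding c_def by (rule sum.inter_restrict[OF YX(2), symmetric])
    also have "Y \<inter> U = U - \<Union>F" using sub(3) by (auto simp: Y_def)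
    also have "(\<Sum>i\<in>U - \<Union>F. \<alpha> * (1 - \<rho>)) \<le> p * (\<alpha> * (1 - \<rho>))"
      using cU \<alpha> by (simp add: mult_right_mono)
    finally show ?thesis .
  qed
  have sU: "(\<Sum>i\<in>\<Union>P. f i) = (\<Sum>B\<in>P. \<Sum>i\<in>B. f i)" if "disjoint P" "finite (\<Union>P)" for P and f :: "nat \<Rightarrow> real"
    using that by (subst sum.Union_disjoint) (auto simp: disjoint_def intro: finite_subset)
  have "(\<Sum>i\<in>X. w (v i)) = (\<Sum>i\<in>Xi. w (v i)) + (\<Sum>i\<in>Xo. w (v i))"
    using sum.subset_diff[OF sub(1) fX, of "\<lambda>i. w (v i)"] by (simp add: Xo_def)
  also have "(\<Sum>i\<in>Xo. w (v i)) = (\<Sum>i\<in>\<Union>F. w (v i)) + (\<Sum>i\<in>Y. w (v i))"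
    using sum.subset_diff[OF _ fin(1), of "\<Union>F" "\<lambda>i. w (v i)"] F(2) sub(3) by (auto simp: Y_def)
  also have "(\<Sum>i\<in>\<Union>F. w (v i)) \<le> (\<Sum>B\<in>F. w (sum v B))"
    unfolding sU[OF F(1) fFG(1)] by (rule sum_mono) (rule wF)
  also have "(\<Sum>i\<in>Y. w (v i)) = (\<Sum>i\<in>Y. w (v i) - c i) + (\<Sum>i\<in>Y. c i)"
    by (simp add: sum_subtractf)
  also have "(\<Sum>i\<in>Y. w (v i) - c i) = (\<Sum>i\<in>\<Union>G. w (v i) - c i) + (\<Sum>i\<in>T. w (v i) - c i)"
    using sum.subset_diff[OF G(2) YX(2), of "\<lambda>i. w (v i) - c i"] by (simp add: T_def)
  also have "(\<Sum>i\<in>\<Union>G. w (v i) - c i) \<le> (\<Sum>B\<in>G. w (sum v B))"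
    unfolding sU[OF G(1) fFG(2)] by (rule sum_mono) (rule wG')
  finally have le: "(\<Sum>i\<in>X. w (v i)) \<le> (\<Sum>i\<in>Xi. w (v i)) + (\<Sum>B\<in>F. w (sum v B)) +
      (\<Sum>B\<in>G. w (sum v B)) + p * (\<alpha> * \<rho>) + p * (\<alpha> * (1 - \<rho>))"
    using wT cY by linarith
  have fFG': "finite F" "finite G" using fFG finite_UnionD by blast+
  have djH: "?S \<inter> F = {}" "(?S \<union> F) \<inter> G = {}"
    using dj F(3) G(3) by blast+
  have "(\<Sum>B\<in>H. w (sum v B)) = (\<Sum>B\<in>?S. w (sum v B)) + (\<Sum>B\<in>F. w (sum v B)) + (\<Sum>B\<in>G. w (sum v B))"
    unfolding H_def using fin(3) fFG' djH by (subst sum.union_disjoint, simp_all)+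
  also have "(\<Sum>B\<in>?S. w (sum v B)) = (\<Sum>i\<in>Xi. w (v i))"
    by (subst sum.reindex) (auto simp: inj_on_def)
  finally have "(\<Sum>i\<in>X. w (v i)) \<le> p * \<alpha> + (\<Sum>i\<in>X'. w (u i))"
    using le wu[of w] by (simp add: algebra_simps)
  moreover have "u i \<in> M \<inter> L" if "i \<in> X'" for i using u(2)[OF that] HL by auto
  ultimately show thesis using u by (intro that[of u X']) auto
qed

subsection \<open>The length of families over elementary groups\<close>

text \<open>Coordinates from \<open>N\<close> on are unrestricted and thus disappear in the
  quotient, which is \<open>C_q^N\<close>.\<close>

definition prime_lattice :: "nat \<Rightarrow> nat \<Rightarrow> (nat \<Rightarrow> int) set" where
  "prime_lattice q N = {z. \<forall>j<N. int q dvd z j}"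

lemma subgrp_prime_lattice: "subgrp (prime_lattice q N)"
  by (auto simp: subgrp_def prime_lattice_def)

lemma nmul_apply: "nmul l a j = int l * a j" for a :: "nat \<Rightarrow> int"
  by (induction l) (simp_all add: algebra_simps)

lemma subgrp_nmul: "subgrp H \<Longrightarrow> a \<in> H \<Longrightarrow> nmul l a \<in> H"
  by (induction l) (auto simp: subgrpD)

text \<open>For prime \<open>q\<close>, Fermat's little theorem makes each factor, modulo
  \<open>q\<close>, the indicator of \<open>q\<close> dividing \<open>z j\<close>.\<close>

definition zero_indicator :: "nat \<Rightarrow> nat \<Rightarrow> (nat \<Rightarrow> int) \<Rightarrow> int" where
  "zero_indicator q N z = (\<Prod>j<N. 1 - z j ^ (q - 1))"

lemma ann_zero_indicator: "ann (int q) (Suc (N * (q - 1))) (zero_indicator q N)"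
proof -
  have "ann (int q) (Suc ((q - 1) * 1)) (\<lambda>z :: nat \<Rightarrow> int. z j ^ (q - 1))" for j
    by (rule ann_power) simp
  then have "ann (int q) (Suc (q - 1)) (\<lambda>z :: nat \<Rightarrow> int. 1 - z j ^ (q - 1))" for j
    using ann_mono[OF ann_const[of "int q" 1], of "Suc (q - 1)"] by (intro ann_diff) auto
  then have "ann (int q) (Suc (card {..<N} * (q - 1))) (\<lambda>z. \<Prod>j\<in>{..<N}. 1 - z j ^ (q - 1))"
    by (intro ann_prod) auto
  then show ?thesis by (simp add: zero_indicator_def[abs_def])
qed

lemma good_zero_indicator:
  assumes q: "prime q"
  shows "good (int q) (prime_lattice q N) v Y (zero_indicator q N)"
  unfolding good_def
proof (intro conjI allI impI)
  show "periodic (int q) (prime_lattice q N) (zero_indicator q N)"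
    unfolding periodic_def
  proof (intro allI ballI)
    fix z x assume x: "x \<in> prime_lattice q N"
    have "[zero_indicator q N (z + x) = zero_indicator q N z] (mod int q)"
      unfolding zero_indicator_def
    proof (intro cong_prod cong_diff cong_refl cong_pow)
      fix j assume "j \<in> {..<N}"
      then have "int q dvd (z + x) j - z j" using x by (simp add: prime_lattice_def)
      then show "[(z + x) j = z j] (mod int q)" by (simp add: cong_iff_dvd_diff)
    qed
    then show "int q dvd zero_indicator q N (z + x) - zero_indicator q N z" by (simp add: cong_iff_dvd_diff)
  qed
  fix J assume "sum v J \<notin> prime_lattice q N"
  then obtain j where j: "j < N" "\<not> int q dvd sum v J j" by (auto simp: prime_lattice_def)
  have "[sum v J j ^ (q - 1) = 1] (mod int q)"
  proof -
    define a where "a = nat (sum v J j mod int q)"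
    have q0: "int q > 0" using q by (simp add: prime_gt_0_nat)
    have a: "int a = sum v J j mod int q" using q0 by (simp add: a_def)
    have "\<not> int q dvd int a" using j(2) by (simp add: a dvd_mod_iff)
    then have "\<not> q dvd a" by simp
    then have "[a ^ (q - 1) = 1] (mod q)" using q by (intro fermat_theorem)
    then have "[int a ^ (q - 1) = 1] (mod int q)" by (metis cong_int_iff of_nat_1 of_nat_power)
    moreover have "[int a ^ (q - 1) = sum v J j ^ (q - 1)] (mod int q)"
      by (intro cong_pow) (simp add: a cong_def)
    ultimately show ?thesis using cong_sym cong_trans by blast
  qed
  then have "int q dvd 1 - sum v J j ^ (q - 1)" by (simp add: cong_iff_dvd_diff dvd_diff_commute)
  moreover have "1 - sum v J j ^ (q - 1) dvd zero_indicator q N (sum v J)"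
    unfolding zero_indicator_def using j(1) by (intro dvd_prodI) auto
  ultimately show "int q dvd zero_indicator q N (sum v J)" by (rule dvd_trans)
next
  have "zero_indicator q N 0 = 1" using prime_gt_1_nat[OF q] by (simp add: zero_indicator_def zero_power)
  then show "\<not> int q dvd zero_indicator q N 0" using prime_gt_1_nat[OF q] by simp
qed

text \<open>The determinant \<open>D\<close> decides: if it is invertible modulo \<open>q\<close>,
  the two vectors form a basis, and otherwise they are proportional.\<close>

lemma prime_lattice_two_dichotomy:
  assumes q: "prime q" and a: "a \<notin> prime_lattice q 2" and b: "b \<notin> prime_lattice q 2"
  shows "generates (prime_lattice q 2) a b \<or> (\<exists>l. \<not> int q dvd int l \<and> b - nmul l a \<in> prime_lattice q 2)"
proof -
  have pq: "prime (int q)" using q by simp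
  have q0: "int q > 0" using q by (simp add: prime_gt_0_nat)
  have inv: "\<exists>y. int q dvd x * y - 1" if "\<not> int q dvd x" for x
  proof -
    have "coprime x (int q)" using prime_imp_coprime[OF pq that] by (simp add: coprime_commute)
    then obtain y where "[x * y = 1] (mod int q)" using cong_solve_coprime_int by blast
    then show ?thesis by (auto simp: cong_iff_dvd_diff)
  qed
  have KN2: "z \<in> prime_lattice q 2 \<longleftrightarrow> int q dvd z 0 \<and> int q dvd z 1" for z
    by (auto simp: prime_lattice_def less_2_cases_iff)
  define D where "D = a 0 * b 1 - a 1 * b 0"
  show ?thesis
  proof (cases "int q dvd D")
    case False
    then obtain y where y: "int q dvd D * y - 1" using inv by blast
    have "generates (prime_lattice q 2) a b"
      unfolding generates_def
    proof (intro allI impI equalityI subsetI)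
      fix H :: "(nat \<Rightarrow> int) set" and z :: "nat \<Rightarrow> int"
      assume H: "subgrp H" "prime_lattice q 2 \<subseteq> H" "a \<in> H" "b \<in> H"
      \<comment> \<open>Cramer's rule, where \<open>y\<close> is the inverse of the determinant
        modulo \<open>q\<close>.\<close>
      define s where "s = y * (z 0 * b 1 - z 1 * b 0)"
      define t where "t = y * (a 0 * z 1 - a 1 * z 0)"
      define m n where "m = nat (s mod int q)" and "n = nat (t mod int q)"
      have mn: "int q dvd s - int m" "int q dvd t - int n"
        using q0 by (simp_all add: m_def n_def mod_eq_dvd_iff[symmetric])
      have st: "int q dvd z j - (s * a j + t * b j)" if "j = 0 \<or> j = 1" for j :: nat
      proof -
        have "z j - (s * a j + t * b j) = (D * y - 1) * (- z j)"
          using that by (auto simp: s_def t_def D_def algebra_simps)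
        then show ?thesis by (simp only: dvd_mult2[OF y])
      qed
      have "int q dvd (z - (nmul m a + nmul n b)) j" if "j = 0 \<or> j = 1" for j :: nat
      proof -
        have e: "(z - (nmul m a + nmul n b)) j =
            (z j - (s * a j + t * b j)) + (s - int m) * a j + (t - int n) * b j"
          by (simp add: nmul_apply algebra_simps)
        show ?thesis unfolding e by (intro dvd_add dvd_mult2 st[OF that] mn)
      qed
      then have "z - (nmul m a + nmul n b) \<in> H" using H(2) KN2 by blast
      moreover have "nmul m a + nmul n b \<in> H"
        using H(1,3,4) by (intro subgrpD(2)[OF H(1)] subgrp_nmul)
      ultimately show "z \<in> H" using subgrpD(2)[OF H(1)] by fastforce
    qed simp
    then show ?thesis ..
  next
    case True
    obtain i where i: "i = 0 \<or> i = 1" "\<not> int q dvd a i" using a KN2 by blast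
    then obtain y where y: "int q dvd a i * y - 1" using inv by blast
    \<comment> \<open>The quotient of \<open>b i\<close> by \<open>a i\<close> modulo
      \<open>q\<close>. The vanishing determinant makes it the factor for the other coordinate
      too.\<close>
    define l where "l = nat ((b i * y) mod int q)"
    have l: "int q dvd b i * y - int l"
      using q0 by (simp add: l_def mod_eq_dvd_iff[symmetric])
    have "int q dvd b j - int l * a j" if j: "j = 0 \<or> j = 1" for j :: nat
    proof -
      have e: "int q dvd a i * b j - a j * b i"
      proof -
        have "a i * b j - a j * b i \<in> {0, D, - D}" using i(1) j by (auto simp: D_def)
        then show ?thesis using True by auto
      qed
      have f: "a i * (b j - int l * a j) = (a i * b j - a j * b i) + a i * a j * (b i * y - int l)
          - a j * b i * (a i * y - 1)" by (simp add: algebra_simps)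
      have "int q dvd a i * (b j - int l * a j)"
        unfolding f by (intro dvd_add dvd_diff dvd_mult e l y)
      then show ?thesis using i(2) pq by (simp add: prime_dvd_mult_iff)
    qed
    then have k: "b - nmul l a \<in> prime_lattice q 2" using KN2 by (auto simp: nmul_apply)
    have "\<not> int q dvd int l"
    proof
      assume "int q dvd int l"
      then have "nmul l a \<in> prime_lattice q 2" by (auto simp: prime_lattice_def nmul_apply)
      then have "b \<in> prime_lattice q 2" using k subgrpD(2)[OF subgrp_prime_lattice, of "b - nmul l a"] by fastforce
      then show False using b by simp
    qed
    then show ?thesis using k by blast
  qed
qed

text \<open>The degree count \<open>less\<close> leaves the number of blocks to be bounded by
  \<open>N\<close>. For \<open>q = 3\<close> this is \<open>twice_card_blocks_less\<close>, since
  then \<open>N * (q - 1)\<close> equals \<open>2 * N\<close>. In rank two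
  \<open>rank_two_bound\<close> is used instead, where \<open>k + 1\<close> is just
  \<open>2 * q\<close>.\<close>

theorem elementary_uf_card_le:
  fixes v :: "'i \<Rightarrow> nat \<Rightarrow> int"
  assumes q: "prime q" and N: "q = 2 \<or> q = 3 \<or> N \<le> 2"
    and X: "uf (prime_lattice q N) v X" "\<And>i. i \<in> X \<Longrightarrow> v i \<notin> prime_lattice q N"
  shows "card X \<le> N * q"
proof -
  note K = subgrp_prime_lattice[of q N]
  have fX: "finite X" using X by (simp add: uf_def)
  have q0: "q > 0" using q prime_gt_0_nat by blast
  obtain P where P: "partition_on X P" "\<And>B. B \<in> P \<Longrightarrow> minzs (prime_lattice q N) v B"
    using minzs_partition[OF K fX, of v] X(1) unfolding uf_def by blast
  have XP: "X = \<Union>P" using partition_onD1[OF P(1)] .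
  have fP: "finite P" using fX unfolding XP by (rule finite_UnionD)
  note h = good_zero_indicator[OF q, of N v X] ann_zero_indicator[of q N]
  have less: "card X < Suc (N * (q - 1)) + card P"
    by (rule card_minus_blocks_less[OF K X(1) P h])
  have pq: "prime (int q)" using q by simp
  consider "q = 2" | "q = 3" | "q \<noteq> 2" "N = 2" | "N = 1" | "N = 0" using N by linarith
  then show ?thesis
  proof cases
    case 1
    \<comment> \<open>A singleton block would be a member in the lattice. Hence the number of blocks
      is at most half of \<open>card X\<close>, which turns \<open>less\<close> into the
      claim.\<close>
    have "2 \<le> card B" if B: "B \<in> P" for B
    proof -
      have BX: "B \<subseteq> X" using B XP by blast
      have "B \<noteq> {}" using partition_onD3[OF P(1)] B by blast
      then have "card B \<noteq> 0" using finite_subset[OF BX fX] by simp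
      moreover have "card B \<noteq> 1"
        using P(2)[OF B] X(2) BX by (auto simp: card_1_singleton_iff minzs_def)
      ultimately show ?thesis by linarith
    qed
    then have "(\<Sum>B\<in>P. 2) \<le> (\<Sum>B\<in>P. card B)" by (rule sum_mono)
    also have "\<dots> = card X"
    proof -
      have "finite B" if "B \<in> P" for B using that XP fX by (meson Union_upper finite_subset)
      then show ?thesis
        unfolding XP using partition_onD2[OF P(1)]
        by (subst card_Union_disjoint) (auto simp: disjoint_def pairwise_def disjnt_def)
    qed
    finally show ?thesis using less 1 by simp
  next
    case 2
    have "2 * card P < Suc (N * (q - 1))"
    proof (rule twice_card_blocks_less[OF pq _ K X P])
      show "int q \<noteq> 2" using 2 by simp
    qed (use h XP in auto)
    then show ?thesis using less 2 by simp
  next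
    case 3
    have "card (\<Union>P) \<le> Suc (N * (q - 1)) + 1"
      using 3 h XP prime_lattice_two_dichotomy[OF q] by (intro rank_two_bound[OF pq _ K _ X P]) auto
    moreover have "N * q = N * (q - 1) + 2" using q0 3(2) by (cases q) auto
    ultimately show ?thesis using XP by simp
  next
    case 4
    \<comment> \<open>In rank one the lattice has index \<open>q\<close>, and the index bound
      applies without any polynomial.\<close>
    have L: "prime_lattice q N = {z. int q dvd z 0}" by (auto simp: prime_lattice_def 4)
    have "card X \<le> q"
      by (rule sum_closed_card_le_index[OF q0 _ L fX X(2)]) (use X(1) in \<open>auto simp: uf_def\<close>)
    then show ?thesis using 4 by simp
  next
    case 5
    then have "X = {}" using X(2) by (auto simp: prime_lattice_def)
    then show ?thesis by simp
  qed
qed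

lemma sum_fun_apply: "(sum v I) j = (\<Sum>i\<in>I. v i j)" for v :: "'i \<Rightarrow> 'j \<Rightarrow> int"
  by (induction I rule: infinite_finite_induct) simp_all

lemma uf_transfer:
  assumes "uf K v X" "\<And>I. I \<subseteq> X \<Longrightarrow> sum v I \<in> K \<longleftrightarrow> sum u I \<in> K'"
  shows "uf K' u X"
  unfolding uf_def
proof (intro conjI allI impI)
  show "finite X" "sum u X \<in> K'" using assms(1) assms(2)[of X] by (simp_all add: uf_def)
  fix I J assume IJ: "I \<subseteq> X" "J \<subseteq> X" "sum u I \<in> K'" "sum u J \<in> K'"
  then have "sum v (I \<inter> J) \<in> K" using assms(1) assms(2)[OF IJ(1)] assms(2)[OF IJ(2)] by (simp add: uf_def)
  then show "sum u (I \<inter> J) \<in> K'" using assms(2)[of "I \<inter> J"] IJ(1) by auto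
qed

subsection \<open>Cross numbers\<close>

text \<open>The direct sum of \<open>C_(p^m)\<close> and \<open>C_r^n\<close> is the quotient by this lattice: coordinate \<open>0\<close> is the
  component of order \<open>p^m\<close>, and the coordinates \<open>1, ..., n\<close> are the components of order \<open>r\<close>.\<close>

definition mixed_lattice :: "nat \<Rightarrow> nat \<Rightarrow> nat \<Rightarrow> nat \<Rightarrow> (nat \<Rightarrow> int) set" where
  "mixed_lattice p m r n = {z. int (p ^ m) dvd z 0 \<and> (\<forall>j\<in>{1..n}. int r dvd z j)}"

lemma subgrp_mixed_lattice: "subgrp (mixed_lattice p m r n)"
  by (auto simp: subgrp_def mixed_lattice_def)

lemma prime_int_dvd_of_nat_mult:
  assumes "prime (r::nat)" "int r dvd int N * x" "\<not> int r dvd x"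
  shows "r dvd N"
proof -
  have "prime (int r)" using assms(1) by simp
  then have "int r dvd int N" using assms(2,3) by (simp add: prime_dvd_mult_iff)
  then show ?thesis by simp
qed

text \<open>\<open>ord\<close> is known only through the multiples it divides, so the estimates
  apply to any group presented by the lattice. For \<open>k \<le> m\<close>, the condition
  \<open>int (p ^ (m - k)) dvd z 0\<close> means that the cyclic component of \<open>z\<close> has
  order dividing \<open>p^k\<close>.\<close>

lemma order_bound:
  fixes ord :: "(nat \<Rightarrow> int) \<Rightarrow> nat"
  assumes p: "prime p" and r: "prime r"
    and ord: "\<And>z N. ord z dvd N \<longleftrightarrow> nmul N z \<in> mixed_lattice p m r n"
  shows "0 < ord z"
    and "k < m \<Longrightarrow> int (p ^ (m - Suc k)) dvd z 0 \<Longrightarrow> \<not> int (p ^ (m - k)) dvd z 0 \<Longrightarrow> p ^ Suc k dvd ord z"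
    and "j \<in> {1..n} \<Longrightarrow> \<not> int r dvd z j \<Longrightarrow> r dvd ord z"
    and "k \<le> m \<Longrightarrow> int (p ^ (m - k)) dvd z 0 \<Longrightarrow> ord z dvd p ^ k * r"
    and "k \<le> m \<Longrightarrow> int (p ^ (m - k)) dvd z 0 \<Longrightarrow> (\<forall>j\<in>{1..n}. int r dvd int (p ^ k) * z j) \<Longrightarrow> ord z dvd p ^ k"
    and "r = p \<Longrightarrow> z \<notin> mixed_lattice p m r n \<Longrightarrow> p dvd ord z"
proof -
  have self: "int (p ^ m) dvd int (ord z) * z 0" "\<And>j. j \<in> {1..n} \<Longrightarrow> int r dvd int (ord z) * z j"
    using ord[of z "ord z"] by (simp_all add: mixed_lattice_def nmul_apply)
  have pp: "int (p ^ m) dvd int (p ^ k) * x" if "k \<le> m" "int (p ^ (m - k)) dvd x" for k x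
  proof -
    have "int (p ^ m) = int (p ^ k) * int (p ^ (m - k))"
      using that(1) by (simp flip: power_add)
    then show ?thesis using that(2) by (simp add: mult_dvd_mono)
  qed
  show le: "k \<le> m \<Longrightarrow> int (p ^ (m - k)) dvd z 0 \<Longrightarrow> ord z dvd p ^ k * r" for k
    unfolding ord mixed_lattice_def using pp[of k "z 0"] by (simp add: nmul_apply mult.commute[of _ "int r"] mult.assoc)
  show "k \<le> m \<Longrightarrow> int (p ^ (m - k)) dvd z 0 \<Longrightarrow> (\<forall>j\<in>{1..n}. int r dvd int (p ^ k) * z j) \<Longrightarrow> ord z dvd p ^ k" for k
    unfolding ord mixed_lattice_def using pp[of k "z 0"] by (simp add: nmul_apply)
  have "ord z dvd p ^ m * r" using le[of m] by simp
  moreover have "0 < p ^ m * r" using p r prime_gt_0_nat by simp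
  ultimately show "0 < ord z" by (metis dvd_pos_nat)
  show "p ^ Suc k dvd ord z"
    if k: "k < m" "int (p ^ (m - Suc k)) dvd z 0" "\<not> int (p ^ (m - k)) dvd z 0"
  proof -
    obtain x where x: "z 0 = int (p ^ (m - Suc k)) * x" using k(2) by (auto elim: dvdE)
    have e1: "m - k = Suc (m - Suc k)" and e2: "m = (m - Suc k) + Suc k" using k(1) by auto
    have nx: "\<not> int p dvd x"
    proof
      assume "int p dvd x"
      then have "int (p ^ (m - k)) dvd z 0" unfolding x e1 by (simp add: mult.commute mult_dvd_mono)
      then show False using k(3) by simp
    qed
    have "int (p ^ m) = int (p ^ (m - Suc k)) * int (p ^ Suc k)"
      by (subst e2) (simp only: power_add of_nat_mult)
    then have "int (p ^ (m - Suc k)) * int (p ^ Suc k) dvd int (p ^ (m - Suc k)) * (int (ord z) * x)"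
      using self(1) unfolding x by (simp only: mult_ac)
    moreover have "int (p ^ (m - Suc k)) \<noteq> 0" using p prime_gt_0_nat by auto
    ultimately have d: "int (p ^ Suc k) dvd int (ord z) * x" unfolding dvd_mult_cancel_left by blast
    have "coprime (int p) x" using nx p by (intro prime_imp_coprime) simp_all
    then have "coprime (int (p ^ Suc k)) x" by (simp del: power_Suc)
    then have "int (p ^ Suc k) dvd int (ord z)" using d by (simp only: coprime_dvd_mult_left_iff)
    then show ?thesis by (simp only: of_nat_dvd_iff)
  qed
  show "r dvd ord z" if "j \<in> {1..n}" "\<not> int r dvd z j"
    using prime_int_dvd_of_nat_mult[OF r self(2)[OF that(1)] that(2)] .
  show "p dvd ord z" if rp: "r = p" and z: "z \<notin> mixed_lattice p m r n"
  proof (rule ccontr)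
    assume np: "\<not> p dvd ord z"
    then have "coprime (int p) (int (ord z))" using p by (simp add: prime_imp_coprime)
    then have "coprime (int (p ^ m)) (int (ord z))" by (simp del: power_Suc)
    then have "int (p ^ m) dvd z 0" using self(1) by (simp only: coprime_dvd_mult_right_iff)
    moreover have "int r dvd z j" if "j \<in> {1..n}" for j
      using prime_int_dvd_of_nat_mult[OF r self(2)[OF that]] np rp by blast
    ultimately show False using z by (simp add: mixed_lattice_def)
  qed
qed

text \<open>The cyclic components are confined to the subgroup of order \<open>p^k\<close>, and
  \<open>k\<close> decreases to 0, or to 1 if \<open>r = p\<close>, where an elementary group
  remains. In the step \<open>\<alpha>\<close> bounds the weights outside \<open>L\<close>, and
  \<open>p * \<alpha>\<close> is exactly the new term \<open>1 / p^k\<close>.\<close>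

lemma weight_bound:
  fixes v :: "nat \<Rightarrow> nat \<Rightarrow> int" and ord :: "(nat \<Rightarrow> int) \<Rightarrow> nat"
  assumes p: "prime p" and r: "prime r"
    and ord: "\<And>z N. ord z dvd N \<longleftrightarrow> nmul N z \<in> mixed_lattice p m r n"
    and rank: "r = 2 \<or> r = 3 \<or> (if r = p then Suc n else n) \<le> 2"
    and k: "k \<le> m" "r = p \<Longrightarrow> 1 \<le> k"
    and X: "uf (mixed_lattice p m r n) v X" "\<And>i. i \<in> X \<Longrightarrow> v i \<notin> mixed_lattice p m r n"
      "\<And>i. i \<in> X \<Longrightarrow> int (p ^ (m - k)) dvd v i 0"
  shows "(\<Sum>i\<in>X. 1 / real (ord (v i))) \<le> real n + (\<Sum>j<k. 1 / real p ^ j)"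
  using k X
proof (induction k arbitrary: X v)
  case 0
  then have rp: "r \<noteq> p" by auto
  \<comment> \<open>The cyclic component is trivial here, and dropping coordinate 0 leaves
    \<open>C_r^n\<close>.\<close>
  define u where "u i j = v i (Suc j)" for i j
  have eq: "sum v I \<in> mixed_lattice p m r n \<longleftrightarrow> sum u I \<in> prime_lattice r n" if "I \<subseteq> X" for I
  proof -
    have "int (p ^ m) dvd (sum v I) 0"
      unfolding sum_fun_apply using 0(5) that by (intro dvd_sum) auto
    then have "sum v I \<in> mixed_lattice p m r n \<longleftrightarrow> (\<forall>j\<in>{1..n}. int r dvd (sum v I) j)" by (simp add: mixed_lattice_def)
    also have "{1..n} = Suc ` {..<n}" by (metis image_Suc_lessThan)
    also have "(\<forall>j\<in>Suc ` {..<n}. int r dvd (sum v I) j) \<longleftrightarrow> sum u I \<in> prime_lattice r n"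
      by (auto simp: prime_lattice_def sum_fun_apply u_def)
    finally show ?thesis .
  qed
  have "uf (prime_lattice r n) u X" by (rule uf_transfer[OF 0(3) eq])
  moreover have "u i \<notin> prime_lattice r n" if "i \<in> X" for i using eq[of "{i}"] 0(4)[OF that] that by simp
  ultimately have card: "card X \<le> n * r" using r rank rp by (intro elementary_uf_card_le) auto
  have "1 / real (ord (v i)) \<le> 1 / real r" if i: "i \<in> X" for i
  proof -
    obtain j where "j \<in> {1..n}" "\<not> int r dvd v i j" using 0(4,5)[OF i] by (auto simp: mixed_lattice_def)
    then have "r dvd ord (v i)" using order_bound(3)[OF p r ord] by blast
    then have "r \<le> ord (v i)" using order_bound(1)[OF p r ord] by (simp add: dvd_imp_le)
    then show ?thesis using r prime_gt_0_nat by (simp add: frac_le)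
  qed
  then have "(\<Sum>i\<in>X. 1 / real (ord (v i))) \<le> real (card X) * (1 / real r)"
    by (intro sum_bounded_above) auto
  also have "\<dots> \<le> real (n * r) * (1 / real r)" using card by (intro mult_right_mono) (simp_all only: of_nat_mono, simp)
  also have "\<dots> = real n" using r prime_gt_0_nat by simp
  finally show ?case by simp
next
  case (Suc k)
  have km: "k < m" using Suc.prems(1) by simp
  define c where "c = int (p ^ (m - Suc k))"
  have c0: "c > 0" using p prime_gt_0_nat by (simp add: c_def)
  have cp: "int (p ^ (m - k)) = int p * c"
    unfolding c_def using km by (simp add: Suc_diff_Suc flip: power_Suc)
  show ?case
  proof (cases "r = p \<and> k = 0")
    case True
    then have rp: "r = p" and k0: "k = 0" by auto
    \<comment> \<open>Division by \<open>c\<close> identifies the subgroup of order \<open>p\<close>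
      of the cyclic component with \<open>C_p\<close>, so all coordinates together give an
      elementary group of rank \<open>Suc n\<close>.\<close>
    define u where "u i j = (if j = 0 then v i 0 div c else v i j)" for i and j :: nat
    have uc: "v i 0 = c * u i 0" if "i \<in> X" for i using Suc.prems(5)[OF that] by (simp add: u_def c_def)
    have eq: "sum v I \<in> mixed_lattice p m r n \<longleftrightarrow> sum u I \<in> prime_lattice p (Suc n)" if "I \<subseteq> X" for I
    proof -
      have "(\<Sum>i\<in>I. v i 0) = c * (\<Sum>i\<in>I. u i 0)"
        unfolding sum_distrib_left using that uc by (intro sum.cong) auto
      then have "int (p ^ m) dvd (\<Sum>i\<in>I. v i 0) \<longleftrightarrow> int p dvd (\<Sum>i\<in>I. u i 0)"
        using cp c0 k0 by (simp add: mult.commute[of _ c])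
      moreover have "(\<forall>j\<in>{1..n}. int r dvd (\<Sum>i\<in>I. v i j)) \<longleftrightarrow> (\<forall>j\<in>{1..n}. int p dvd (\<Sum>i\<in>I. u i j))"
        by (simp add: u_def rp)
      moreover have "(\<forall>j<Suc n. Q j) \<longleftrightarrow> Q 0 \<and> (\<forall>j\<in>{1..n}. Q j)" for Q
        by (metis atLeastAtMost_iff less_Suc_eq_le less_one not_le zero_less_Suc)
      ultimately show ?thesis by (simp add: mixed_lattice_def prime_lattice_def sum_fun_apply)
    qed
    have "uf (prime_lattice p (Suc n)) u X" by (rule uf_transfer[OF Suc.prems(3) eq])
    moreover have "u i \<notin> prime_lattice p (Suc n)" if "i \<in> X" for i using eq[of "{i}"] Suc.prems(4)[OF that] that by simp
    ultimately have card: "card X \<le> Suc n * p" using p rank rp by (intro elementary_uf_card_le) auto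
    have "1 / real (ord (v i)) \<le> 1 / real p" if i: "i \<in> X" for i
    proof -
      have "p dvd ord (v i)" using order_bound(6)[OF p r ord rp Suc.prems(4)[OF i]] .
      then have "p \<le> ord (v i)" using order_bound(1)[OF p r ord] by (simp add: dvd_imp_le)
      then show ?thesis using p prime_gt_0_nat by (simp add: frac_le)
    qed
    then have "(\<Sum>i\<in>X. 1 / real (ord (v i))) \<le> real (card X) * (1 / real p)"
      by (intro sum_bounded_above) auto
    also have "\<dots> \<le> real (Suc n * p) * (1 / real p)"
      using card by (intro mult_right_mono) (simp_all only: of_nat_mono, simp)
    also have "\<dots> = real n + 1" using prime_gt_0_nat[OF p] by (simp add: field_simps)
    finally show ?thesis by (simp add: k0)
  next
    case False
    define M where "M = {z :: nat \<Rightarrow> int. c dvd z 0}"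
    define L where "L = {z :: nat \<Rightarrow> int. int p * c dvd z 0}"
    \<comment> \<open>For \<open>r \<noteq> p\<close>, \<open>A\<close> consists of the elements
      without a component of order \<open>r\<close>, and such a component divides the weight by
      \<open>r\<close>. For \<open>r = p\<close> it does not change the order of an element outside
      \<open>L\<close>, so all elements are treated alike.\<close>
    define A where "A = (if r = p then UNIV else {z :: nat \<Rightarrow> int. \<forall>j\<in>{1..n}. int r dvd z j})"
    define \<rho> where "\<rho> = (if r = p then 1 else 1 / real r)"
    define \<alpha> where "\<alpha> = 1 / real p ^ Suc k"
    have p0: "real p > 0" "p > 0" and r0: "real r \<ge> 1" "r > 0" using p r prime_gt_0_nat by (auto simp: Suc_le_eq)
    have Lk: "z \<in> L \<longleftrightarrow> int (p ^ (m - k)) dvd z 0" for z unfolding cp by (simp add: L_def)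
    have pa: "real p * \<alpha> = 1 / real p ^ k" using p0 by (simp add: \<alpha>_def)
    have opos: "0 < ord z" for z using order_bound(1)[OF p r ord] .
    have inv: "1 / real (ord z) \<le> 1 / real N" if "N dvd ord z" for z N
    proof -
      have "0 < N" using that opos[of z] by (cases N) auto
      moreover have "N \<le> ord z" using that opos[of z] by (simp add: dvd_imp_le)
      ultimately show ?thesis by (simp add: frac_le)
    qed
    have inv': "1 / real N \<le> 1 / real (ord z)" if "ord z dvd N" "0 < N" for z N
      using dvd_imp_le[OF that] opos[of z] by (simp add: frac_le)
    obtain X' :: "nat set" and u where u: "uf (mixed_lattice p m r n) u X'" "\<And>i. i \<in> X' \<Longrightarrow> u i \<notin> mixed_lattice p m r n"
      "\<And>i. i \<in> X' \<Longrightarrow> u i \<in> M \<inter> L"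
      "(\<Sum>i\<in>X. 1 / real (ord (v i))) \<le> real p * \<alpha> + (\<Sum>i\<in>X'. 1 / real (ord (u i)))"
    proof (rule peel[where p = p and M = M and L = L and K = "mixed_lattice p m r n" and A = A and X = X and v = v
          and \<alpha> = \<alpha> and \<rho> = \<rho> and \<chi> = "\<lambda>z. z 0 div c" and w = "\<lambda>z. 1 / real (ord z)"])
      show "(x + y) 0 div c = x 0 div c + y 0 div c" if "x \<in> M" "y \<in> M" for x y
        using that by (simp add: M_def div_add)
      show "x \<in> L \<longleftrightarrow> int p dvd x 0 div c" if "x \<in> M" for x
        using that c0 by (auto simp: L_def M_def elim!: dvdE)
      show "mixed_lattice p m r n \<subseteq> L"
      proof
        fix z assume "z \<in> mixed_lattice p m r n"
        then have "int (p ^ m) dvd z 0" by (simp add: mixed_lattice_def)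
        moreover have "int (p ^ (m - k)) dvd int (p ^ m)" by (simp add: le_imp_power_dvd)
        ultimately show "z \<in> L" unfolding Lk by (rule dvd_trans[rotated])
      qed
      show "subgrp L" "subgrp M" "subgrp A" by (auto simp: subgrp_def L_def M_def A_def)
      show "v i \<in> M" if "i \<in> X" for i using Suc.prems(5)[OF that] by (simp add: M_def c_def)
      show "0 \<le> \<alpha>" "0 \<le> \<rho>" "\<rho> \<le> 1" using r0 by (simp_all add: \<alpha>_def \<rho>_def)
      have outer: "p ^ Suc k dvd ord z" if "z \<in> M - L" for z
        using order_bound(2)[OF p r ord km, of z] that by (simp add: Lk[of z] M_def c_def)
      show "1 / real (ord z) \<le> \<alpha>" if "z \<in> M - L" for z
        using inv[OF outer[OF that]] by (simp add: \<alpha>_def)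
      show "1 / real (ord z) \<le> \<alpha> * \<rho>" if z: "z \<in> M - L" "z \<notin> A" for z
      proof -
        have rp: "r \<noteq> p" and "\<not> (\<forall>j\<in>{1..n}. int r dvd z j)" using z(2) by (auto simp: A_def split: if_splits)
        then have "r dvd ord z" using order_bound(3)[OF p r ord] by blast
        moreover have "coprime (p ^ Suc k) r" using primes_coprime[OF p r] rp by simp
        ultimately have "p ^ Suc k * r dvd ord z" using outer[OF z(1)] by (intro divides_mult)
        from inv[OF this] show ?thesis using rp by (simp add: \<alpha>_def \<rho>_def)
      qed
      have okA: "ord z dvd p ^ k" if z: "z \<in> M \<inter> L - mixed_lattice p m r n" "z \<in> A" for z
      proof (rule order_bound(5)[OF p r ord])
        show "k \<le> m" using km by simp
        show "int (p ^ (m - k)) dvd z 0" using z(1) Lk by blast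
        show "\<forall>j\<in>{1..n}. int r dvd int (p ^ k) * z j"
        proof (cases "r = p")
          case True
          \<comment> \<open>In this case \<open>k\<close> is not 0, so \<open>p^k\<close>
            annihilates the components of order \<open>r = p\<close> as well.\<close>
          then have "int r dvd int (p ^ k)" using False by (simp add: dvd_power)
          then show ?thesis by simp
        next
          case False
          then show ?thesis using z(2) by (simp add: A_def)
        qed
      qed
      show "real p * \<alpha> \<le> 1 / real (ord z)" if z: "z \<in> M \<inter> L - mixed_lattice p m r n" "z \<in> A" for z
        using inv'[OF okA[OF z]] p0 by (simp add: pa)
      show "real p * (\<alpha> * \<rho>) \<le> 1 / real (ord z)" if z: "z \<in> M \<inter> L - mixed_lattice p m r n" for z
      proof (cases "r = p")
        case True
        then show ?thesis using inv'[OF okA[OF z]] p0 by (simp add: pa \<rho>_def A_def)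
      next
        case False
        have "ord z dvd p ^ k * r"
          using order_bound(4)[OF p r ord, of k z] km z Lk[of z] by simp
        from inv'[OF this] p0 r0 have "1 / real p ^ k * (1 / real r) \<le> 1 / real (ord z)" by simp
        then show ?thesis using False by (simp add: \<rho>_def pa flip: mult.assoc)
      qed
    qed (use Suc.prems p0 subgrp_mixed_lattice in auto)
    have "(\<Sum>i\<in>X'. 1 / real (ord (u i))) \<le> real n + (\<Sum>j<k. 1 / real p ^ j)"
    proof (rule Suc.IH[OF _ _ u(1,2)])
      show "k \<le> m" using km by simp
      show "1 \<le> k" if "r = p" using that False by simp
      show "int (p ^ (m - k)) dvd u i 0" if "i \<in> X'" for i using u(3)[OF that] Lk by blast
    qed
    then show ?thesis using u(4) by (simp add: pa)
  qed
qed

section \<open>Unique factorization as closure under intersection\<close>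

text \<open>Factorizations of a zero-sum set and of its complement combine to one of
  \<open>X\<close>, which must be \<open>P\<close>. So zero-sum sets are unions of blocks of
  \<open>P\<close>, and such unions are closed under intersection.\<close>

lemma uf_if_unique_factorization:
  assumes K: "subgrp K" and fX: "finite X" and zX: "sum v X \<in> K"
    and un: "\<exists>!P. partition_on X P \<and> (\<forall>B\<in>P. minzs K v B)"
  shows "uf K v X"
proof -
  obtain P where P: "partition_on X P" "\<forall>B\<in>P. minzs K v B"
    and uniq: "\<And>Q. partition_on X Q \<Longrightarrow> \<forall>B\<in>Q. minzs K v B \<Longrightarrow> Q = P"
    using un by blast
  have sub: "\<exists>Q\<subseteq>P. I = \<Union>Q" if I: "I \<subseteq> X" "sum v I \<in> K" for I
  proof -
    have fI: "finite I" using I(1) fX finite_subset by blast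
    obtain Q where Q: "partition_on I Q" "\<forall>B\<in>Q. minzs K v B"
      using minzs_partition[OF K fI I(2)] by blast
    have "sum v (X - I) \<in> K" using sum_Diff_mem[OF K fX I] zX by simp
    then obtain R where R: "partition_on (X - I) R" "\<forall>B\<in>R. minzs K v B"
      using minzs_partition[OF K, of "X - I" v] fX by blast
    have "partition_on (I \<union> (X - I)) (Q \<union> R)"
    proof (rule partition_onI)
      show "\<Union>(Q \<union> R) = I \<union> (X - I)" using partition_onD1[OF Q(1)] partition_onD1[OF R(1)] by blast
      show "{} \<notin> Q \<union> R" using partition_onD3[OF Q(1)] partition_onD3[OF R(1)] by blast
      have "disjoint (Q \<union> R)"
        using partition_onD2[OF Q(1)] partition_onD2[OF R(1)] partition_onD1[OF Q(1)] partition_onD1[OF R(1)]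
        by (intro disjoint_union) auto
      then show "disjnt A B" if "A \<in> Q \<union> R" "B \<in> Q \<union> R" "A \<noteq> B" for A B
        using that disjointD[of "Q \<union> R" A B] by (simp add: disjnt_def)
    qed
    moreover have "I \<union> (X - I) = X" using I(1) by blast
    ultimately have "Q \<union> R = P" using uniq[of "Q \<union> R"] Q(2) R(2) by (metis Un_iff)
    then show ?thesis using partition_onD1[OF Q(1)] by blast
  qed
  show ?thesis
    unfolding uf_def
  proof (intro conjI allI impI fX zX)
    fix I J assume IJ: "I \<subseteq> X" "J \<subseteq> X" "sum v I \<in> K" "sum v J \<in> K"
    obtain Q where Q: "Q \<subseteq> P" "I = \<Union>Q" using sub[OF IJ(1,3)] by blast
    obtain R where R: "R \<subseteq> P" "J = \<Union>R" using sub[OF IJ(2,4)] by blast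
    have dis: "disjoint P" using partition_onD2[OF P(1)] .
    have e: "I \<inter> J = \<Union>(Q \<inter> R)"
    proof
      show "I \<inter> J \<subseteq> \<Union>(Q \<inter> R)"
      proof
        fix x assume "x \<in> I \<inter> J"
        then obtain B C where BC: "B \<in> Q" "C \<in> R" "x \<in> B" "x \<in> C" using Q R by blast
        then have "B = C" using disjointD[OF dis, of B C] Q(1) R(1) by blast
        then show "x \<in> \<Union>(Q \<inter> R)" using BC by blast
      qed
    qed (use Q R in blast)
    have "finite B" if "B \<in> Q \<inter> R" for B
    proof -
      have "B \<subseteq> X" using that Q IJ(1) by blast
      then show ?thesis using fX finite_subset by blast
    qed
    moreover have "\<forall>A\<in>Q \<inter> R. \<forall>B\<in>Q \<inter> R. A \<noteq> B \<longrightarrow> A \<inter> B = {}"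
      using dis Q(1) by (auto simp: disjoint_def)
    ultimately have "sum v (\<Union>(Q \<inter> R)) = (\<Sum>B\<in>Q \<inter> R. sum v B)"
      by (subst sum.Union_disjoint) auto
    also have "\<dots> \<in> K"
      by (rule subgrp_sum[OF K, of "Q \<inter> R" "sum v"]) (use P(2) Q(1) in \<open>auto simp: minzs_def\<close>)
    finally show "sum v (I \<inter> J) \<in> K" unfolding e .
  qed
qed

text \<open>Blocks of two factorizations that share a member contain each other by
  \<open>uf_block\<close>.\<close>

lemma unique_factorization_if_uf:
  assumes K: "subgrp K" and X: "uf K v X"
  shows "\<exists>!P. partition_on X P \<and> (\<forall>B\<in>P. minzs K v B)"
proof -
  have fX: "finite X" and zX: "sum v X \<in> K" using X by (simp_all add: uf_def)
  have le: "P \<subseteq> Q" if P: "partition_on X P" "\<forall>B\<in>P. minzs K v B"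
    and Q: "partition_on X Q" "\<forall>B\<in>Q. minzs K v B" for P Q
  proof
    fix B assume B: "B \<in> P"
    then obtain x where x: "x \<in> B" using partition_onD3[OF P(1)] by (metis ex_in_conv)
    have BX: "B \<subseteq> X" using B partition_onD1[OF P(1)] by blast
    then obtain C where C: "C \<in> Q" "x \<in> C" using x partition_onD1[OF Q(1)] by blast
    have CX: "C \<subseteq> X" using C partition_onD1[OF Q(1)] by blast
    have mB: "minzs K v B" and mC: "minzs K v C" using P(2) B Q(2) C by blast+
    have "sum v B \<in> K" "sum v C \<in> K" using mB mC by (simp_all add: minzs_def)
    then have "C \<subseteq> B" "B \<subseteq> C"
      using uf_block[OF X CX mC BX] uf_block[OF X BX mB CX] x C(2) by blast+
    then show "B \<in> Q" using C(1) by auto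
  qed
  obtain P where P: "partition_on X P" "\<forall>B\<in>P. minzs K v B" using minzs_partition[OF K fX zX] by blast
  show ?thesis
  proof (rule ex1I)
    show "partition_on X P \<and> (\<forall>B\<in>P. minzs K v B)" using P ..
    fix Q assume "partition_on X Q \<and> (\<forall>B\<in>Q. minzs K v B)"
    then have Q: "partition_on X Q" "\<forall>B\<in>Q. minzs K v B" by (rule conjunct1, rule conjunct2)
    show "Q = P" using le[OF Q P] le[OF P Q] by (rule subset_antisym)
  qed
qed

section \<open>Families attaining the bound\<close>

text \<open>The last assumption makes the new block independent of \<open>M\<close>: no proper
  nonempty part of it is cancelled by an element of \<open>M\<close>. Zero-sum sets are then exactly
  those of the old family, with or without the whole block.\<close>

lemma uf_add_block:
  fixes v w :: "nat \<Rightarrow> 'v::ab_group_add"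
  assumes K: "subgrp K" and M: "subgrp M" and X: "uf K v {..<N}" "\<And>i. i < N \<Longrightarrow> v i \<in> M"
    and w: "sum w {..<t} \<in> K"
      "\<And>y I. y \<in> M \<Longrightarrow> I \<subseteq> {..<t} \<Longrightarrow> y + sum w I \<in> K \<Longrightarrow> I = {} \<or> I = {..<t}"
  shows "uf K (\<lambda>i. if i < N then v i else w (i - N)) {..<N + t}"
proof -
  define u where "u i = (if i < N then v i else w (i - N))" for i
  define lo where "lo I = I \<inter> {..<N}" for I
  define hi where "hi I = {i. i + N \<in> I}" for I
  have lo: "lo I \<subseteq> {..<N}" "lo (I \<inter> J) = lo I \<inter> lo J" for I J by (auto simp: lo_def)
  have hi: "hi (I \<inter> J) = hi I \<inter> hi J" for I J by (auto simp: hi_def)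
  have hit: "hi I \<subseteq> {..<t}" if "I \<subseteq> {..<N + t}" for I using that by (force simp: hi_def)
  have su: "sum u I = sum v (lo I) + sum w (hi I)" if I: "I \<subseteq> {..<N + t}" for I
  proof -
    have fI: "finite I" using I finite_subset by blast
    have e: "I = lo I \<union> (\<lambda>i. i + N) ` hi I"
    proof -
      have "x \<in> (\<lambda>i. i + N) ` hi I" if "x \<in> I" "\<not> x < N" for x
        using that by (intro image_eqI[of _ _ "x - N"]) (auto simp: hi_def)
      then show ?thesis by (auto simp: lo_def hi_def)
    qed
    have fin: "finite (lo I)" "finite (hi I)"
      using fI finite_subset[OF hit[OF I]] by (auto simp: lo_def)
    have "sum u I = sum u (lo I) + sum u ((\<lambda>i. i + N) ` hi I)"
      by (subst e, rule sum.union_disjoint) (use fin in \<open>auto simp: lo_def\<close>)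
    also have "sum u (lo I) = sum v (lo I)" by (rule sum.cong) (auto simp: lo_def u_def)
    also have "sum u ((\<lambda>i. i + N) ` hi I) = sum w (hi I)" by (subst sum.reindex) (auto simp: u_def)
    finally show ?thesis .
  qed
  have inM: "sum v (lo I) \<in> M" for I using X(2) by (intro subgrp_sum[OF M]) (auto simp: lo_def)
  have zs: "sum u I \<in> K \<longleftrightarrow> sum v (lo I) \<in> K \<and> (hi I = {} \<or> hi I = {..<t})" if I: "I \<subseteq> {..<N + t}" for I
  proof
    assume z: "sum u I \<in> K"
    then have h: "hi I = {} \<or> hi I = {..<t}" using w(2)[OF inM hit[OF I]] su[OF I] by simp
    then have "sum w (hi I) \<in> K" using w(1) subgrpD(1)[OF K] by (metis sum.empty)
    then show "sum v (lo I) \<in> K \<and> (hi I = {} \<or> hi I = {..<t})"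
      using z h unfolding su[OF I] by (simp only: subgrp_add_cancel(1)[OF K])
  next
    assume h: "sum v (lo I) \<in> K \<and> (hi I = {} \<or> hi I = {..<t})"
    then have "sum w (hi I) \<in> K" using w(1) subgrpD(1)[OF K] by (metis sum.empty)
    then show "sum u I \<in> K" unfolding su[OF I] using h subgrpD(2)[OF K] by blast
  qed
  have "uf K u {..<N + t}"
    unfolding uf_def
  proof (intro conjI allI impI)
    have "lo {..<N + t} = {..<N}" "hi {..<N + t} = {..<t}" by (auto simp: lo_def hi_def)
    then show "sum u {..<N + t} \<in> K" using zs[of "{..<N + t}"] X(1) by (simp add: uf_def)
    fix I J assume IJ: "I \<subseteq> {..<N + t}" "J \<subseteq> {..<N + t}" "sum u I \<in> K" "sum u J \<in> K"
    have z: "sum v (lo I) \<in> K" "sum v (lo J) \<in> K" using IJ zs by blast+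
    have "sum v (lo I \<inter> lo J) \<in> K" using X(1) z lo(1) unfolding uf_def by simp
    moreover have "hi I \<inter> hi J = {} \<or> hi I \<inter> hi J = {..<t}"
      using zs[OF IJ(1)] zs[OF IJ(2)] IJ(3,4) by auto
    moreover have "I \<inter> J \<subseteq> {..<N + t}" using IJ(1) by blast
    ultimately show "sum u (I \<inter> J) \<in> K" using zs[of "I \<inter> J"] lo(2) hi by simp
  qed simp
  then show ?thesis by (simp add: u_def[abs_def])
qed

text \<open>The extremal family has the blocks consisting of \<open>r\<close> equal unit vectors and, for \<open>k = 1, ..., m\<close>, the
  block of \<open>p - 1\<close> copies of \<open>p^(m-k)\<close> and one copy of \<open>p^(m-k) (1 - p)\<close>.\<close>

lemma unit_vector_blocks:
  assumes p: "prime p" and r: "prime r" and j: "j \<le> n"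
    and ord: "\<And>z N. ord z dvd N \<longleftrightarrow> nmul N z \<in> mixed_lattice p m r n"
  shows "\<exists>(N :: nat) v. uf (mixed_lattice p m r n) v {..<N} \<and> (\<forall>i<N. v i \<notin> mixed_lattice p m r n \<and> v i 0 = 0 \<and> (\<forall>l>j. v i l = 0)) \<and>
    real j \<le> (\<Sum>i<N. 1 / real (ord (v i)))"
  using j
proof (induction j)
  case 0
  show ?case by (rule exI[of _ "0 :: nat"]) (simp add: uf_def subgrpD[OF subgrp_mixed_lattice])
next
  case (Suc j)
  then have "j \<le> n" by simp
  from Suc.IH[OF this] obtain N :: nat and v where v1: "uf (mixed_lattice p m r n) v {..<N}"
    and v2: "\<forall>i<N. v i \<notin> mixed_lattice p m r n \<and> v i 0 = 0 \<and> (\<forall>l>j. v i l = 0)"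
    and v3: "real j \<le> (\<Sum>i<N. 1 / real (ord (v i)))" by (elim exE conjE)
  note v = v1 v2[rule_format] v3
  define e :: "nat \<Rightarrow> int" where "e l = (if l = Suc j then 1 else 0)" for l
  define u where "u i = (if i < N then v i else e)" for i
  have r1: "1 < r" using r prime_gt_1_nat by blast
  have se: "(\<Sum>i\<in>I. e) l = int (card I) * e l" for I :: "nat set" and l
    by (simp add: sum_fun_apply)
  have eK: "e \<notin> mixed_lattice p m r n" using Suc.prems r1 by (auto simp: mixed_lattice_def e_def)
  \<comment> \<open>The earlier blocks vanish in coordinate \<open>Suc j\<close>. There a zero-sum
    set shows only its number of copies of \<open>e\<close>, which must be a multiple of
    \<open>r\<close>.\<close>
  have "uf (mixed_lattice p m r n) u {..<N + r}"
    unfolding u_def[abs_def]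
  proof (rule uf_add_block[OF subgrp_mixed_lattice, where M = "{z. z (Suc j) = 0}" and w = "\<lambda>_. e"])
    show "subgrp {z :: nat \<Rightarrow> int. z (Suc j) = 0}" by (simp add: subgrp_def)
    show "v i \<in> {z. z (Suc j) = 0}" if "i < N" for i using v(2)[OF that] by simp
    show "(\<Sum>i\<in>{..<r}. e) \<in> mixed_lattice p m r n" unfolding mixed_lattice_def mem_Collect_eq se by (simp add: e_def)
    fix y :: "nat \<Rightarrow> int" and I
    assume y: "y \<in> {z. z (Suc j) = 0}" and I: "I \<subseteq> {..<r}" and z: "y + (\<Sum>i\<in>I. e) \<in> mixed_lattice p m r n"
    have "int r dvd (y + (\<Sum>i\<in>I. e)) (Suc j)" using z Suc.prems by (simp add: mixed_lattice_def)
    then have "int r dvd int (card I)" using y se[of I "Suc j"] by (simp add: e_def)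
    then have "r dvd card I" by simp
    moreover have fI: "finite I" using I finite_subset by blast
    have "card I \<le> r" using card_mono[OF _ I] by simp
    ultimately have "card I = 0 \<or> card I = r" by (auto elim!: dvdE)
    then show "I = {} \<or> I = {..<r}"
      using fI I card_subset_eq[of "{..<r}" I] by auto
  qed (use v(1) in auto)
  moreover have "u i \<notin> mixed_lattice p m r n \<and> u i 0 = 0 \<and> (\<forall>l>Suc j. u i l = 0)" if "i < N + r" for i
    using v(2)[of i] eK by (simp add: u_def e_def)
  moreover have "real (Suc j) \<le> (\<Sum>i<N + r. 1 / real (ord (u i)))"
  proof -
    have "ord e dvd r"
      unfolding ord mixed_lattice_def mem_Collect_eq nmul_apply by (simp add: e_def)
    then have "ord e \<le> r" using r1 by (simp add: dvd_imp_le)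
    moreover have "0 < ord e" using order_bound(1)[OF p r ord] .
    ultimately have "real r * (1 / real (ord e)) \<ge> 1" by (simp add: field_simps)
    moreover have "(\<Sum>i<N + r. 1 / real (ord (u i))) = (\<Sum>i<N. 1 / real (ord (v i))) + real r * (1 / real (ord e))"
      by (subst sum.atLeastLessThan_concat[of 0 N "N + r", symmetric, unfolded atLeast0LessThan])
        (simp_all add: u_def)
    ultimately show ?thesis using v(3) by simp
  qed
  ultimately show ?case by blast
qed

text \<open>Each step adds \<open>p\<close> elements of order at most \<open>p^(k+1)\<close>, which
  contribute at least \<open>1 / p^k\<close>. Earlier members have coordinate 0 divisible by
  \<open>p * c\<close>, whereas every new one is congruent to \<open>c\<close> modulo
  \<open>p * c\<close>, so only the whole block can occur in a zero-sum set.\<close>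

lemma extremal_uf:
  assumes p: "prime p" and r: "prime r" and k: "k \<le> m"
    and ord: "\<And>z N. ord z dvd N \<longleftrightarrow> nmul N z \<in> mixed_lattice p m r n"
  shows "\<exists>(N :: nat) v. uf (mixed_lattice p m r n) v {..<N} \<and> (\<forall>i<N. v i \<notin> mixed_lattice p m r n \<and> int (p ^ (m - k)) dvd v i 0) \<and>
    real n + (\<Sum>j<k. 1 / real p ^ j) \<le> (\<Sum>i<N. 1 / real (ord (v i)))"
  using k
proof (induction k)
  case 0
  obtain N :: nat and v where "uf (mixed_lattice p m r n) v {..<N}"
    "\<forall>i<N. v i \<notin> mixed_lattice p m r n \<and> v i 0 = 0 \<and> (\<forall>l>n. v i l = 0)"
    "real n \<le> (\<Sum>i<N. 1 / real (ord (v i)))"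
    using unit_vector_blocks[OF p r le_refl ord] by (elim exE conjE)
  then show ?case by (intro exI[of _ N] exI[of _ v]) simp
next
  case (Suc k)
  then have "k \<le> m" by simp
  from Suc.IH[OF this] obtain N :: nat and v where v1: "uf (mixed_lattice p m r n) v {..<N}"
    and v2: "\<forall>i<N. v i \<notin> mixed_lattice p m r n \<and> int (p ^ (m - k)) dvd v i 0"
    and v3: "real n + (\<Sum>j<k. 1 / real p ^ j) \<le> (\<Sum>i<N. 1 / real (ord (v i)))" by (elim exE conjE)
  note v = v1 v2[rule_format] v3
  define c where "c = int (p ^ (m - Suc k))"
  have p1: "1 < p" using p prime_gt_1_nat by blast
  have c0: "c > 0" using p1 by (simp add: c_def)
  have cp: "int (p ^ (m - k)) = int p * c"
    unfolding c_def using Suc.prems by (simp add: Suc_diff_Suc flip: power_Suc)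
  have cm: "int (p ^ m) = c * int (p ^ Suc k)"
    unfolding c_def of_nat_mult[symmetric] power_add[symmetric] using Suc.prems by simp
  \<comment> \<open>The entry \<open>1 - int p\<close> is congruent to 1 modulo \<open>p\<close>
    like the others, but makes the block sum exactly 0.\<close>
  define x where "x b = (if b = 0 then 1 - int p else 1)" for b :: nat
  define w where "w b l = (if l = 0 then c * x b else 0)" for b and l :: nat
  define u where "u i = (if i < N then v i else w (i - N))" for i
  have px: "\<not> int p dvd x b" for b
    using p1 by (auto simp: x_def dvd_diff_left_iff)
  have sx: "(\<Sum>b\<in>I. x b) = int (card I) - (if 0 \<in> I then int p else 0)" if "finite I" for I
  proof -
    have "(\<Sum>b\<in>I. x b) = (\<Sum>b\<in>I. 1 - (if b = 0 then int p else 0))" by (rule sum.cong) (auto simp: x_def)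
    then show ?thesis using that by (simp add: sum_subtractf)
  qed
  have sw: "sum w I 0 = c * (\<Sum>b\<in>I. x b)" "0 < l \<Longrightarrow> sum w I l = 0" for I l
    by (simp_all add: sum_fun_apply w_def sum_distrib_left)
  have pk: "int p * c dvd int (p ^ m)"
    unfolding cm by simp
  have wK: "w b \<notin> mixed_lattice p m r n" for b
  proof
    assume "w b \<in> mixed_lattice p m r n"
    then have "int (p ^ m) dvd c * x b" by (simp add: mixed_lattice_def w_def)
    from dvd_trans[OF pk this] have "c * int p dvd c * x b" by (simp only: mult.commute[of "int p" c])
    then show False using c0 px by simp
  qed
  have "uf (mixed_lattice p m r n) u {..<N + p}"
    unfolding u_def[abs_def]
  proof (rule uf_add_block[OF subgrp_mixed_lattice, where M = "{z. int p * c dvd z 0}" and w = w])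
    show "subgrp {z :: nat \<Rightarrow> int. int p * c dvd z 0}" by (simp add: subgrp_def)
    show "v i \<in> {z. int p * c dvd z 0}" if "i < N" for i using v(2)[OF that] cp by simp
    have "(\<Sum>b<p. x b) = 0" using p1 by (simp add: sx)
    then show "sum w {..<p} \<in> mixed_lattice p m r n" by (simp add: mixed_lattice_def sw)
    fix y :: "nat \<Rightarrow> int" and I
    assume y: "y \<in> {z. int p * c dvd z 0}" and I: "I \<subseteq> {..<p}" and z: "y + sum w I \<in> mixed_lattice p m r n"
    have fI: "finite I" using I finite_subset by blast
    have "int (p ^ m) dvd y 0 + c * (\<Sum>b\<in>I. x b)" using z by (simp add: mixed_lattice_def sw)
    from dvd_trans[OF pk this] have "c * int p dvd y 0 + c * (\<Sum>b\<in>I. x b)"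
      by (simp only: mult.commute[of "int p" c])
    moreover have "c * int p dvd y 0" using y by (simp add: mult.commute)
    ultimately have "c * int p dvd c * (\<Sum>b\<in>I. x b)" by (simp only: dvd_add_right_iff)
    then have "int p dvd (\<Sum>b\<in>I. x b)" using c0 by simp
    then have "int p dvd int (card I)" unfolding sx[OF fI] by (simp add: dvd_diff_left_iff split: if_splits)
    then have "p dvd card I" by simp
    moreover have "card I \<le> p" using card_mono[OF _ I] by simp
    ultimately have "card I = 0 \<or> card I = p" by (auto elim!: dvdE)
    then show "I = {} \<or> I = {..<p}"
      using fI I card_subset_eq[of "{..<p}" I] by auto
  qed (use v(1) in auto)
  moreover have "u i \<notin> mixed_lattice p m r n \<and> int (p ^ (m - Suc k)) dvd u i 0" if "i < N + p" for i
  proof -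
    have "c dvd v i 0" if "i < N" using v(2)[OF that] unfolding cp by (auto intro: dvd_mult_right)
    moreover have "c dvd w (i - N) 0" by (simp add: w_def)
    ultimately show ?thesis using v(2)[of i] wK by (auto simp: u_def c_def)
  qed
  moreover have "real n + (\<Sum>j<Suc k. 1 / real p ^ j) \<le> (\<Sum>i<N + p. 1 / real (ord (u i)))"
  proof -
    have ge: "1 / real p ^ Suc k \<le> 1 / real (ord (w b))" for b
    proof -
      have "ord (w b) dvd p ^ Suc k"
        using Suc.prems by (intro order_bound(5)[OF p r ord]) (auto simp: w_def c_def)
      then have "ord (w b) \<le> p ^ Suc k" using p1 by (intro dvd_imp_le) simp_all
      then have "real (ord (w b)) \<le> real p ^ Suc k" by (metis of_nat_le_iff of_nat_power)
      moreover have "0 < ord (w b)" using order_bound(1)[OF p r ord] .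
      ultimately show ?thesis by (intro frac_le) simp_all
    qed
    have "1 / real p ^ k = (\<Sum>b<p. 1 / real p ^ Suc k)" using p1 by simp
    also have "\<dots> \<le> (\<Sum>b<p. 1 / real (ord (w b)))" by (rule sum_mono) (rule ge)
    finally have *: "1 / real p ^ k \<le> (\<Sum>b<p. 1 / real (ord (w b)))" .
    have "(\<Sum>i<N + p. 1 / real (ord (u i))) =
        (\<Sum>i<N. 1 / real (ord (u i))) + (\<Sum>i\<in>{N..<N + p}. 1 / real (ord (u i)))"
      by (subst sum.atLeastLessThan_concat[of 0 N "N + p", symmetric, unfolded atLeast0LessThan]) simp_all
    also have "(\<Sum>i\<in>{N..<N + p}. 1 / real (ord (u i))) = (\<Sum>b<p. 1 / real (ord (w b)))"
      by (rule sum.reindex_bij_witness[of _ "\<lambda>b. b + N" "\<lambda>i. i - N"]) (auto simp: u_def)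
    also have "(\<Sum>i<N. 1 / real (ord (u i))) = (\<Sum>i<N. 1 / real (ord (v i)))"
      by (simp add: u_def)
    finally show ?thesis using v(3) * by simp
  qed
  ultimately show ?case by blast
qed

section \<open>From lattices to abstract groups\<close>

text \<open>The axioms say that \<open>rep\<close> induces an isomorphism from \<open>G\<close> onto
  the quotient by \<open>K\<close>. It is required to be additive only modulo \<open>K\<close>, as
  is the case for reduced residues.\<close>

locale coordinates = comm_group G for G :: "('a, 'b) monoid_scheme" (structure) +
  fixes K :: "(nat \<Rightarrow> int) set" and rep :: "'a \<Rightarrow> nat \<Rightarrow> int"
  assumes subgrp_K: "subgrp K"
    and rep_mult: "x \<in> carrier G \<Longrightarrow> y \<in> carrier G \<Longrightarrow> rep (x \<otimes> y) - (rep x + rep y) \<in> K"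
    and rep_one_iff: "x \<in> carrier G \<Longrightarrow> rep x \<in> K \<longleftrightarrow> x = \<one>"
    and rep_surj: "\<exists>x\<in>carrier G. rep x - z \<in> K"
begin

lemma rep_finprod:
  "finite I \<Longrightarrow> f \<in> I \<rightarrow> carrier G \<Longrightarrow> rep (finprod G f I) - (\<Sum>i\<in>I. rep (f i)) \<in> K"
proof (induction I rule: finite_induct)
  case empty
  then show ?case using rep_one_iff[of \<one>] by simp
next
  case (insert i I)
  have f: "f i \<in> carrier G" "f \<in> I \<rightarrow> carrier G" using insert.prems by auto
  then have c: "finprod G f I \<in> carrier G" by (intro finprod_closed)
  have "rep (f i \<otimes> finprod G f I) - (\<Sum>i\<in>insert i I. rep (f i)) =
      (rep (f i \<otimes> finprod G f I) - (rep (f i) + rep (finprod G f I))) +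
      (rep (finprod G f I) - (\<Sum>i\<in>I. rep (f i)))"
    using insert.hyps by (simp add: algebra_simps)
  also have "\<dots> \<in> K" using rep_mult[OF f(1) c] insert.IH[OF f(2)] by (rule subgrpD(2)[OF subgrp_K])
  finally show ?case unfolding finprod_insert[OF insert.hyps f(2,1)] .
qed

lemma diff_mem_iff: "x - y \<in> K \<Longrightarrow> x \<in> K \<longleftrightarrow> y \<in> K"
  using subgrp_add_cancel(2)[OF subgrp_K, of "x - y" y] by simp

lemma zero_sum_iff:
  assumes "set S \<subseteq> carrier G" "I \<subseteq> {..<length S}"
  shows "zero_sum G S I \<longleftrightarrow> (\<Sum>i\<in>I. rep (S ! i)) \<in> K"
proof -
  have f: "(\<lambda>i. S ! i) \<in> I \<rightarrow> carrier G" using assms nth_mem by blast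
  have fin: "finite I" using assms(2) finite_subset by blast
  have "finprod G (\<lambda>i. S ! i) I \<in> carrier G" using f by (rule finprod_closed)
  then show ?thesis
    unfolding zero_sum_def sigma_def using rep_one_iff diff_mem_iff[OF rep_finprod[OF fin f]] by simp
qed

lemma minimal_zero_sum_iff:
  assumes "set S \<subseteq> carrier G" "I \<subseteq> {..<length S}"
  shows "minimal_zero_sum G S I \<longleftrightarrow> minzs K (\<lambda>i. rep (S ! i)) I"
proof -
  have "zero_sum G S J \<longleftrightarrow> (\<Sum>i\<in>J. rep (S ! i)) \<in> K" if "J \<subseteq> I" for J
    using zero_sum_iff[OF assms(1)] that assms(2) by blast
  then show ?thesis unfolding minimal_zero_sum_def minzs_def by (metis order_refl psubset_imp_subset)
qed

lemma irreducible_factorization_iff: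
  assumes "set S \<subseteq> carrier G"
  shows "irreducible_factorization G S P \<longleftrightarrow>
    partition_on {..<length S} P \<and> (\<forall>B\<in>P. minzs K (\<lambda>i. rep (S ! i)) B)"
  unfolding irreducible_factorization_def
  using minimal_zero_sum_iff[OF assms] partition_onD1 by (metis Union_upper)

lemma ufim_iff:
  "ufim G S \<longleftrightarrow> set S \<subseteq> carrier G - {\<one>} \<and> uf K (\<lambda>i. rep (S ! i)) {..<length S}"
proof (cases "set S \<subseteq> carrier G - {\<one>}")
  case True
  then have S: "set S \<subseteq> carrier G" by blast
  let ?v = "\<lambda>i. rep (S ! i)"
  have z: "zero_sum G S {..<length S} \<longleftrightarrow> sum ?v {..<length S} \<in> K"
    by (rule zero_sum_iff[OF S order_refl])
  have "ufim G S \<longleftrightarrow> sum ?v {..<length S} \<in> K \<and>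
      (\<exists>!P. partition_on {..<length S} P \<and> (\<forall>B\<in>P. minzs K ?v B))"
    unfolding ufim_def irreducible_factorization_iff[OF S] z using True by simp
  also have "\<dots> \<longleftrightarrow> uf K ?v {..<length S}"
  proof
    assume "sum ?v {..<length S} \<in> K \<and> (\<exists>!P. partition_on {..<length S} P \<and> (\<forall>B\<in>P. minzs K ?v B))"
    then show "uf K ?v {..<length S}" by (intro uf_if_unique_factorization[OF subgrp_K]) simp_all
  next
    assume u: "uf K ?v {..<length S}"
    then have "sum ?v {..<length S} \<in> K" by (simp add: uf_def)
    then show "sum ?v {..<length S} \<in> K \<and> (\<exists>!P. partition_on {..<length S} P \<and> (\<forall>B\<in>P. minzs K ?v B))"
      using unique_factorization_if_uf[OF subgrp_K u] by (rule conjI)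
  qed
  finally show ?thesis using True by simp
qed (simp add: ufim_def)

lemma rep_pow: "x \<in> carrier G \<Longrightarrow> rep (x [^] (N :: nat)) - nmul N (rep x) \<in> K"
proof (induction N)
  case 0
  then show ?case using rep_one_iff[of \<one>] by simp
next
  case (Suc N)
  have "rep (x [^] N \<otimes> x) - nmul (Suc N) (rep x) =
      (rep (x [^] N \<otimes> x) - (rep (x [^] N) + rep x)) + (rep (x [^] N) - nmul N (rep x))"
    by (simp add: algebra_simps)
  also have "\<dots> \<in> K"
    by (rule subgrpD(2)[OF subgrp_K rep_mult Suc.IH]) (use Suc.prems in simp_all)
  finally show ?case unfolding nat_pow_Suc .
qed

lemma ord_dvd_iff: "x \<in> carrier G \<Longrightarrow> ord x dvd N \<longleftrightarrow> nmul N (rep x) \<in> K"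
  using pow_eq_id[of x N] rep_one_iff[of "x [^] N"] diff_mem_iff[OF rep_pow[of x N]] by simp

text \<open>A section of \<open>rep\<close> modulo \<open>K\<close>, through which the order becomes
  a function of integer vectors.\<close>

definition elt :: "(nat \<Rightarrow> int) \<Rightarrow> 'a" where
  "elt z = (SOME x. x \<in> carrier G \<and> rep x - z \<in> K)"

lemma elt: "elt z \<in> carrier G" "rep (elt z) - z \<in> K"
  using someI_ex[of "\<lambda>x. x \<in> carrier G \<and> rep x - z \<in> K"] rep_surj[of z] unfolding elt_def by blast+

lemma nmul_diff: "nmul N x - nmul N y = nmul N (x - y)" for x y :: "nat \<Rightarrow> int"
  by (rule ext) (simp add: nmul_apply right_diff_distrib)

lemma ord_elt_dvd_iff: "ord (elt z) dvd N \<longleftrightarrow> nmul N z \<in> K"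
proof -
  have "nmul N (rep (elt z)) - nmul N z \<in> K"
    unfolding nmul_diff by (rule subgrp_nmul[OF subgrp_K elt(2)])
  then show ?thesis using ord_dvd_iff[OF elt(1)] diff_mem_iff by blast
qed

lemma ord_elt_rep: "x \<in> carrier G \<Longrightarrow> ord (elt (rep x)) = ord x"
  using ord_elt_dvd_iff[of "rep x"] ord_dvd_iff[of x] by (intro dvd_antisym) (metis dvd_refl)+

lemma cross_number_eq:
  assumes "set S \<subseteq> carrier G"
  shows "cross_number G S = (\<Sum>i<length S. 1 / real (ord (elt (rep (S ! i)))))"
proof -
  have "cross_number G S = (\<Sum>i<length S. 1 / real (ord (S ! i)))"
    unfolding cross_number_def by (simp add: sum_list_sum_nth atLeast0LessThan)
  also have "\<dots> = (\<Sum>i<length S. 1 / real (ord (elt (rep (S ! i)))))"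
    using assms by (intro sum.cong) (auto simp: ord_elt_rep subsetD)
  finally show ?thesis .
qed

lemma K1_eq:
  assumes fin: "finite (carrier G)" and K: "K = mixed_lattice p m r n"
    and p: "prime p" and r: "prime r" and m: "0 < m"
    and rank: "r = 2 \<or> r = 3 \<or> (if r = p then Suc n else n) \<le> 2"
  shows "K1 G = real n + (\<Sum>j<m. 1 / real p ^ j)"
  unfolding K1_def
proof (rule Max_eqI)
  let ?V = "real n + (\<Sum>j<m. 1 / real p ^ j)"
  define od where "od z = ord (elt z)" for z
  have od: "od z dvd N \<longleftrightarrow> nmul N z \<in> mixed_lattice p m r n" for z N
    unfolding K[symmetric] od_def ord_elt_dvd_iff ..
  have le: "cross_number G S \<le> ?V" if S: "ufim G S" for S
  proof -
    have c: "set S \<subseteq> carrier G - {\<one>}" and u: "uf (mixed_lattice p m r n) (\<lambda>i. rep (S ! i)) {..<length S}"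
      using S unfolding ufim_iff K by blast+
    have "rep (S ! i) \<notin> mixed_lattice p m r n" if "i \<in> {..<length S}" for i
    proof -
      have "S ! i \<in> carrier G - {\<one>}" using c nth_mem[of i S] that by blast
      then show ?thesis using rep_one_iff[of "S ! i"] K by auto
    qed
    then have "(\<Sum>i<length S. 1 / real (od (rep (S ! i)))) \<le> ?V"
      using m u by (intro weight_bound[OF p r od rank]) auto
    then show ?thesis using c by (subst cross_number_eq) (auto simp: od_def)
  qed
  show "y \<le> ?V" if "y \<in> {cross_number G S |S. ufim G S}" for y using that le by auto
  have pr0: "0 < p ^ m * r" using p r prime_gt_0_nat by simp
  \<comment> \<open>Each member contributes at least \<open>1 / (p^m * r)\<close>, so the bound on
    the cross number limits the length. Only finitely many lists remain, and \<open>Max\<close> is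
    taken over a finite set.\<close>
  have "length S \<le> nat \<lceil>?V * real (p ^ m * r)\<rceil>" if S: "ufim G S" for S
  proof -
    have c: "set S \<subseteq> carrier G" using S by (auto simp: ufim_def)
    have "1 / real (p ^ m * r) \<le> 1 / real (od z)" for z
    proof -
      have "od z dvd p ^ m * r" by (rule order_bound(4)[OF p r od]) simp_all
      then have "od z \<le> p ^ m * r" using pr0 by (rule dvd_imp_le)
      moreover have "0 < od z" using order_bound(1)[OF p r od] .
      ultimately show ?thesis by (intro frac_le of_nat_mono) simp_all
    qed
    then have "(\<Sum>i<length S. 1 / real (p ^ m * r)) \<le> (\<Sum>i<length S. 1 / real (od (rep (S ! i))))"
      by (intro sum_mono)
    also have "\<dots> = cross_number G S" by (simp add: cross_number_eq[OF c] od_def)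
    also have "\<dots> \<le> ?V" using S by (rule le)
    finally have "real (length S) \<le> ?V * real (p ^ m * r)" using pr0 by (simp add: field_simps)
    then show ?thesis by linarith
  qed
  moreover have "set S \<subseteq> carrier G" if "ufim G S" for S using that by (auto simp: ufim_def)
  ultimately have "{cross_number G S |S. ufim G S} \<subseteq>
      cross_number G ` {S. set S \<subseteq> carrier G \<and> length S \<le> nat \<lceil>?V * real (p ^ m * r)\<rceil>}"
    by blast
  then show "finite {cross_number G S |S. ufim G S}"
    using finite_lists_length_le[OF fin] finite_surj by blast
  obtain N :: nat and v where v: "uf (mixed_lattice p m r n) v {..<N}"
    "\<forall>i<N. v i \<notin> mixed_lattice p m r n \<and> int (p ^ (m - m)) dvd v i 0"
    "?V \<le> (\<Sum>i<N. 1 / real (od (v i)))"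
    using extremal_uf[OF p r order_refl od] by (elim exE conjE)
  define S where "S = map (\<lambda>i. elt (v i)) [0..<N]"
  have len: "length S = N" and nth: "i < N \<Longrightarrow> S ! i = elt (v i)" for i by (simp_all add: S_def)
  have c: "set S \<subseteq> carrier G - {\<one>}"
  proof
    fix x assume "x \<in> set S"
    then obtain i where i: "i < N" "x = elt (v i)" by (auto simp: S_def)
    have "rep x \<notin> K" using v(2) i diff_mem_iff[OF elt(2)[of "v i"]] K by auto
    then show "x \<in> carrier G - {\<one>}" using i elt(1) rep_one_iff by auto
  qed
  have "uf K (\<lambda>i. rep (S ! i)) {..<N}"
  proof (rule uf_transfer[OF v(1)[folded K]])
    fix I assume I: "I \<subseteq> {..<N}"
    have "(\<Sum>i\<in>I. rep (S ! i)) - sum v I = (\<Sum>i\<in>I. rep (elt (v i)) - v i)"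
      unfolding sum_subtractf using I nth by (intro arg_cong2[where f = minus] sum.cong) auto
    also have "\<dots> \<in> K" using elt(2) by (intro subgrp_sum[OF subgrp_K])
    finally show "sum v I \<in> K \<longleftrightarrow> (\<Sum>i\<in>I. rep (S ! i)) \<in> K" using diff_mem_iff by blast
  qed
  then have S: "ufim G S" using c by (simp add: ufim_iff len)
  have "od (rep (S ! i)) = od (v i)" if "i < N" for i
    using that by (simp add: nth od_def ord_elt_rep elt(1))
  then have "cross_number G S = (\<Sum>i<N. 1 / real (od (v i)))"
    using c by (subst cross_number_eq) (auto simp: len od_def)
  then have "cross_number G S = ?V" using v(3) le[OF S] by simp
  then show "?V \<in> {cross_number G S |S. ufim G S}" using S by (intro CollectI exI[of _ S]) simp
qed

end

section \<open>Direct sums of cyclic groups in coordinates\<close>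

lemma mult_cyclic_sum:
  "x \<otimes>\<^bsub>cyclic_sum ds\<^esub> y = (\<lambda>i\<in>{..<length ds}. (x i + y i) mod int (fst (ds ! i) ^ snd (ds ! i)))"
  by (simp add: cyclic_sum_def product_group_def)

lemma carrier_cyclic_sum:
  assumes "\<And>i. i < length ds \<Longrightarrow> 0 < fst (ds ! i)"
  shows "carrier (cyclic_sum ds) = (\<Pi>\<^sub>E i\<in>{..<length ds}. {0..<int (fst (ds ! i) ^ snd (ds ! i))})"
  unfolding cyclic_sum_def carrier_product_group
proof (rule PiE_cong)
  fix i assume "i \<in> {..<length ds}"
  then have "fst (ds ! i) ^ snd (ds ! i) \<noteq> 0" using assms[of i] by simp
  then show "carrier (integer_mod_group (fst (ds ! i) ^ snd (ds ! i))) = {0..<int (fst (ds ! i) ^ snd (ds ! i))}"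
    by (simp only: carrier_integer_mod_group if_False)
qed

lemma one_cyclic_sum: "\<one>\<^bsub>cyclic_sum ds\<^esub> = (\<lambda>i\<in>{..<length ds}. 0)"
  by (simp add: cyclic_sum_def)

text \<open>Members of \<open>cyclic_sum\<close> are themselves integer-valued functions, so the
  isomorphism \<open>h\<close> serves as \<open>rep\<close>. The remaining identity with
  \<open>K1_star\<close> is a geometric sum.\<close>

lemma K1_eq_K1_star_of_iso:
  assumes G: "group G" and iso: "G \<cong> cyclic_sum ((p, m) # replicate n (r, 1))"
    and p: "prime p" and r: "prime r" and m: "0 < m"
    and rank: "r = 2 \<or> r = 3 \<or> (if r = p then Suc n else n) \<le> 2"
  shows "K1 G = K1_star G"
proof -
  define ds where "ds = (p, m) # replicate n (r, 1 :: nat)"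
  define c where "c i = fst (ds ! i) ^ snd (ds ! i)" for i
  have len: "length ds = Suc n" by (simp add: ds_def)
  have pos: "0 < fst (ds ! i)" if "i < length ds" for i
    using that p r prime_gt_0_nat by (cases i) (auto simp: ds_def)
  have c0: "c 0 = p ^ m" by (simp add: c_def ds_def)
  have cS: "c i = r" if "i \<in> {1..n}" for i using that by (cases i) (auto simp: c_def ds_def)
  have cpos: "0 < int (c i)" if "i < Suc n" for i using pos[of i] that by (simp add: c_def len)
  have mixed_lattice_iff: "z \<in> mixed_lattice p m r n \<longleftrightarrow> (\<forall>i<Suc n. int (c i) dvd z i)" for z
  proof -
    have "(\<forall>i<Suc n. Q i) \<longleftrightarrow> Q 0 \<and> (\<forall>i\<in>{1..n}. Q i)" for Q
      by (metis atLeastAtMost_iff less_Suc_eq_le less_one not_le zero_less_Suc)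
    then show ?thesis by (simp add: mixed_lattice_def c0 cS)
  qed
  let ?C = "cyclic_sum ds"
  have car: "carrier ?C = (\<Pi>\<^sub>E i\<in>{..<Suc n}. {0..<int (c i)})"
    using carrier_cyclic_sum[OF pos] by (simp add: len c_def)
  have mlt: "x \<otimes>\<^bsub>?C\<^esub> y = (\<lambda>i\<in>{..<Suc n}. (x i + y i) mod int (c i))" for x y
    by (simp add: mult_cyclic_sum len c_def)
  obtain h where h: "h \<in> iso G ?C" using iso by (auto simp: is_iso_def ds_def)
  have hom: "h x \<in> carrier ?C" "y \<in> carrier G \<Longrightarrow> h (x \<otimes>\<^bsub>G\<^esub> y) = h x \<otimes>\<^bsub>?C\<^esub> h y"
    if "x \<in> carrier G" for x y
    using h that by (auto simp: iso_def hom_def)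
  have bij: "bij_betw h (carrier G) (carrier ?C)" using h by (simp add: iso_def)
  interpret G: group G by (rule G)
  have comm: "comm_group G"
  proof (rule G.group_comm_groupI)
    fix x y assume xy: "x \<in> carrier G" "y \<in> carrier G"
    have "h (x \<otimes>\<^bsub>G\<^esub> y) = h (y \<otimes>\<^bsub>G\<^esub> x)" using hom xy by (simp add: mlt add.commute)
    then show "x \<otimes>\<^bsub>G\<^esub> y = y \<otimes>\<^bsub>G\<^esub> x"
      using bij xy by (auto simp: bij_betw_def dest: inj_onD)
  qed
  have h1: "h \<one>\<^bsub>G\<^esub> = (\<lambda>i\<in>{..<Suc n}. 0)"
  proof -
    have "h \<one>\<^bsub>G\<^esub> = \<one>\<^bsub>?C\<^esub>"
      using h G group_cyclic_sum by (intro hom_one) (auto simp: iso_def)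
    then show ?thesis by (simp add: one_cyclic_sum len)
  qed
  have "coordinates G (mixed_lattice p m r n) h"
  proof (intro coordinates.intro comm coordinates_axioms.intro subgrp_mixed_lattice)
    fix x y assume xy: "x \<in> carrier G" "y \<in> carrier G"
    have "int (c i) dvd (h (x \<otimes>\<^bsub>G\<^esub> y) - (h x + h y)) i" if "i < Suc n" for i
      using that by (simp add: hom(2)[OF xy] mlt mod_eq_dvd_iff[symmetric])
    then show "h (x \<otimes>\<^bsub>G\<^esub> y) - (h x + h y) \<in> mixed_lattice p m r n" unfolding mixed_lattice_iff by blast
  next
    fix x assume x: "x \<in> carrier G"
    have hx: "h x \<in> (\<Pi>\<^sub>E i\<in>{..<Suc n}. {0..<int (c i)})" using hom(1)[OF x] car by simp
    have "h x \<in> mixed_lattice p m r n \<longleftrightarrow> h x = h \<one>\<^bsub>G\<^esub>"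
    proof
      assume k: "h x \<in> mixed_lattice p m r n"
      have "h x i = 0" if "i < Suc n" for i
      proof -
        have "int (c i) dvd h x i" "0 \<le> h x i" "h x i < int (c i)"
          using k hx that unfolding mixed_lattice_iff by (auto simp: PiE_iff)
        then show ?thesis by (meson zdvd_not_zless not_less order_le_less)
      qed
      \<comment> \<open>The lattice says nothing about these coordinates. Extensionality fixes them,
        so that \<open>h x\<close> is determined by the first \<open>Suc n\<close>.\<close>
      moreover have "h x i = undefined" if "\<not> i < Suc n" for i using hx that by (auto simp: PiE_iff extensional_def)
      ultimately show "h x = h \<one>\<^bsub>G\<^esub>" unfolding h1 by (auto simp: restrict_def)
    next
      assume "h x = h \<one>\<^bsub>G\<^esub>"
      then show "h x \<in> mixed_lattice p m r n" unfolding mixed_lattice_iff h1 by simp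
    qed
    also have "\<dots> \<longleftrightarrow> x = \<one>\<^bsub>G\<^esub>" using bij x by (auto simp: bij_betw_def dest: inj_onD)
    finally show "h x \<in> mixed_lattice p m r n \<longleftrightarrow> x = \<one>\<^bsub>G\<^esub>" .
  next
    fix z :: "nat \<Rightarrow> int"
    define y where "y = (\<lambda>i\<in>{..<Suc n}. z i mod int (c i))"
    have "y \<in> carrier ?C" unfolding car y_def using cpos by (auto simp: PiE_iff)
    then obtain x where x: "x \<in> carrier G" "h x = y"
      using bij_betw_imp_surj_on[OF bij] by (metis (lifting) imageE)
    have "int (c i) dvd (y - z) i" if "i < Suc n" for i
      using that by (simp add: y_def mod_eq_dvd_iff[symmetric])
    then show "\<exists>x\<in>carrier G. h x - z \<in> mixed_lattice p m r n" using x unfolding mixed_lattice_iff by blast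
  qed
  moreover have "finite (carrier G)"
    using bij_betw_finite[OF bij] unfolding car by (simp add: finite_PiE)
  ultimately have K1: "K1 G = real n + (\<Sum>j<m. 1 / real p ^ j)"
    using coordinates.K1_eq[OF _ _ refl p r m rank] by blast
  have "prime_power_decomposition G ds"
    using p r m iso by (auto simp: prime_power_decomposition_def ds_def)
  then have "K1_star G = K1_star_of ds" by (rule K1_star_eq[OF G])
  also have "\<dots> = (real p ^ m - 1) / (real p ^ m - real p ^ (m - 1)) + real n * ((real r - 1) / (real r - 1))"
    by (simp add: K1_star_of_def ds_def sum_list_replicate)
  also have "(real p ^ m - 1) / (real p ^ m - real p ^ (m - 1)) = (\<Sum>j<m. 1 / real p ^ j)"
  proof -
    have p1: "real p > 1" using prime_gt_1_nat[OF p] by simp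
    obtain k where k: "m = Suc k" using m by (cases m) auto
    have "(\<Sum>j<m. (1 / real p) ^ j) = ((1 / real p) ^ m - 1) / (1 / real p - 1)"
      using p1 by (intro geometric_sum) auto
    also have "\<dots> = (real p ^ m - 1) / (real p ^ m - real p ^ (m - 1))"
      using p1 by (simp add: k field_simps)
    finally show ?thesis by (simp add: power_one_over)
  qed
  also have "(real r - 1) / (real r - 1) = 1" using prime_gt_1_nat[OF r] by simp
  finally show ?thesis using K1 by simp
qed

text \<open>The first factor becomes coordinate 0, and the coordinates of \<open>e\<close> are
  shifted by one.\<close>

lemma iso_cyclic_sum_Cons:
  assumes e: "e \<in> iso H (cyclic_sum ds)"
  shows "integer_mod_group (p ^ m) \<times>\<times> H \<cong> cyclic_sum ((p, m) # ds)"
proof -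
  let ?A = "integer_mod_group (p ^ m)" and ?C = "cyclic_sum ((p, m) # ds)"
  define f where "f = (\<lambda>(x, y). \<lambda>i\<in>{..<Suc (length ds)}. case i of 0 \<Rightarrow> x | Suc j \<Rightarrow> e y j)"
  have eh: "e y \<in> carrier (cyclic_sum ds)" if "y \<in> carrier H" for y using e that by (auto simp: iso_def hom_def)
  have em: "e (x \<otimes>\<^bsub>H\<^esub> y) = e x \<otimes>\<^bsub>cyclic_sum ds\<^esub> e y" if "x \<in> carrier H" "y \<in> carrier H" for x y
    using e that by (auto simp: iso_def hom_def)
  have eb: "bij_betw e (carrier H) (carrier (cyclic_sum ds))" using e by (simp add: iso_def)
  have carC: "carrier (cyclic_sum ds') = (\<Pi>\<^sub>E i\<in>{..<length ds'}. carrier (integer_mod_group (fst (ds' ! i) ^ snd (ds' ! i))))" for ds'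
    by (simp add: cyclic_sum_def)
  have "f \<in> iso (?A \<times>\<times> H) ?C"
  proof (rule isoI)
    show "f \<in> hom (?A \<times>\<times> H) ?C"
    proof (rule homI)
      fix u assume "u \<in> carrier (?A \<times>\<times> H)"
      then obtain x y where u: "u = (x, y)" "x \<in> carrier ?A" "y \<in> carrier H" by auto
      have "e y \<in> carrier (cyclic_sum ds)" using eh u by blast
      then show "f u \<in> carrier ?C"
        using u unfolding carC by (auto simp: f_def PiE_iff split: nat.split)
    next
      fix u v assume "u \<in> carrier (?A \<times>\<times> H)" "v \<in> carrier (?A \<times>\<times> H)"
      then obtain x y x' y' where uv: "u = (x, y)" "v = (x', y')" "y \<in> carrier H" "y' \<in> carrier H" by auto
      show "f (u \<otimes>\<^bsub>?A \<times>\<times> H\<^esub> v) = f u \<otimes>\<^bsub>?C\<^esub> f v"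
        unfolding uv mult_cyclic_sum
        by (rule ext) (auto simp: f_def em[OF uv(3,4)] mult_cyclic_sum restrict_def split: nat.split)
    qed
    show "bij_betw f (carrier (?A \<times>\<times> H)) (carrier ?C)"
    proof (rule bij_betwI')
      fix u v assume uv: "u \<in> carrier (?A \<times>\<times> H)" "v \<in> carrier (?A \<times>\<times> H)"
      obtain x y where u: "u = (x, y)" "y \<in> carrier H" using uv by auto
      obtain x' y' where v: "v = (x', y')" "y' \<in> carrier H" using uv by auto
      show "f u = f v \<longleftrightarrow> u = v"
      proof
        assume eq: "f u = f v"
        have "x = x'" using fun_cong[OF eq, of 0] u v by (simp add: f_def)
        moreover have "e y = e y'"
        proof (rule PiE_ext)
          show "e y \<in> (\<Pi>\<^sub>E i\<in>{..<length ds}. carrier (integer_mod_group (fst (ds ! i) ^ snd (ds ! i))))"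
            "e y' \<in> (\<Pi>\<^sub>E i\<in>{..<length ds}. carrier (integer_mod_group (fst (ds ! i) ^ snd (ds ! i))))"
            using eh u v carC by metis+
          show "e y i = e y' i" if "i \<in> {..<length ds}" for i
            using fun_cong[OF eq, of "Suc i"] u v that by (simp add: f_def)
        qed
        then have "y = y'" using eb u(2) v(2) by (auto simp: bij_betw_def dest: inj_onD)
        ultimately show "u = v" using u v by simp
      qed simp
    next
      fix u assume "u \<in> carrier (?A \<times>\<times> H)"
      then obtain x y where u: "u = (x, y)" "x \<in> carrier ?A" "y \<in> carrier H" by auto
      have "e y \<in> carrier (cyclic_sum ds)" using eh u by blast
      then show "f u \<in> carrier ?C"
        using u unfolding carC by (auto simp: f_def PiE_iff split: nat.split)
    next
      fix z assume z: "z \<in> carrier ?C"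
      define w where "w = (\<lambda>i\<in>{..<length ds}. z (Suc i))"
      have "z (Suc i) \<in> carrier (integer_mod_group (fst (ds ! i) ^ snd (ds ! i)))" if "i < length ds" for i
        using z that unfolding carC by (auto dest!: PiE_mem[of _ _ _ "Suc i"])
      then have "w \<in> carrier (cyclic_sum ds)" unfolding carC w_def by (auto simp: PiE_iff)
      then obtain y where y: "y \<in> carrier H" "e y = w"
        using bij_betw_imp_surj_on[OF eb] by (metis (lifting) imageE)
      have "z 0 \<in> carrier ?A" using z unfolding carC by (auto dest!: PiE_mem[of _ _ _ 0])
      moreover have "z = f (z 0, y)"
      proof
        fix i
        show "z i = f (z 0, y) i"
          using z y unfolding carC by (cases i) (auto simp: f_def w_def PiE_iff extensional_def)
      qed
      ultimately show "\<exists>u\<in>carrier (?A \<times>\<times> H). z = f u" using y by (intro bexI[of _ "(z 0, y)"]) auto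
    qed
  qed
  then show ?thesis by (auto simp: is_iso_def)
qed

lemma product_group_cong:
  "I = J \<Longrightarrow> (\<And>i. i \<in> J \<Longrightarrow> G i = H i) \<Longrightarrow> product_group I G = product_group J H"
  unfolding product_group_def
  by (auto cong: PiE_cong restrict_cong)

lemma iso_product_group_cyclic_sum:
  "(\<lambda>x. x) \<in> iso (product_group {..<n} (\<lambda>_. integer_mod_group r)) (cyclic_sum (replicate n (r, 1)))"
proof -
  have "cyclic_sum (replicate n (r, 1)) = product_group {..<n} (\<lambda>_. integer_mod_group r)"
    unfolding cyclic_sum_def by (rule product_group_cong) simp_all
  then show ?thesis by (simp add: iso_def hom_def bij_betw_def)
qed

lemma iso_integer_mod_group_cyclic_sum:
  "(\<lambda>x. \<lambda>i\<in>{..<1}. x) \<in> iso (integer_mod_group r) (cyclic_sum (replicate 1 (r, 1)))"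
proof (rule isoI)
  show "(\<lambda>x. \<lambda>i\<in>{..<1}. x) \<in> hom (integer_mod_group r) (cyclic_sum (replicate 1 (r, 1)))"
    by (rule homI) (auto simp: cyclic_sum_def fun_eq_iff)
  show "bij_betw (\<lambda>x. \<lambda>i\<in>{..<1}. x) (carrier (integer_mod_group r)) (carrier (cyclic_sum (replicate 1 (r, 1))))"
  proof (rule bij_betwI')
    show "((\<lambda>i\<in>{..<1::nat}. x) = (\<lambda>i\<in>{..<1}. y)) \<longleftrightarrow> x = y" for x y :: int
      by (auto simp: fun_eq_iff)
    show "(\<lambda>i\<in>{..<1}. x) \<in> carrier (cyclic_sum (replicate 1 (r, 1)))" if "x \<in> carrier (integer_mod_group r)" for x
      using that by (auto simp: cyclic_sum_def)
    show "\<exists>x\<in>carrier (integer_mod_group r). z = (\<lambda>i\<in>{..<1}. x)"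
      if "z \<in> carrier (cyclic_sum (replicate 1 (r, 1)))" for z
      using that by (intro bexI[of _ "z 0"]) (auto simp: cyclic_sum_def fun_eq_iff PiE_iff extensional_def)
  qed
qed

lemma K1_eq_K1_star_DirProd:
  assumes H: "group H" and e: "e \<in> iso H (cyclic_sum (replicate n (r, 1)))"
    and p: "prime p" and r: "prime r" and m: "0 < m"
    and rank: "r = 2 \<or> r = 3 \<or> (if r = p then Suc n else n) \<le> 2"
  shows "K1 (integer_mod_group (p ^ m) \<times>\<times> H) = K1_star (integer_mod_group (p ^ m) \<times>\<times> H)"
  by (rule K1_eq_K1_star_of_iso[OF _ iso_cyclic_sum_Cons[OF e] p r m rank])
    (simp add: DirProd_group H)

theorem corollary7:
  fixes p q m n :: nat
  assumes "prime p" "prime q" "p \<noteq> q" "0 < m" "0 < n"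
  shows "(let G = integer_mod_group (p ^ m) \<times>\<times> integer_mod_group p
            in K1 G = K1_star G) \<and>
         (let G = integer_mod_group (p ^ m) \<times>\<times> integer_mod_group q
            in K1 G = K1_star G) \<and>
         (let G = integer_mod_group (p ^ m) \<times>\<times> product_group {..<2::nat} (\<lambda>_. integer_mod_group q)
            in K1 G = K1_star G) \<and>
         (let G = integer_mod_group (p ^ m) \<times>\<times> product_group {..<n} (\<lambda>_. integer_mod_group 2)
            in K1 G = K1_star G) \<and>
         (let G = integer_mod_group (p ^ m) \<times>\<times> product_group {..<n} (\<lambda>_. integer_mod_group 3)
            in K1 G = K1_star G)"
  unfolding Let_def
proof (intro conjI)
  \<comment> \<open>With one component of order \<open>r\<close> the relevant rank is 2 for
    \<open>r = p\<close> and 1 otherwise, so every prime is admissible.\<close>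
  have one: "K1 (integer_mod_group (p ^ m) \<times>\<times> integer_mod_group r) =
      K1_star (integer_mod_group (p ^ m) \<times>\<times> integer_mod_group r)" if "prime r" for r
    using assms(1,4) that by (intro K1_eq_K1_star_DirProd[OF _ iso_integer_mod_group_cyclic_sum]) auto
  show "K1 (integer_mod_group (p ^ m) \<times>\<times> integer_mod_group p) =
      K1_star (integer_mod_group (p ^ m) \<times>\<times> integer_mod_group p)"
    "K1 (integer_mod_group (p ^ m) \<times>\<times> integer_mod_group q) =
      K1_star (integer_mod_group (p ^ m) \<times>\<times> integer_mod_group q)"
    by (rule one, rule assms)+
  \<comment> \<open>For two components of order \<open>q\<close> the condition holds because
    \<open>q \<noteq> p\<close> keeps the rank at 2. For \<open>r = 2\<close> and
    \<open>r = 3\<close> it holds for every \<open>k\<close>, also when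
    \<open>p = r\<close>.\<close>
  have "K1 (integer_mod_group (p ^ m) \<times>\<times> product_group {..<k} (\<lambda>_. integer_mod_group r)) =
      K1_star (integer_mod_group (p ^ m) \<times>\<times> product_group {..<k} (\<lambda>_. integer_mod_group r))"
    if "prime r" "r = 2 \<or> r = 3 \<or> (if r = p then Suc k else k) \<le> 2" for k r
    using assms(1,4) that by (intro K1_eq_K1_star_DirProd[OF _ iso_product_group_cyclic_sum]) auto
  then show "K1 (integer_mod_group (p ^ m) \<times>\<times> product_group {..<2::nat} (\<lambda>_. integer_mod_group q)) =
      K1_star (integer_mod_group (p ^ m) \<times>\<times> product_group {..<2::nat} (\<lambda>_. integer_mod_group q))"
    "K1 (integer_mod_group (p ^ m) \<times>\<times> product_group {..<n} (\<lambda>_. integer_mod_group 2)) =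
      K1_star (integer_mod_group (p ^ m) \<times>\<times> product_group {..<n} (\<lambda>_. integer_mod_group 2))"
    "K1 (integer_mod_group (p ^ m) \<times>\<times> product_group {..<n} (\<lambda>_. integer_mod_group 3)) =
      K1_star (integer_mod_group (p ^ m) \<times>\<times> product_group {..<n} (\<lambda>_. integer_mod_group 3))"
    using assms(2,3) by auto
qed

end
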